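(* There do not exist $d \in \mathbb{N}$ and a map $b: \mathbb{D} \to \mathbb{B}_d$ that induces a surjective homomorphism $$\operatorname{Mult}(H^2_d) \to \operatorname{Mult}(\mathcal{D}), \quad \varphi \mapsto \varphi \circ b.$$ That is, for no $d\in\mathbb{N}$ and no map $b:\mathbb{D}\to\mathbb{B}_d$ is it the case that $\varphi\circ b\in \operatorname{Mult}(\mathcal{D})$ for every $\varphi\in\operatorname{Mult}(H^2_d)$ and every element of $\operatorname{Mult}(\mathcal{D})$ is of this form.
   Context: $\mathbb{N}=\{1,2,3,\dots\}$; $\mathbb{D}$ is the open unit disc in $\mathbb{C}$ and $\mathbb{B}_d$ is the open Euclidean unit ball of $\mathbb{C}^d$. The Dirichlet space is $\mathcal{D} = \{f \text{ holomorphic on } \mathbb{D} : \int_{\mathbb{D}} |f'|^2\, dA < \infty\}$, where $dA$ is normalized area measure on $\mathbb{D}$, with norm $\|f\|^2 = \int_{\mathbb{D}} |f'|^2\, dA + \|f\|_{H^2}^2$, where $\|f\|_{H^2}^2=\sup_{0\le r<1}\int_0^{2\pi}|f(re^{it})|^2\frac{dt}{2\pi}$; it is the reproducing kernel Hilbert space on $\mathbb{D}$ with kernel $k(z,w) = \frac{1}{z\overline{w}} \log\big(\frac{1}{1-z\overline{w}}\big)$ (equal to $1$ when $z\overline w=0$). The Drury--Arveson space $H^2_d$ is the reproducing kernel Hilbert space on $\mathbb{B}_d$ with kernel $K(z,w) = \frac{1}{1-\langle z,w\rangle}$. For a reproducing kernel Hilbert space $\mathcal{H}$ of functions on a set $X$,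 $\operatorname{Mult}(\mathcal{H})$ is the algebra of all functions $\varphi: X\to\mathbb{C}$ with $\varphi f \in \mathcal{H}$ for all $f\in\mathcal{H}$, normed by the operator norm of $f\mapsto \varphi f$. *)

theory Defs
  imports "HOL-Analysis.Analysis" "HOL-Complex_Analysis.Complex_Analysis"
begin

text \<open>
  A complex-valued function on a set \<open>X\<close> is encoded as a total function vanishing
  off \<open>X\<close>. This makes the encoding unique and compatible with pointwise operations.
\<close>

definition functions_on :: "'a set \<Rightarrow> ('a \<Rightarrow> complex) set" where
  "functions_on X = {f. \<forall>x. x \<notin> X \<longrightarrow> f x = 0}"

definition on_set :: "'a set \<Rightarrow> ('a \<Rightarrow> complex) \<Rightarrow> 'a \<Rightarrow> complex" where
  "on_set X f = (\<lambda>x. if x \<in> X then f x else 0)"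

locale hilbert_function_space =
  fixes X :: "'a set"
    and H :: "('a \<Rightarrow> complex) set"
    and ip :: "('a \<Rightarrow> complex) \<Rightarrow> ('a \<Rightarrow> complex) \<Rightarrow> complex"
  assumes subset: "H \<subseteq> functions_on X"
    and zero_mem: "(\<lambda>x. 0) \<in> H"
    and add_mem: "\<And>f g. f \<in> H \<Longrightarrow> g \<in> H \<Longrightarrow> (\<lambda>x. f x + g x) \<in> H"
    and scale_mem: "\<And>c f. f \<in> H \<Longrightarrow> (\<lambda>x. c * f x) \<in> H"
    and ip_add: "\<And>f g h. f \<in> H \<Longrightarrow> g \<in> H \<Longrightarrow> h \<in> H \<Longrightarrow>
                   ip (\<lambda>x. f x + g x) h = ip f h + ip g h"
    and ip_scale: "\<And>c f g. f \<in> H \<Longrightarrow> g \<in> H \<Longrightarrow> ip (\<lambda>x. c * f x) g = c * ip f g"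
    and ip_sym: "\<And>f g. f \<in> H \<Longrightarrow> g \<in> H \<Longrightarrow> ip g f = cnj (ip f g)"
    and ip_nonneg: "\<And>f. f \<in> H \<Longrightarrow> 0 \<le> Re (ip f f)"
    and ip_definite: "\<And>f. f \<in> H \<Longrightarrow> ip f f = 0 \<Longrightarrow> f = (\<lambda>x. 0)"
    and complete: "\<And>F :: nat \<Rightarrow> 'a \<Rightarrow> complex.
      (\<And>n. F n \<in> H) \<Longrightarrow>
      (\<And>e. e > 0 \<Longrightarrow> \<exists>N. \<forall>m\<ge>N. \<forall>n\<ge>N.
         sqrt (Re (ip (\<lambda>x. F m x - F n x) (\<lambda>x. F m x - F n x))) < e) \<Longrightarrow>
      \<exists>f\<in>H. (\<lambda>n. sqrt (Re (ip (\<lambda>x. F n x - f x) (\<lambda>x. F n x - f x)))) \<longlonglongrightarrow> 0"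

text \<open>
  \<open>H\<close> with inner product \<open>ip\<close> is the reproducing kernel Hilbert space on \<open>X\<close> with
  kernel \<open>K\<close>; by Moore--Aronszajn this determines \<open>H\<close>, and \<open>ip\<close> on \<open>H\<close>, uniquely.
\<close>

locale rkhs = hilbert_function_space X H ip
  for X :: "'a set" and H ip +
  fixes K :: "'a \<Rightarrow> 'a \<Rightarrow> complex"
  assumes kernel_mem: "\<And>w. w \<in> X \<Longrightarrow> on_set X (\<lambda>z. K z w) \<in> H"
    and reproducing: "\<And>f w. f \<in> H \<Longrightarrow> w \<in> X \<Longrightarrow> f w = ip f (on_set X (\<lambda>z. K z w))"

definition Mult :: "'a set \<Rightarrow> ('a \<Rightarrow> complex) set \<Rightarrow> ('a \<Rightarrow> complex) set" where
  "Mult X H = {\<phi> \<in> functions_on X. \<forall>f\<in>H. (\<lambda>x. \<phi> x * f x) \<in> H}"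

definition cdot :: "complex ^ 'n \<Rightarrow> complex ^ 'n \<Rightarrow> complex" where
  "cdot z w = (\<Sum>i\<in>UNIV. z $ i * cnj (w $ i))"

definition drury_arveson_kernel :: "complex ^ 'n \<Rightarrow> complex ^ 'n \<Rightarrow> complex" where
  "drury_arveson_kernel z w = 1 / (1 - cdot z w)"

definition is_drury_arveson_space ::
  "(complex ^ 'n \<Rightarrow> complex) set \<Rightarrow>
   ((complex ^ 'n \<Rightarrow> complex) \<Rightarrow> (complex ^ 'n \<Rightarrow> complex) \<Rightarrow> complex) \<Rightarrow> bool" where
  "is_drury_arveson_space H ip \<longleftrightarrow> rkhs (ball 0 1) H ip drury_arveson_kernel"

text \<open>
  The factor \<open>1 / pi\<close> normalizes Lebesgue measure on the complex plane so that the
  unit disc has area \<open>1\<close>.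
\<close>

definition dirichlet_integral :: "(complex \<Rightarrow> complex) \<Rightarrow> ennreal" where
  "dirichlet_integral f =
     ennreal (1 / pi) * (\<integral>\<^sup>+ z \<in> ball 0 1. ennreal ((cmod (deriv f z))\<^sup>2) \<partial>lborel)"

definition dirichlet_space :: "(complex \<Rightarrow> complex) set" where
  "dirichlet_space = {f \<in> functions_on (ball 0 1).
     f holomorphic_on ball 0 1 \<and> dirichlet_integral f < \<infinity>}"

end

theory Submission
  imports Defs
begin

text \<open>
  Let \<open>kdist\<close> be the distance of a reproducing kernel Hilbert space given by the sine of the angle
  between kernel functions. Two facts about it are incompatible with a surjective composition
  homomorphism.
  
  In the Dirichlet space there are, for all \<open>0 < d < 1\<close> and every \<open>N\<close>, points \<open>z 0, \<dots>, z (N - 1)\<close> whose mutual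
  distances all lie between \<open>d / 2\<close> and \<open>d\<close> (\<open>dirichlet_nearly_equilateral\<close>). The reason is that the
  kernel is logarithmic: for points with \<open>1 - |z|\<^sup>2 = \<epsilon>\<close> at angles of order \<open>\<epsilon>\<^sup>a\<close> the normalized
  kernel is about \<open>a\<close>, whatever the constants. In the unit ball of a finite-dimensional space, on the other
  hand, \<open>kdist\<close> is the pseudohyperbolic distance, and only boundedly many points with mutual distances
  at least \<open>c\<close> can lie within distance \<open>1 / 2\<close> of one of them: move that one to the centre by an
  automorphism and use compactness (\<open>drury_arveson_packing\<close>).
  
  The link is \<open>kdist_transfer\<close>. Composition with \<open>b\<close> mapping multipliers to multipliers forces
  \<open>kdist (b z) (b w) < 1 / 2\<close> once \<open>kdist z w < d\<close> for some \<open>d > 0\<close>; surjectivity forces conversely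
  \<open>kdist (b z) (b w) \<ge> c\<close> whenever \<open>kdist z w \<ge> d / 2\<close>, for some \<open>c > 0\<close>. Hence the points \<open>b (z i)\<close> violate the
  packing bound for large \<open>N\<close>. With the open mapping theorem these statements would be immediate; here
  they are proved directly by a gliding hump argument along sequences of pairs of points. It needs two
  things of the spaces: functions that are large along a whole sequence, which exist because the
  kernels have positive real part (\<open>large_along_sequence\<close>), and multipliers of uniformly bounded norm that
  separate points. The latter are the normalized kernel functions; they are multipliers of norm at most
  \<open>2\<close> because both kernels have the form \<open>1 / (1 - L)\<close> with \<open>L\<close> positive, the complete Pick property
  (\<open>mult_bound_normalized_kernel\<close>). For the Dirichlet space \<open>L\<close> has nonnegative coefficients by Kaluza's
  lemma (\<open>renewal_coeff_nonneg\<close>).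
\<close>

section \<open>Geometry of Hilbert function spaces\<close>

context hilbert_function_space
begin

definition nrm :: "('a \<Rightarrow> complex) \<Rightarrow> real" where
  "nrm f = sqrt (Re (ip f f))"

lemma diff_mem: "f \<in> H \<Longrightarrow> g \<in> H \<Longrightarrow> (\<lambda>x. f x - g x) \<in> H"
  using add_mem[of f "\<lambda>x. - 1 * g x"] scale_mem[of g "-1"] by simp

lemma sum_mem: "finite F \<Longrightarrow> (\<And>i. i \<in> F \<Longrightarrow> f i \<in> H) \<Longrightarrow> (\<lambda>x. \<Sum>i\<in>F. f i x) \<in> H"
  by (induction F rule: finite_induct) (auto intro: zero_mem add_mem)

lemma ip_zero_left: "g \<in> H \<Longrightarrow> ip (\<lambda>x. 0) g = 0"
  using ip_scale[of g g 0] by simp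

lemma ip_diff: "f \<in> H \<Longrightarrow> g \<in> H \<Longrightarrow> h \<in> H \<Longrightarrow> ip (\<lambda>x. f x - g x) h = ip f h - ip g h"
  using ip_add[of f "\<lambda>x. -1 * g x" h] ip_scale[of g h "-1"] scale_mem[of g "-1"] by simp

lemma ip_sum:
  assumes "finite F" "\<And>i. i \<in> F \<Longrightarrow> f i \<in> H" "h \<in> H"
  shows "ip (\<lambda>x. \<Sum>i\<in>F. f i x) h = (\<Sum>i\<in>F. ip (f i) h)"
  using assms
proof (induction F rule: finite_induct)
  case empty
  then show ?case by (simp add: ip_zero_left)
next
  case (insert i F)
  then have "(\<lambda>x. \<Sum>i\<in>F. f i x) \<in> H"
    by (intro sum_mem) auto
  with insert show ?case
    using ip_add[of "f i" "\<lambda>x. \<Sum>i\<in>F. f i x" h] by simp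
qed

lemma ip_add_right:
  assumes "f \<in> H" "g \<in> H" "h \<in> H"
  shows "ip h (\<lambda>x. f x + g x) = ip h f + ip h g"
proof -
  have "ip h (\<lambda>x. f x + g x) = cnj (ip (\<lambda>x. f x + g x) h)"
    using ip_sym[of "\<lambda>x. f x + g x" h] add_mem assms by blast
  also have "\<dots> = cnj (ip f h) + cnj (ip g h)"
    using ip_add assms by simp
  finally show ?thesis
    using ip_sym[of f h] ip_sym[of g h] assms by simp
qed

lemma ip_scale_right:
  assumes "f \<in> H" "h \<in> H"
  shows "ip h (\<lambda>x. c * f x) = cnj c * ip h f"
proof -
  have "ip h (\<lambda>x. c * f x) = cnj (ip (\<lambda>x. c * f x) h)"
    using ip_sym[of "\<lambda>x. c * f x" h] scale_mem assms by blast
  then show ?thesis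
    using ip_scale[of f h c] ip_sym[of f h] assms by simp
qed

lemma ip_diff_right:
  assumes "f \<in> H" "g \<in> H" "h \<in> H"
  shows "ip h (\<lambda>x. f x - g x) = ip h f - ip h g"
proof -
  have "ip h (\<lambda>x. f x - g x) = cnj (ip (\<lambda>x. f x - g x) h)"
    using ip_sym[of "\<lambda>x. f x - g x" h] diff_mem assms by blast
  also have "\<dots> = cnj (ip f h) - cnj (ip g h)"
    using ip_diff assms by simp
  finally show ?thesis
    using ip_sym[of f h] ip_sym[of g h] assms by simp
qed

lemma ip_self: "f \<in> H \<Longrightarrow> ip f f = of_real ((nrm f)\<^sup>2)"
proof -
  assume f: "f \<in> H"
  have "Im (ip f f) = 0"
    using ip_sym[OF f f] by (metis Im_complex_of_real Reals_cnj_iff complex_is_Real_iff)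
  then show ?thesis
    using ip_nonneg[OF f] by (simp add: nrm_def complex_eq_iff)
qed

lemma nrm_nonneg: "f \<in> H \<Longrightarrow> 0 \<le> nrm f"
  using ip_nonneg by (simp add: nrm_def)

lemma nrm_scale: "f \<in> H \<Longrightarrow> nrm (\<lambda>x. c * f x) = cmod c * nrm f"
proof -
  assume f: "f \<in> H"
  have "ip (\<lambda>x. c * f x) (\<lambda>x. c * f x) = c * (cnj c * ip f f)"
    using f by (simp add: ip_scale ip_scale_right scale_mem)
  also have "\<dots> = of_real ((cmod c * nrm f)\<^sup>2)"
    using f by (simp add: ip_self power_mult_distrib complex_norm_square mult.assoc[symmetric]
        del: of_real_power)
  finally have "Re (ip (\<lambda>x. c * f x) (\<lambda>x. c * f x)) = (cmod c * nrm f)\<^sup>2"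
    by (metis Re_complex_of_real)
  then show ?thesis
    using nrm_nonneg[OF f] unfolding nrm_def[of "\<lambda>x. c * f x"] by (simp only: real_sqrt_abs) simp
qed

lemma nrm_add_sq:
  assumes "f \<in> H" "g \<in> H"
  shows "(nrm (\<lambda>x. f x + g x))\<^sup>2 = (nrm f)\<^sup>2 + (nrm g)\<^sup>2 + 2 * Re (ip f g)"
proof -
  have "ip (\<lambda>x. f x + g x) (\<lambda>x. f x + g x) = (ip f f + ip f g) + (cnj (ip f g) + ip g g)"
    using assms ip_sym[of f g] by (simp add: ip_add ip_add_right add_mem)
  then have "of_real ((nrm (\<lambda>x. f x + g x))\<^sup>2) = (ip f f + ip f g) + (cnj (ip f g) + ip g g)"
    using ip_self[OF add_mem[OF assms]] by simp
  then have "Re (of_real ((nrm (\<lambda>x. f x + g x))\<^sup>2))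
      = Re ((ip f f + ip f g) + (cnj (ip f g) + ip g g))"
    by presburger
  then show ?thesis
    using assms by (simp add: ip_self)
qed

lemma nrm_diff_sq:
  assumes "f \<in> H" "g \<in> H"
  shows "(nrm (\<lambda>x. f x - g x))\<^sup>2 = (nrm f)\<^sup>2 + (nrm g)\<^sup>2 - 2 * Re (ip f g)"
  using nrm_add_sq[of f "\<lambda>x. - 1 * g x"] nrm_scale[of g "-1"] ip_scale_right[of g f "-1"]
    scale_mem[of g "-1"] assms by simp

lemma cauchy_schwarz:
  assumes f: "f \<in> H" and g: "g \<in> H"
  shows "cmod (ip f g) \<le> nrm f * nrm g"
proof (cases "nrm g = 0")
  case True
  then have "g = (\<lambda>x. 0)"
    using ip_self[OF g] ip_definite[OF g] by simp
  then have "ip g f = 0"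
    using ip_zero_left[OF f] by simp
  then show ?thesis
    using ip_sym[OF g f] nrm_nonneg[OF f] nrm_nonneg[OF g] by simp
next
  case False
  define p where "p = nrm g"
  have p: "p > 0" using False nrm_nonneg[OF g] by (simp add: p_def)
  define c where "c = ip f g / of_real (p\<^sup>2)"
  have cm: "cmod c = cmod (ip f g) / p\<^sup>2"
    by (simp add: c_def norm_divide norm_power)
  have "Re (cnj c * ip f g) = (cmod (ip f g))\<^sup>2 / p\<^sup>2"
  proof -
    have "cnj c * ip f g = of_real ((cmod (ip f g))\<^sup>2 / p\<^sup>2)"
      by (simp add: c_def complex_norm_square[symmetric] mult.commute)
    then show ?thesis by (metis Re_complex_of_real)
  qed
  then have "(nrm (\<lambda>x. f x - c * g x))\<^sup>2
      = (nrm f)\<^sup>2 + (cmod c * p)\<^sup>2 - 2 * ((cmod (ip f g))\<^sup>2 / p\<^sup>2)"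
    using nrm_diff_sq[OF f scale_mem[OF g, of c]] nrm_scale[OF g, of c] ip_scale_right[OF g f, of c]
    by (simp add: p_def)
  also have "(cmod c * p)\<^sup>2 = (cmod (ip f g))\<^sup>2 / p\<^sup>2"
    using p by (simp add: cm power2_eq_square field_simps)
  finally have "(cmod (ip f g))\<^sup>2 / p\<^sup>2 \<le> (nrm f)\<^sup>2"
    by (smt (verit) zero_le_power2)
  then have "(cmod (ip f g))\<^sup>2 \<le> (nrm f * p)\<^sup>2"
    using p by (simp add: power_mult_distrib divide_le_eq)
  then show ?thesis
    using nrm_nonneg[OF f] p by (auto simp: p_def intro: power2_le_imp_le)
qed

lemma nrm_triangle:
  assumes f: "f \<in> H" and g: "g \<in> H"
  shows "nrm (\<lambda>x. f x + g x) \<le> nrm f + nrm g"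
proof -
  have "(nrm (\<lambda>x. f x + g x))\<^sup>2 \<le> (nrm f)\<^sup>2 + (nrm g)\<^sup>2 + 2 * (nrm f * nrm g)"
    using nrm_add_sq[OF assms] cauchy_schwarz[OF assms] complex_Re_le_cmod[of "ip f g"] by linarith
  then have "(nrm (\<lambda>x. f x + g x))\<^sup>2 \<le> (nrm f + nrm g)\<^sup>2"
    by (simp add: power2_sum)
  then show ?thesis
    using nrm_nonneg[OF f] nrm_nonneg[OF g] by (auto intro: power2_le_imp_le)
qed

lemma nrm_triangle_diff:
  assumes f: "f \<in> H" and g: "g \<in> H"
  shows "nrm f \<le> nrm (\<lambda>x. f x - g x) + nrm g"
  using nrm_triangle[OF diff_mem[OF f g] g] by simp

lemma nrm_zero: "nrm (\<lambda>x. 0) = 0"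
  using nrm_scale[OF zero_mem, of 0] by simp

lemma nrm_sum_le:
  assumes "finite F" "\<And>i. i \<in> F \<Longrightarrow> f i \<in> H"
  shows "nrm (\<lambda>x. \<Sum>i\<in>F. f i x) \<le> (\<Sum>i\<in>F. nrm (f i))"
  using assms
proof (induction F rule: finite_induct)
  case empty
  then show ?case by (simp add: nrm_zero)
next
  case (insert i F)
  then have "(\<lambda>x. \<Sum>i\<in>F. f i x) \<in> H"
    by (intro sum_mem) auto
  with insert show ?case
    using nrm_triangle[of "f i" "\<lambda>x. \<Sum>i\<in>F. f i x"] by fastforce
qed

text \<open>
  Representation of a bounded functional by minimising \<open>\<parallel>E v\<parallel>\<^sup>2 - 2 Re (l v)\<close>: by the
  parallelogram law a minimising sequence is Cauchy, and its limit represents \<open>l\<close>. The functional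
  lives on a space of parameters \<open>v\<close> rather than on the vectors \<open>E v\<close>, so it need not be
  known beforehand to depend on \<open>E v\<close> only.
\<close>

lemma riesz_on_parameters:
  fixes E :: "('v \<Rightarrow> complex) \<Rightarrow> 'a \<Rightarrow> complex" and l :: "('v \<Rightarrow> complex) \<Rightarrow> complex"
  assumes Vne: "V \<noteq> {}"
    and Vadd: "\<And>v w. v \<in> V \<Longrightarrow> w \<in> V \<Longrightarrow> (\<lambda>x. v x + w x) \<in> V"
    and Vscale: "\<And>c v. v \<in> V \<Longrightarrow> (\<lambda>x. c * v x) \<in> V"
    and E: "\<And>v. v \<in> V \<Longrightarrow> E v \<in> H"
    and Eadd: "\<And>v w. v \<in> V \<Longrightarrow> w \<in> V \<Longrightarrow> E (\<lambda>x. v x + w x) = (\<lambda>x. E v x + E w x)"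
    and Escale: "\<And>c v. v \<in> V \<Longrightarrow> E (\<lambda>x. c * v x) = (\<lambda>x. c * E v x)"
    and ladd: "\<And>v w. v \<in> V \<Longrightarrow> w \<in> V \<Longrightarrow> l (\<lambda>x. v x + w x) = l v + l w"
    and lscale: "\<And>c v. v \<in> V \<Longrightarrow> l (\<lambda>x. c * v x) = c * l v"
    and bound: "\<And>v. v \<in> V \<Longrightarrow> cmod (l v) \<le> C * nrm (E v)"
  shows "\<exists>h\<in>H. \<forall>v\<in>V. l v = ip (E v) h"
proof -
  define J where "J v = (nrm (E v))\<^sup>2 - 2 * Re (l v)" for v
  have Jlow: "- C\<^sup>2 \<le> J v" if "v \<in> V" for v
  proof -
    have "Re (l v) \<le> C * nrm (E v)"
      using bound[OF that] complex_Re_le_cmod[of "l v"] by linarith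
    moreover have "0 \<le> (nrm (E v) - C)\<^sup>2" by simp
    ultimately show ?thesis by (simp add: J_def power2_diff algebra_simps)
  qed
  define m where "m = Inf (J ` V)"
  have bdd: "bdd_below (J ` V)"
    using Jlow by (intro bdd_belowI[where m = "- C\<^sup>2"]) auto
  have m_le: "m \<le> J v" if "v \<in> V" for v
    unfolding m_def by (rule cInf_lower[OF _ bdd]) (use that in auto)
  have "\<exists>v\<in>V. J v < m + 1 / real (Suc n)" for n
    using cInf_lessD[of "J ` V" "m + 1 / real (Suc n)"] Vne by (auto simp: m_def)
  then obtain v where v: "\<And>n. v n \<in> V" "\<And>n. J (v n) < m + 1 / real (Suc n)"
    by metis
  have Jadd: "J (\<lambda>x. p x + t * q x) = J p + (cmod t)\<^sup>2 * (nrm (E q))\<^sup>2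
      + 2 * Re (t * (ip (E q) (E p) - l q))" if "p \<in> V" "q \<in> V" for p q t
  proof -
    have tq: "(\<lambda>x. t * q x) \<in> V" using that Vscale by blast
    have Ep: "E p \<in> H" and Eq: "E q \<in> H" using E that by blast+
    have "(nrm (E (\<lambda>x. p x + t * q x)))\<^sup>2
      = (nrm (E p))\<^sup>2 + (cmod t * nrm (E q))\<^sup>2 + 2 * Re (ip (E p) (\<lambda>x. t * E q x))"
      using nrm_add_sq[OF Ep scale_mem[OF Eq, of t]]
      by (simp add: Eadd[OF that(1) tq] Escale[OF that(2)] nrm_scale[OF Eq])
    moreover have "Re (ip (E p) (\<lambda>x. t * E q x)) = Re (t * ip (E q) (E p))"
    proof -
      have "ip (E p) (\<lambda>x. t * E q x) = cnj (t * ip (E q) (E p))"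
        using ip_scale_right[OF Eq Ep, of t] ip_sym[OF Eq Ep] by simp
      then show ?thesis by (metis complex_cnj(1) cnj.simps(1))
    qed
    moreover have "l (\<lambda>x. p x + t * q x) = l p + t * l q"
      using ladd[OF that(1) tq] lscale[OF that(2)] by simp
    ultimately show ?thesis
      by (simp add: J_def power_mult_distrib algebra_simps)
  qed
  have close: "(nrm (\<lambda>x. E (v i) x - E (v j) x))\<^sup>2 \<le> 2 / real (Suc i) + 2 / real (Suc j)" for i j
  proof -
    define p q where "p = v i" and "q = v j"
    have pq: "p \<in> V" "q \<in> V" using v by (auto simp: p_def q_def)
    have Ep: "E p \<in> H" and Eq: "E q \<in> H" using E pq by blast+
    have s: "(\<lambda>x. p x + 1 * q x) \<in> V" using Vadd[OF pq] by simp
    let ?w = "\<lambda>x. (1/2) * (p x + 1 * q x)"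
    have w: "?w \<in> V" using Vscale[OF s, of "1/2"] .
    have "E ?w = (\<lambda>x. (1/2) * (E p x + E q x))"
      using Escale[OF s, of "1/2"] Eadd[OF pq] by simp
    then have A: "nrm (E ?w) = (1/2) * nrm (\<lambda>x. E p x + E q x)"
      using nrm_scale[OF add_mem[OF Ep Eq], of "1/2"] by simp
    have B: "l ?w = (1/2) * (l p + l q)"
      using lscale[OF s, of "1/2"] ladd[OF pq] by simp
    have "4 * J ?w = (nrm (\<lambda>x. E p x + E q x))\<^sup>2 - 4 * Re (l p) - 4 * Re (l q)"
      unfolding J_def A B by (simp add: power_divide add_divide_distrib)
    then have "(nrm (\<lambda>x. E p x - E q x))\<^sup>2 = 2 * J p + 2 * J q - 4 * J ?w"
      using nrm_add_sq[OF Ep Eq] nrm_diff_sq[OF Ep Eq] by (simp add: J_def)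
    also have "\<dots> \<le> 2 * (m + 1 / real (Suc i)) + 2 * (m + 1 / real (Suc j)) - 4 * m"
    proof -
      have "J p < m + 1 / real (Suc i)" "J q < m + 1 / real (Suc j)" "m \<le> J ?w"
        using v(2)[of i] v(2)[of j] m_le[OF w] by (simp_all add: p_def q_def)
      then show ?thesis by argo
    qed
    finally show ?thesis by (simp add: p_def q_def)
  qed
  have "\<exists>h\<in>H. (\<lambda>n. sqrt (Re (ip (\<lambda>x. E (v n) x - h x) (\<lambda>x. E (v n) x - h x)))) \<longlonglongrightarrow> 0"
  proof (rule complete)
    show "E (v n) \<in> H" for n using E v by blast
    fix e :: real assume e: "e > 0"
    obtain N where N: "N > 0" "4 / real N < e\<^sup>2"
    proof -
      obtain N where "real N > 4 / e\<^sup>2" using reals_Archimedean2 by blast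
      moreover then have "real N > 0" using e by (smt (verit) divide_nonneg_nonneg zero_le_power2)
      ultimately have "N > 0" "4 / real N < e\<^sup>2"
        using e by (auto simp: field_simps)
      then show ?thesis using that by blast
    qed
    show "\<exists>N. \<forall>i\<ge>N. \<forall>j\<ge>N. sqrt (Re (ip (\<lambda>x. E (v i) x - E (v j) x) (\<lambda>x. E (v i) x - E (v j) x))) < e"
    proof (intro exI allI impI)
      fix i j assume ij: "N \<le> i" "N \<le> j"
      have "2 / real (Suc i) \<le> 2 / real N" "2 / real (Suc j) \<le> 2 / real N"
        using ij N(1) by (auto simp: frac_le)
      then have "(nrm (\<lambda>x. E (v i) x - E (v j) x))\<^sup>2 < e\<^sup>2"
        using close[of i j] N(2) by linarith
      then have "nrm (\<lambda>x. E (v i) x - E (v j) x) < e"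
        using e by (auto intro: power2_less_imp_less)
      then show "sqrt (Re (ip (\<lambda>x. E (v i) x - E (v j) x) (\<lambda>x. E (v i) x - E (v j) x))) < e"
        by (simp add: nrm_def)
    qed
  qed
  then obtain h where h: "h \<in> H" "(\<lambda>n. nrm (\<lambda>x. E (v n) x - h x)) \<longlonglongrightarrow> 0"
    unfolding nrm_def by blast
  have "l q = ip (E q) h" if q: "q \<in> V" for q
  proof -
    have Eq: "E q \<in> H" using E q by blast
    define D where "D n = ip (E q) (E (v n)) - l q" for n
    define D' where "D' = ip (E q) h - l q"
    have "(\<lambda>n. ip (E q) (E (v n)) - ip (E q) h) \<longlonglongrightarrow> 0"
    proof (rule Lim_null_comparison)
      show "\<forall>\<^sub>F n in sequentially. norm (ip (E q) (E (v n)) - ip (E q) h)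
          \<le> nrm (E q) * nrm (\<lambda>x. E (v n) x - h x)"
        using cauchy_schwarz[OF Eq diff_mem[OF E[OF v(1)] h(1)]]
          ip_diff_right[OF E[OF v(1)] h(1) Eq] by simp
      show "(\<lambda>n. nrm (E q) * nrm (\<lambda>x. E (v n) x - h x)) \<longlonglongrightarrow> 0"
        using tendsto_mult_left[OF h(2), of "nrm (E q)"] by simp
    qed
    then have DD: "D \<longlonglongrightarrow> D'"
      unfolding D_def[abs_def] D'_def by (intro tendsto_diff tendsto_const) (simp add: LIM_zero_iff)
    define s where "s = 1 / ((nrm (E q))\<^sup>2 + 1)"
    have s: "0 < s" "s * (nrm (E q))\<^sup>2 \<le> 1"
      by (auto simp: s_def add_nonneg_pos divide_le_eq)
    \<comment> \<open>adding \<open>t * q\<close> to \<open>v n\<close> changes \<open>J\<close> to first order by \<open>2 * Re (t * D n)\<close> and gains at most \<open>1 / Suc n\<close>\<close>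
    have ineq: "- (1 / real (Suc n)) \<le> s\<^sup>2 * (cmod (D n))\<^sup>2 * (nrm (E q))\<^sup>2 - 2 * s * (cmod (D n))\<^sup>2" for n
    proof -
      let ?t = "- (of_real s * cnj (D n))"
      have "(\<lambda>x. v n x + ?t * q x) \<in> V"
        using Vadd[OF v(1) Vscale[OF q, of ?t]] .
      then have "m \<le> J (\<lambda>x. v n x + ?t * q x)" by (rule m_le)
      also have "\<dots> = J (v n) + (cmod ?t)\<^sup>2 * (nrm (E q))\<^sup>2 + 2 * Re (?t * D n)"
        unfolding D_def by (rule Jadd[OF v(1) q])
      also have "?t * D n = of_real (- s * (cmod (D n))\<^sup>2)"
        by (simp add: complex_norm_square[symmetric] algebra_simps)
      also have "Re (of_real (- s * (cmod (D n))\<^sup>2)) = - s * (cmod (D n))\<^sup>2"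
        by (rule Re_complex_of_real)
      also have "(cmod ?t)\<^sup>2 = s\<^sup>2 * (cmod (D n))\<^sup>2"
        using s by (simp add: norm_mult power_mult_distrib)
      finally show ?thesis
        using v(2)[of n] by linarith
    qed
    have "0 \<le> s\<^sup>2 * (cmod D')\<^sup>2 * (nrm (E q))\<^sup>2 - 2 * s * (cmod D')\<^sup>2"
    proof (rule LIMSEQ_le)
      show "(\<lambda>n. - (1 / real (Suc n))) \<longlonglongrightarrow> 0"
        using tendsto_minus[OF LIMSEQ_inverse_real_of_nat] by (simp add: inverse_eq_divide)
      show "(\<lambda>n. s\<^sup>2 * (cmod (D n))\<^sup>2 * (nrm (E q))\<^sup>2 - 2 * s * (cmod (D n))\<^sup>2)
          \<longlonglongrightarrow> s\<^sup>2 * (cmod D')\<^sup>2 * (nrm (E q))\<^sup>2 - 2 * s * (cmod D')\<^sup>2"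
        by (intro tendsto_intros DD)
    qed (use ineq in auto)
    also have "\<dots> = s * (cmod D')\<^sup>2 * (s * (nrm (E q))\<^sup>2 - 2)"
      by (simp add: algebra_simps power2_eq_square)
    also have "\<dots> \<le> s * (cmod D')\<^sup>2 * (- 1)"
      using s by (intro mult_left_mono) auto
    finally have "(cmod D')\<^sup>2 \<le> 0"
      using s by (simp add: zero_le_mult_iff mult_le_0_iff)
    then show ?thesis by (simp add: D'_def)
  qed
  with h show ?thesis by blast
qed

end

section \<open>Positive kernels\<close>

definition quad :: "'a set \<Rightarrow> ('a \<Rightarrow> complex) \<Rightarrow> ('a \<Rightarrow> 'a \<Rightarrow> complex) \<Rightarrow> complex" where
  "quad F a M = (\<Sum>x\<in>F. \<Sum>y\<in>F. a x * cnj (a y) * M x y)"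

definition psd :: "'a set \<Rightarrow> ('a \<Rightarrow> 'a \<Rightarrow> complex) \<Rightarrow> bool" where
  "psd X M \<longleftrightarrow> (\<forall>F a. finite F \<longrightarrow> F \<subseteq> X \<longrightarrow> quad F a M \<in> \<real>\<^sub>\<ge>\<^sub>0)"

lemma psdD: "psd X M \<Longrightarrow> finite F \<Longrightarrow> F \<subseteq> X \<Longrightarrow> quad F a M \<in> \<real>\<^sub>\<ge>\<^sub>0"
  by (simp add: psd_def)

lemma quad_add: "quad F a (\<lambda>x y. M x y + N x y) = quad F a M + quad F a N"
  by (simp add: quad_def sum.distrib algebra_simps)

lemma quad_cmult: "quad F a (\<lambda>x y. c * M x y) = c * quad F a M"
  by (simp add: quad_def sum_distrib_left algebra_simps)

lemma quad_rank_one: "quad F a (\<lambda>x y. b x * cnj (b y) * M x y) = quad F (\<lambda>x. b x * a x) M"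
  by (simp add: quad_def algebra_simps)

lemma quad_one: "quad F a (\<lambda>x y. 1) = of_real ((cmod (\<Sum>x\<in>F. a x))\<^sup>2)"
  unfolding complex_norm_square by (simp add: quad_def sum_product)

lemma quad_cong:
  "(\<And>x y. x \<in> F \<Longrightarrow> y \<in> F \<Longrightarrow> M x y = N x y) \<Longrightarrow> quad F a M = quad F a N"
  by (auto simp: quad_def intro!: sum.cong)

lemma psd_cong:
  "psd X M \<Longrightarrow> (\<And>x y. x \<in> X \<Longrightarrow> y \<in> X \<Longrightarrow> N x y = M x y) \<Longrightarrow> psd X N"
  unfolding psd_def by (metis quad_cong subsetD)

lemma psd_add: "psd X M \<Longrightarrow> psd X N \<Longrightarrow> psd X (\<lambda>x y. M x y + N x y)"
  by (simp add: psd_def quad_add nonneg_Reals_add_I)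

lemma psd_zero: "psd X (\<lambda>x y. 0)"
  by (simp add: psd_def quad_def)

lemma psd_one: "psd X (\<lambda>x y. 1)"
  by (simp add: psd_def quad_one del: of_real_power)

lemma psd_cmult: "psd X M \<Longrightarrow> c \<in> \<real>\<^sub>\<ge>\<^sub>0 \<Longrightarrow> psd X (\<lambda>x y. c * M x y)"
  by (simp add: psd_def quad_cmult nonneg_Reals_mult_I)

lemma psd_rank_one: "psd X M \<Longrightarrow> psd X (\<lambda>x y. b x * cnj (b y) * M x y)"
  by (simp add: psd_def quad_rank_one)

lemma psd_sum:
  "finite I \<Longrightarrow> (\<And>i. i \<in> I \<Longrightarrow> psd X (M i)) \<Longrightarrow> psd X (\<lambda>x y. \<Sum>i\<in>I. M i x y)"
  by (induction I rule: finite_induct) (auto intro: psd_zero psd_add)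

lemma psd_limit:
  assumes "\<And>n. psd X (M n)" and "\<And>x y. x \<in> X \<Longrightarrow> y \<in> X \<Longrightarrow> (\<lambda>n. M n x y) \<longlonglongrightarrow> N x y"
  shows "psd X N"
  unfolding psd_def
proof (intro allI impI)
  fix F a assume F: "finite F" "F \<subseteq> X"
  have "(\<lambda>n. quad F a (M n)) \<longlonglongrightarrow> quad F a N"
    unfolding quad_def using assms(2) F by (intro tendsto_intros) auto
  then show "quad F a N \<in> \<real>\<^sub>\<ge>\<^sub>0"
    by (rule closed_sequentially[OF closed_nonneg_Reals_complex psdD[OF assms(1) F]])
qed

text \<open>
  Cauchy--Schwarz for the semi-inner product given by \<open>M\<close>, applied to a finite combination
  and the point \<open>w\<close>.
\<close>

lemma psd_cauchy_schwarz:
  assumes M: "psd X M" and herm: "\<And>x y. x \<in> X \<Longrightarrow> y \<in> X \<Longrightarrow> M y x = cnj (M x y)"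
    and w: "w \<in> X"
  shows "psd X (\<lambda>x y. M w w * M x y - M x w * cnj (M y w))"
  unfolding psd_def
proof (intro allI impI)
  fix F a assume F: "finite F" "F \<subseteq> X"
  define \<alpha> where "\<alpha> = (\<Sum>x\<in>F. a x * M x w)"
  define q where "q = Re (quad F a M)"
  have q: "quad F a M = of_real q" "q \<ge> 0"
    using psdD[OF M F, of a] by (auto simp: q_def elim!: nonneg_Reals_cases)
  obtain l where l: "M w w = of_real l" "l \<ge> 0"
  proof -
    have "quad {w} (\<lambda>_. 1) M \<in> \<real>\<^sub>\<ge>\<^sub>0" by (rule psdD[OF M]) (use w in auto)
    then show ?thesis using that by (auto simp: quad_def elim!: nonneg_Reals_cases)
  qed
  have ineq: "0 \<le> q - 2 * t * (cmod \<alpha>)\<^sup>2 + t\<^sup>2 * (cmod \<alpha>)\<^sup>2 * l" for t :: real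
  proof -
    \<comment> \<open>perturb the coefficient at \<open>w\<close>, a point that may or may not belong to \<open>F\<close>\<close>
    define c where "c = - (of_real t * \<alpha>)"
    define a' where "a' x = (if x \<in> F then a x else 0) + (if x = w then c else 0)" for x
    have sum1: "(\<Sum>x\<in>insert w F. a' x * g x) = (\<Sum>x\<in>F. a x * g x) + c * g w" for g
    proof -
      have "(\<Sum>x\<in>insert w F. a' x * g x)
        = (\<Sum>x\<in>insert w F. (if x \<in> F then a x * g x else 0)) + (\<Sum>x\<in>insert w F. (if x = w then c * g w else 0))"
        unfolding sum.distrib[symmetric] by (rule sum.cong) (auto simp: a'_def algebra_simps)
      also have "(\<Sum>x\<in>insert w F. (if x \<in> F then a x * g x else 0)) = (\<Sum>x\<in>F. a x * g x)"
        using F(1) by (intro sum.mono_neutral_cong_right) auto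
      also have "(\<Sum>x\<in>insert w F. (if x = w then c * g w else 0)) = c * g w"
        using F(1) by (simp add: sum.delta)
      finally show ?thesis .
    qed
    have sum2: "(\<Sum>x\<in>insert w F. cnj (a' x) * g x) = (\<Sum>x\<in>F. cnj (a x) * g x) + cnj c * g w" for g
      using arg_cong[OF sum1[of "\<lambda>x. cnj (g x)"], of cnj] by simp
    have "quad (insert w F) a' M
        = (\<Sum>x\<in>insert w F. a' x * (\<Sum>y\<in>insert w F. cnj (a' y) * M x y))"
      by (simp add: quad_def sum_distrib_left mult.assoc)
    also have "\<dots> = (\<Sum>x\<in>F. a x * ((\<Sum>y\<in>F. cnj (a y) * M x y) + cnj c * M x w))
        + c * ((\<Sum>y\<in>F. cnj (a y) * M w y) + cnj c * M w w)"
      unfolding sum2 sum1 ..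
    also have "(\<Sum>x\<in>F. a x * ((\<Sum>y\<in>F. cnj (a y) * M x y) + cnj c * M x w))
        = quad F a M + cnj c * \<alpha>"
      by (simp add: quad_def \<alpha>_def sum.distrib sum_distrib_left algebra_simps)
    also have "(\<Sum>y\<in>F. cnj (a y) * M w y) = cnj \<alpha>"
    proof -
      have "cnj (a y) * M w y = cnj (a y * M y w)" if "y \<in> F" for y
        using herm[of y w] that F w by auto
      then have "(\<Sum>y\<in>F. cnj (a y) * M w y) = (\<Sum>y\<in>F. cnj (a y * M y w))"
        by (intro sum.cong) auto
      then show ?thesis unfolding \<alpha>_def cnj_sum .
    qed
    also have "quad F a M + cnj c * \<alpha> + c * (cnj \<alpha> + cnj c * M w w)
        = of_real (q - 2 * t * (cmod \<alpha>)\<^sup>2 + t\<^sup>2 * (cmod \<alpha>)\<^sup>2 * l)"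
      unfolding of_real_add of_real_diff of_real_mult complex_norm_square
      by (simp add: c_def q l algebra_simps power2_eq_square)
    finally have e: "quad (insert w F) a' M
        = of_real (q - 2 * t * (cmod \<alpha>)\<^sup>2 + t\<^sup>2 * (cmod \<alpha>)\<^sup>2 * l)" .
    have "quad (insert w F) a' M \<in> \<real>\<^sub>\<ge>\<^sub>0"
      by (rule psdD[OF M]) (use F w in auto)
    then show ?thesis unfolding e by (simp only: nonneg_Reals_of_real_iff)
  qed
  have "(cmod \<alpha>)\<^sup>2 \<le> q * l"
  proof (cases "\<alpha> = 0")
    case True
    then show ?thesis using q l by simp
  next
    case False
    then have A: "(cmod \<alpha>)\<^sup>2 > 0" by simp
    show ?thesis
    proof (cases "l = 0")
      case True
      have "0 \<le> q - 2 * ((q + 1) / (cmod \<alpha>)\<^sup>2) * (cmod \<alpha>)\<^sup>2"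
        using ineq[of "(q + 1) / (cmod \<alpha>)\<^sup>2"] True by simp
      then show ?thesis using A q by simp
    next
      case False
      then have "l > 0" using l by simp
      have "0 \<le> q - 2 * (1/l) * (cmod \<alpha>)\<^sup>2 + (1/l)\<^sup>2 * (cmod \<alpha>)\<^sup>2 * l" by (rule ineq)
      then show ?thesis using \<open>l > 0\<close> by (simp add: power2_eq_square field_simps)
    qed
  qed
  moreover have "quad F a (\<lambda>x y. M w w * M x y - M x w * cnj (M y w))
      = of_real (q * l - (cmod \<alpha>)\<^sup>2)"
  proof -
    have "quad F a (\<lambda>x y. M w w * M x y - M x w * cnj (M y w))
      = M w w * quad F a M - quad F a (\<lambda>x y. M x w * cnj (M y w) * 1)"
      using quad_add[of F a "\<lambda>x y. M w w * M x y - M x w * cnj (M y w)" "\<lambda>x y. M x w * cnj (M y w) * 1"]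
        quad_cmult[of F a "M w w" M] by simp
    also have "quad F a (\<lambda>x y. M x w * cnj (M y w) * 1) = of_real ((cmod \<alpha>)\<^sup>2)"
      unfolding quad_rank_one quad_one by (simp add: \<alpha>_def mult.commute)
    finally show ?thesis using q l by simp
  qed
  ultimately show "quad F a (\<lambda>x y. M w w * M x y - M x w * cnj (M y w)) \<in> \<real>\<^sub>\<ge>\<^sub>0"
    by (simp del: of_real_diff of_real_mult)
qed

section \<open>Multipliers as adjoints on kernel functions\<close>

text \<open>
  The adjoint of multiplication by \<open>\<phi>\<close> scales the kernel function at each \<open>x\<close> by the conjugate of
  \<open>\<phi> x\<close>. Boundedness of this diagonal action on finite combinations of kernel functions can be
  checked without knowing that \<open>\<phi>\<close> is a multiplier, and it is stable under sums and limits; this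
  is how multipliers are produced below.
\<close>

context rkhs
begin

definition ker :: "'a \<Rightarrow> 'a \<Rightarrow> complex" where
  "ker w = on_set X (\<lambda>z. K z w)"

text \<open>
  The coefficients enter conjugated. The squared norm is then the form \<open>quad F a K\<close>, and the
  adjoint of multiplication by \<open>\<phi>\<close> multiplies \<open>a\<close> by \<open>\<phi>\<close> itself.
\<close>

definition comb :: "'a set \<Rightarrow> ('a \<Rightarrow> complex) \<Rightarrow> 'a \<Rightarrow> complex" where
  "comb F a = (\<lambda>z. \<Sum>x\<in>F. cnj (a x) * ker x z)"

lemma ker_mem: "w \<in> X \<Longrightarrow> ker w \<in> H"
  using kernel_mem by (simp add: ker_def)

lemma reproduce: "f \<in> H \<Longrightarrow> w \<in> X \<Longrightarrow> f w = ip f (ker w)"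
  using reproducing by (simp add: ker_def)

lemma ip_ker_ker: "w \<in> X \<Longrightarrow> z \<in> X \<Longrightarrow> ip (ker w) (ker z) = K z w"
  using reproduce[OF ker_mem, of w z] by (simp add: ker_def on_set_def)

lemma K_herm: "w \<in> X \<Longrightarrow> z \<in> X \<Longrightarrow> K w z = cnj (K z w)"
  using ip_sym[OF ker_mem ker_mem, of w z] by (simp add: ip_ker_ker)

lemma K_self: "w \<in> X \<Longrightarrow> K w w = of_real ((nrm (ker w))\<^sup>2)"
  using ip_self[OF ker_mem, of w] by (simp add: ip_ker_ker)

lemma eval_bound: "f \<in> H \<Longrightarrow> w \<in> X \<Longrightarrow> cmod (f w) \<le> nrm f * nrm (ker w)"
  using cauchy_schwarz[OF _ ker_mem] by (simp add: reproduce)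

lemma comb_mem: "finite F \<Longrightarrow> F \<subseteq> X \<Longrightarrow> comb F a \<in> H"
  unfolding comb_def by (intro sum_mem scale_mem ker_mem) auto

lemma ip_comb:
  assumes "finite F" "F \<subseteq> X" "f \<in> H"
  shows "ip (comb F a) f = cnj (\<Sum>x\<in>F. a x * f x)"
proof -
  have "ip (comb F a) f = (\<Sum>x\<in>F. ip (\<lambda>z. cnj (a x) * ker x z) f)"
    unfolding comb_def by (rule ip_sum) (use assms in \<open>auto intro: scale_mem ker_mem\<close>)
  also have "\<dots> = (\<Sum>x\<in>F. cnj (a x) * cnj (f x))"
  proof (rule sum.cong[OF refl])
    fix x assume "x \<in> F"
    then have x: "x \<in> X" using assms by blast
    show "ip (\<lambda>z. cnj (a x) * ker x z) f = cnj (a x) * cnj (f x)"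
      using ip_scale[OF ker_mem[OF x] assms(3), of "cnj (a x)"] ip_sym[OF assms(3) ker_mem[OF x]]
        reproduce[OF assms(3) x] by simp
  qed
  finally show ?thesis by simp
qed

lemma nrm_comb_sq:
  assumes "finite F" "F \<subseteq> X"
  shows "of_real ((nrm (comb F a))\<^sup>2) = quad F a K"
proof -
  have "of_real ((nrm (comb F a))\<^sup>2) = cnj (ip (comb F a) (comb F a))"
    using ip_self[OF comb_mem[OF assms]] by simp
  also have "\<dots> = (\<Sum>x\<in>F. a x * comb F a x)"
    by (subst ip_comb[OF assms comb_mem[OF assms]]) simp
  also have "\<dots> = quad F a K"
    using assms by (auto simp: quad_def comb_def ker_def on_set_def sum_distrib_left mult.assoc
        intro!: sum.cong)
  finally show ?thesis .
qed

definition mult_bound :: "('a \<Rightarrow> complex) \<Rightarrow> real \<Rightarrow> bool" where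
  "mult_bound \<phi> C \<longleftrightarrow> 0 \<le> C \<and> (\<forall>F a. finite F \<longrightarrow> F \<subseteq> X \<longrightarrow>
     nrm (comb F (\<lambda>x. \<phi> x * a x)) \<le> C * nrm (comb F a))"

lemma mult_boundD:
  "mult_bound \<phi> C \<Longrightarrow> finite F \<Longrightarrow> F \<subseteq> X \<Longrightarrow>
     nrm (comb F (\<lambda>x. \<phi> x * a x)) \<le> C * nrm (comb F a)"
  by (simp add: mult_bound_def)

lemma mult_bound_nonneg: "mult_bound \<phi> C \<Longrightarrow> 0 \<le> C"
  by (simp add: mult_bound_def)

lemma mult_bound_zero: "mult_bound (\<lambda>x. 0) 0"
  by (simp add: mult_bound_def comb_def nrm_zero)

lemma mult_bound_mono: "mult_bound \<phi> C \<Longrightarrow> C \<le> D \<Longrightarrow> mult_bound \<phi> D"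
  unfolding mult_bound_def
  by (meson comb_mem mult_right_mono nrm_nonneg order_trans)

lemma mult_bound_add:
  assumes "mult_bound \<phi> C" "mult_bound \<psi> D"
  shows "mult_bound (\<lambda>x. \<phi> x + \<psi> x) (C + D)"
  unfolding mult_bound_def
proof (intro conjI allI impI)
  show "0 \<le> C + D" using assms by (simp add: mult_bound_def)
  fix F a assume F: "finite F" "F \<subseteq> X"
  have "comb F (\<lambda>x. (\<phi> x + \<psi> x) * a x)
      = (\<lambda>z. comb F (\<lambda>x. \<phi> x * a x) z + comb F (\<lambda>x. \<psi> x * a x) z)"
    by (simp add: comb_def sum.distrib algebra_simps)
  then show "nrm (comb F (\<lambda>x. (\<phi> x + \<psi> x) * a x)) \<le> (C + D) * nrm (comb F a)"
    using nrm_triangle[OF comb_mem[OF F, of "\<lambda>x. \<phi> x * a x"] comb_mem[OF F, of "\<lambda>x. \<psi> x * a x"]]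
      mult_boundD[OF assms(1) F, of a] mult_boundD[OF assms(2) F, of a]
    by (simp add: algebra_simps)
qed

lemma mult_bound_cmult:
  assumes "mult_bound \<phi> C"
  shows "mult_bound (\<lambda>x. c * \<phi> x) (cmod c * C)"
  unfolding mult_bound_def
proof (intro conjI allI impI)
  show "0 \<le> cmod c * C" using assms by (simp add: mult_bound_def)
  fix F a assume F: "finite F" "F \<subseteq> X"
  have "comb F (\<lambda>x. c * \<phi> x * a x) = (\<lambda>z. cnj c * comb F (\<lambda>x. \<phi> x * a x) z)"
    by (simp add: comb_def sum_distrib_left algebra_simps)
  then show "nrm (comb F (\<lambda>x. c * \<phi> x * a x)) \<le> cmod c * C * nrm (comb F a)"
    using nrm_scale[OF comb_mem[OF F, of "\<lambda>x. \<phi> x * a x"], of "cnj c"]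
      mult_left_mono[OF mult_boundD[OF assms F, of a], of "cmod c"]
    by (simp add: mult.assoc)
qed

lemma mult_bound_sum:
  assumes "finite I" "\<And>i. i \<in> I \<Longrightarrow> mult_bound (\<phi> i) (C i)"
  shows "mult_bound (\<lambda>x. \<Sum>i\<in>I. \<phi> i x) (\<Sum>i\<in>I. C i)"
  using assms by (induction I rule: finite_induct) (auto intro: mult_bound_zero mult_bound_add)

lemma mult_bound_limit:
  assumes "\<And>n. mult_bound (\<phi> n) C" and lim: "\<And>x. x \<in> X \<Longrightarrow> (\<lambda>n. \<phi> n x) \<longlonglongrightarrow> \<psi> x"
  shows "mult_bound \<psi> C"
  unfolding mult_bound_def
proof (intro conjI allI impI)
  show C: "0 \<le> C" using assms(1)[of 0] by (simp add: mult_bound_def)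
  fix F a assume F: "finite F" "F \<subseteq> X"
  have "(\<lambda>n. quad F (\<lambda>x. \<phi> n x * a x) K) \<longlonglongrightarrow> quad F (\<lambda>x. \<psi> x * a x) K"
    unfolding quad_def using lim F by (intro tendsto_intros) auto
  then have lim2: "(\<lambda>n. (nrm (comb F (\<lambda>x. \<phi> n x * a x)))\<^sup>2) \<longlonglongrightarrow> (nrm (comb F (\<lambda>x. \<psi> x * a x)))\<^sup>2"
    unfolding nrm_comb_sq[OF F, symmetric] tendsto_of_real_iff .
  have "(nrm (comb F (\<lambda>x. \<psi> x * a x)))\<^sup>2 \<le> (C * nrm (comb F a))\<^sup>2"
  proof (rule LIMSEQ_le_const2[OF lim2])
    show "\<exists>N. \<forall>n\<ge>N. (nrm (comb F (\<lambda>x. \<phi> n x * a x)))\<^sup>2 \<le> (C * nrm (comb F a))\<^sup>2"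
      using mult_boundD[OF assms(1) F, where a = a] nrm_nonneg[OF comb_mem[OF F]]
      by (intro exI[of _ 0] allI impI power_mono) auto
  qed
  then show "nrm (comb F (\<lambda>x. \<psi> x * a x)) \<le> C * nrm (comb F a)"
    using C nrm_nonneg[OF comb_mem[OF F]] by (auto intro: power2_le_imp_le)
qed

lemma mult_bound_series:
  assumes b: "\<And>n. mult_bound (\<phi> n) (C n)" and C: "summable C"
    and lim: "\<And>x. x \<in> X \<Longrightarrow> (\<lambda>n. \<phi> n x) sums \<psi> x"
  shows "mult_bound \<psi> (suminf C)"
proof (rule mult_bound_limit)
  fix n
  show "mult_bound (\<lambda>x. \<Sum>i<n. \<phi> i x) (suminf C)"
    by (rule mult_bound_mono[OF mult_bound_sum[OF _ b]])
      (auto intro: sum_le_suminf[OF C] mult_bound_nonneg[OF b])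
next
  fix x assume "x \<in> X"
  then show "(\<lambda>n. \<Sum>i<n. \<phi> i x) \<longlonglongrightarrow> \<psi> x"
    using lim by (simp add: sums_def)
qed

lemma mult_bound_psd:
  assumes C: "0 \<le> C" and p: "psd X (\<lambda>x y. (of_real (C\<^sup>2) - \<phi> x * cnj (\<phi> y)) * K x y)"
  shows "mult_bound \<phi> C"
  unfolding mult_bound_def
proof (intro conjI allI impI C)
  fix F a assume F: "finite F" "F \<subseteq> X"
  have "quad F a (\<lambda>x y. (of_real (C\<^sup>2) - \<phi> x * cnj (\<phi> y)) * K x y)
      + quad F a (\<lambda>x y. \<phi> x * cnj (\<phi> y) * K x y) = of_real (C\<^sup>2) * quad F a K"
    unfolding quad_add[symmetric] quad_cmult[symmetric] by (simp add: algebra_simps)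
  then have "quad F a (\<lambda>x y. (of_real (C\<^sup>2) - \<phi> x * cnj (\<phi> y)) * K x y)
      = of_real (C\<^sup>2 * (nrm (comb F a))\<^sup>2 - (nrm (comb F (\<lambda>x. \<phi> x * a x)))\<^sup>2)"
    unfolding quad_rank_one nrm_comb_sq[OF F, symmetric] by (simp add: algebra_simps)
  then have "(nrm (comb F (\<lambda>x. \<phi> x * a x)))\<^sup>2 \<le> (C * nrm (comb F a))\<^sup>2"
    using psdD[OF p F, of a] by (simp add: power_mult_distrib del: of_real_diff of_real_mult of_real_power)
  then show "nrm (comb F (\<lambda>x. \<phi> x * a x)) \<le> C * nrm (comb F a)"
    using C nrm_nonneg[OF comb_mem[OF F]] by (auto intro: power2_le_imp_le)
qed

lemma mult_bound_sup:
  assumes "mult_bound \<phi> C" and x: "x \<in> X" and K: "K x x \<noteq> 0"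
  shows "cmod (\<phi> x) \<le> C"
proof -
  have e: "nrm (comb {x} a) = cmod (a x) * nrm (ker x)" for a
    using nrm_scale[OF ker_mem[OF x], of "cnj (a x)"] by (simp add: comb_def)
  have "cmod (\<phi> x) * nrm (ker x) \<le> C * nrm (ker x)"
    using mult_boundD[OF assms(1), of "{x}" "\<lambda>_. 1"] x e by simp
  moreover have "nrm (ker x) > 0"
    using K K_self[OF x] nrm_nonneg[OF ker_mem[OF x]] by (auto simp: order_less_le)
  ultimately show ?thesis by simp
qed

text \<open>
  The adjoint of a multiplication operator acts diagonally on kernel functions, and boundedness
  of the diagonal action already yields the operator: for \<open>f \<in> H\<close> the values \<open>\<phi> x * f x\<close>
  define a bounded functional on combinations of kernel functions, and the vector representing it
  is the product.
\<close>

lemma mult_bound_imp_Mult: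
  assumes b: "mult_bound \<phi> C"
  shows "on_set X \<phi> \<in> Mult X H"
  unfolding Mult_def
proof (intro CollectI conjI ballI)
  show "on_set X \<phi> \<in> functions_on X" by (simp add: functions_on_def on_set_def)
  fix f assume f: "f \<in> H"
  define S where "S a = {x. a x \<noteq> 0}" for a :: "'a \<Rightarrow> complex"
  define V where "V = {a. finite (S a) \<and> S a \<subseteq> X}"
  define E where "E a = comb (S a) (\<lambda>x. cnj (a x))" for a
  define l where "l a = (\<Sum>x\<in>S a. a x * cnj (\<phi> x * f x))" for a
  have VF: "finite (S a)" "S a \<subseteq> X" if "a \<in> V" for a using that by (auto simp: V_def)
  have E_eq: "E a = comb F (\<lambda>x. cnj (a x))" if "finite F" "S a \<subseteq> F" for a F
    unfolding E_def comb_def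
    by (intro ext sum.mono_neutral_left) (use that in \<open>auto simp: S_def\<close>)
  have l_eq: "l a = (\<Sum>x\<in>F. a x * cnj (\<phi> x * f x))" if "finite F" "S a \<subseteq> F" for a F
    unfolding l_def by (rule sum.mono_neutral_left) (use that in \<open>auto simp: S_def\<close>)
  have add: "finite (S a \<union> S b)" "S (\<lambda>x. a x + b x) \<subseteq> S a \<union> S b" if "a \<in> V" "b \<in> V" for a b
    using that by (auto simp: V_def S_def)
  have scale: "S (\<lambda>x. c * a x) \<subseteq> S a" for c a by (auto simp: S_def)
  have "\<exists>h\<in>H. \<forall>v\<in>V. l v = ip (E v) h"
  proof (rule riesz_on_parameters)
    have "(\<lambda>x. 0) \<in> V" by (simp add: V_def S_def)
    then show "V \<noteq> {}" by blast
    show "(\<lambda>x. v x + w x) \<in> V" if "v \<in> V" "w \<in> V" for v w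
    proof -
      have "S (\<lambda>x. v x + w x) \<subseteq> X"
        using add(2)[OF that] VF(2)[OF that(1)] VF(2)[OF that(2)] by blast
      then show ?thesis
        using finite_subset[OF add(2) add(1)] that by (simp add: V_def)
    qed
    show "(\<lambda>x. c * v x) \<in> V" if "v \<in> V" for c v
      using finite_subset[OF scale VF(1)[OF that]] order_trans[OF scale VF(2)[OF that]]
      by (simp add: V_def)
    show "E v \<in> H" if "v \<in> V" for v
      using VF[OF that] by (simp add: E_def comb_mem)
    show "E (\<lambda>x. v x + w x) = (\<lambda>x. E v x + E w x)" if "v \<in> V" "w \<in> V" for v w
      unfolding E_eq[OF add[OF that]] E_eq[OF add(1)[OF that] Un_upper1] E_eq[OF add(1)[OF that] Un_upper2]
      by (simp add: comb_def sum.distrib algebra_simps)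
    show "E (\<lambda>x. c * v x) = (\<lambda>x. c * E v x)" if "v \<in> V" for c v
      unfolding E_eq[OF VF(1)[OF that] scale] E_eq[OF VF(1)[OF that] subset_refl]
      by (simp add: comb_def sum_distrib_left algebra_simps)
    show "l (\<lambda>x. v x + w x) = l v + l w" if "v \<in> V" "w \<in> V" for v w
      unfolding l_eq[OF add[OF that]] l_eq[OF add(1)[OF that] Un_upper1] l_eq[OF add(1)[OF that] Un_upper2]
      by (simp add: sum.distrib algebra_simps)
    show "l (\<lambda>x. c * v x) = c * l v" if "v \<in> V" for c v
      unfolding l_eq[OF VF(1)[OF that] scale] l_eq[OF VF(1)[OF that] subset_refl]
      by (simp add: sum_distrib_left algebra_simps)
    show "cmod (l v) \<le> (C * nrm f) * nrm (E v)" if "v \<in> V" for v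
    proof -
      note F = VF[OF that]
      have "l v = ip (comb (S v) (\<lambda>x. \<phi> x * cnj (v x))) f"
        unfolding ip_comb[OF F f] by (simp add: l_def algebra_simps)
      then have "cmod (l v) \<le> nrm (comb (S v) (\<lambda>x. \<phi> x * cnj (v x))) * nrm f"
        using cauchy_schwarz[OF comb_mem[OF F] f] by simp
      also have "\<dots> \<le> (C * nrm (E v)) * nrm f"
        unfolding E_def using mult_boundD[OF b F] nrm_nonneg[OF f] by (intro mult_right_mono) auto
      finally show ?thesis by (simp add: mult_ac)
    qed
  qed
  then obtain h where h: "h \<in> H" "\<And>v. v \<in> V \<Longrightarrow> l v = ip (E v) h" by blast
  have "on_set X \<phi> x * f x = h x" for x
  proof (cases "x \<in> X")
    case True
    define v where "v = (\<lambda>y. if y = x then 1 else (0::complex))"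
    have S: "S v = {x}" by (auto simp: S_def v_def)
    have "v \<in> V" using True S by (auto simp: V_def)
    then have "l v = ip (comb {x} (\<lambda>x. cnj (v x))) h" using h(2) by (simp add: E_def S)
    also have "\<dots> = cnj (h x)" using ip_comb[of "{x}" h] h(1) True by (simp add: v_def)
    finally have "(\<Sum>x\<in>{x}. v x * cnj (\<phi> x * f x)) = cnj (h x)" unfolding l_def S .
    then have "cnj (\<phi> x * f x) = cnj (h x)" by (simp add: v_def)
    then show ?thesis using True by (metis complex_cnj_cancel_iff on_set_def)
  next
    case False
    then have "h x = 0" using h(1) subset by (auto simp: functions_on_def)
    then show ?thesis using False by (simp add: on_set_def)
  qed
  then show "(\<lambda>x. on_set X \<phi> x * f x) \<in> H" using h(1) by presburger
qed

end

section \<open>Complete Pick spaces and their distance\<close>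

text \<open>
  The sine of the angle between the kernel functions at \<open>x\<close> and \<open>y\<close>. On the unit ball, with the
  Drury--Arveson kernel, it is the pseudohyperbolic distance.
\<close>

definition kdist :: "('a \<Rightarrow> 'a \<Rightarrow> complex) \<Rightarrow> 'a \<Rightarrow> 'a \<Rightarrow> real" where
  "kdist K x y = sqrt (1 - (cmod (K x y))\<^sup>2 / (Re (K x x) * Re (K y y)))"

text \<open>
  Spaces whose kernel is \<open>1 / (1 - L)\<close> for a positive kernel \<open>L\<close>: normalized complete Pick spaces.
  Positivity of \<open>L\<close> is expressed by closure of the positive kernels under multiplication by \<open>L\<close>.
  For kernels that are given as sums of rank one kernels this is immediate, and it replaces the
  general Schur product theorem.
\<close>

locale pick_space = rkhs X H ip K
  for X :: "'a set" and H ip K +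
  fixes L :: "'a \<Rightarrow> 'a \<Rightarrow> complex"
  assumes K_eq: "\<And>x y. x \<in> X \<Longrightarrow> y \<in> X \<Longrightarrow> K x y = 1 / (1 - L x y)"
    and L_less: "\<And>x y. x \<in> X \<Longrightarrow> y \<in> X \<Longrightarrow> cmod (L x y) < 1"
    and L_schur: "\<And>M. psd X M \<Longrightarrow> psd X (\<lambda>x y. L x y * M x y)"
begin

lemma L_ne: "x \<in> X \<Longrightarrow> y \<in> X \<Longrightarrow> 1 - L x y \<noteq> 0"
  using L_less[of x y] by force

lemma L_herm: "x \<in> X \<Longrightarrow> y \<in> X \<Longrightarrow> L y x = cnj (L x y)"
proof -
  assume xy: "x \<in> X" "y \<in> X"
  then have "1 / (1 - L y x) = cnj (1 / (1 - L x y))"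
    using K_herm[of y x] K_eq by simp
  then have "1 / (1 - L y x) = 1 / (1 - cnj (L x y))" by simp
  then have "1 - L y x = 1 - cnj (L x y)" by (metis div_by_1 divide_divide_eq_right mult_1)
  then show ?thesis by simp
qed

lemma Re_K_pos: "x \<in> X \<Longrightarrow> y \<in> X \<Longrightarrow> 0 < Re (K x y)"
proof -
  assume xy: "x \<in> X" "y \<in> X"
  have "Re (1 - L x y) > 0"
    using L_less[OF xy] complex_Re_le_cmod[of "L x y"] by simp
  then have "0 < Re (1 - L x y) / (cmod (1 - L x y))\<^sup>2"
    using L_ne[OF xy] by (intro divide_pos_pos) auto
  then show ?thesis
    using K_eq[OF xy] by (simp add: Re_divide cmod_power2)
qed

lemma nrm_ker_pos: "x \<in> X \<Longrightarrow> 0 < nrm (ker x)"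
proof -
  assume x: "x \<in> X"
  then have "0 < (nrm (ker x))\<^sup>2" using Re_K_pos[OF x x] K_self[OF x] by simp
  then show ?thesis using nrm_nonneg[OF ker_mem[OF x]] by (auto simp: order_less_le)
qed

lemma K_ne: "x \<in> X \<Longrightarrow> y \<in> X \<Longrightarrow> K x y \<noteq> 0"
  using Re_K_pos[of x y] by force

lemma psd_mult_K:
  assumes M: "psd X M"
  shows "psd X (\<lambda>x y. K x y * M x y)"
proof (rule psd_limit)
  have p: "psd X (\<lambda>x y. L x y ^ i * M x y)" for i
  proof (induction i)
    case (Suc i)
    from L_schur[OF Suc] show ?case by (simp add: mult.assoc)
  qed (use M in simp)
  show "psd X (\<lambda>x y. \<Sum>i<n. L x y ^ i * M x y)" for n
    by (rule psd_sum) (use p in auto)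
  show "(\<lambda>n. \<Sum>i<n. L x y ^ i * M x y) \<longlonglongrightarrow> K x y * M x y" if "x \<in> X" "y \<in> X" for x y
  proof -
    have "(\<lambda>i. L x y ^ i) sums K x y"
      using geometric_sums[of "L x y"] L_less[OF that] K_eq[OF that] by simp
    then have "(\<lambda>i. L x y ^ i * M x y) sums (K x y * M x y)" by (rule sums_mult2)
    then show ?thesis by (simp add: sums_def)
  qed
qed

lemma L_psd: "psd X L"
  using L_schur[OF psd_one] by simp

lemma L_self:
  assumes w: "w \<in> X"
  obtains l where "L w w = of_real (l\<^sup>2)" "0 \<le> l" "l < 1"
proof -
  have "quad {w} (\<lambda>_. 1) L \<in> \<real>\<^sub>\<ge>\<^sub>0" by (rule psdD[OF L_psd]) (use w in auto)
  then obtain m where m: "L w w = of_real m" "m \<ge> 0"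
    by (auto simp: quad_def elim!: nonneg_Reals_cases)
  have "m < 1" using L_less[OF w w] m by simp
  then show ?thesis using that[of "sqrt m"] m by simp
qed

text \<open>
  With \<open>K - L K = 1\<close> the kernel \<open>(L w w - L x w * L w y) * K x y\<close> splits into the
  constant \<open>L w w\<close> and the Schur product of \<open>K\<close> with a kernel that is positive by
  Cauchy--Schwarz.
\<close>

lemma mult_bound_L:
  assumes w: "w \<in> X" and l: "L w w = of_real (l\<^sup>2)" "0 \<le> l"
  shows "mult_bound (\<lambda>x. L x w) l"
proof (rule mult_bound_psd[OF l(2)])
  have "psd X (\<lambda>x y. of_real (l\<^sup>2) * 1 + K x y * (L w w * L x y - L x w * cnj (L y w)))"
    by (intro psd_add psd_cmult psd_one psd_mult_K psd_cauchy_schwarz L_psd w L_herm)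
      (auto simp del: of_real_power)
  then show "psd X (\<lambda>x y. (of_real (l\<^sup>2) - L x w * cnj (L y w)) * K x y)"
  proof (rule psd_cong)
    fix x y assume xy: "x \<in> X" "y \<in> X"
    have "K x y * (1 - L x y) = 1" using K_eq[OF xy] L_ne[OF xy] by simp
    then have "K x y = 1 + K x y * L x y" by (simp add: algebra_simps)
    then have "of_real (l\<^sup>2) * K x y = of_real (l\<^sup>2) * (1 + K x y * L x y)" by simp
    then show "(of_real (l\<^sup>2) - L x w * cnj (L y w)) * K x y
        = of_real (l\<^sup>2) * 1 + K x y * (L w w * L x y - L x w * cnj (L y w))"
      unfolding l by (simp add: algebra_simps)
  qed
qed

text \<open>
  The diagonal action \<open>T\<close> of \<open>\<phi>\<close> has norm at most \<open>l < 1\<close>, and the rescaled combination \<open>c\<close> satisfies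
  \<open>c - T c = a\<close>. Hence \<open>\<parallel>c\<parallel> \<le> \<parallel>a\<parallel> + l * \<parallel>c\<parallel>\<close>.
\<close>

lemma mult_bound_resolvent:
  assumes b: "mult_bound \<phi> l" and l: "l < 1" and ne: "\<And>x. x \<in> X \<Longrightarrow> \<phi> x \<noteq> 1"
  shows "mult_bound (\<lambda>x. 1 / (1 - \<phi> x)) (1 / (1 - l))"
  unfolding mult_bound_def
proof (intro conjI allI impI)
  show "0 \<le> 1 / (1 - l)" using l by simp
  fix F a assume F: "finite F" "F \<subseteq> X"
  define c where "c x = 1 / (1 - \<phi> x) * a x" for x
  have "comb F a = (\<lambda>z. comb F c z - comb F (\<lambda>x. \<phi> x * c x) z)"
  proof
    fix z
    have "comb F c z - comb F (\<lambda>x. \<phi> x * c x) z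
      = (\<Sum>x\<in>F. cnj (c x - \<phi> x * c x) * ker x z)"
      by (simp add: comb_def sum_subtractf algebra_simps)
    also have "\<dots> = comb F a z"
      unfolding comb_def
    proof (rule sum.cong[OF refl])
      fix x assume "x \<in> F"
      then have "1 - \<phi> x \<noteq> 0" using ne[of x] F by auto
      then have "(1 - \<phi> x) * c x = a x" by (simp add: c_def)
      then have "c x - \<phi> x * c x = a x" by (simp add: algebra_simps)
      then show "cnj (c x - \<phi> x * c x) * ker x z = cnj (a x) * ker x z" by simp
    qed
    finally show "comb F a z = comb F c z - comb F (\<lambda>x. \<phi> x * c x) z" by simp
  qed
  then have "nrm (comb F c) \<le> nrm (comb F a) + nrm (comb F (\<lambda>x. \<phi> x * c x))"
    using nrm_triangle_diff[OF comb_mem[OF F, of c] comb_mem[OF F, of "\<lambda>x. \<phi> x * c x"]] by simp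
  also have "\<dots> \<le> nrm (comb F a) + l * nrm (comb F c)"
    using mult_boundD[OF b F] by simp
  finally have "nrm (comb F c) * (1 - l) \<le> nrm (comb F a)" by (simp add: algebra_simps)
  then show "nrm (comb F (\<lambda>x. 1 / (1 - \<phi> x) * a x)) \<le> 1 / (1 - l) * nrm (comb F a)"
    using l by (simp add: c_def[abs_def] field_simps)
qed

text \<open>
  The normalized kernel function is \<open>(1 - l\<^sup>2) / (1 - L x w)\<close> with \<open>l\<^sup>2 = L w w\<close>, and the resolvent bound is
  \<open>1 / (1 - l)\<close>. The product \<open>1 + l\<close> is bounded independently of \<open>w\<close>: these functions are the
  supply of test multipliers.
\<close>

lemma mult_bound_normalized_kernel:
  assumes w: "w \<in> X"
  shows "mult_bound (\<lambda>x. K x w / K w w) 2"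
proof -
  obtain l where l: "L w w = of_real (l\<^sup>2)" "0 \<le> l" "l < 1" using L_self[OF w] .
  have "mult_bound (\<lambda>x. (1 - L w w) * (1 / (1 - L x w))) (cmod (1 - L w w) * (1 / (1 - l)))"
    by (intro mult_bound_cmult mult_bound_resolvent mult_bound_L w l)
      (use L_ne[OF _ w] in auto)
  moreover have "cmod (1 - L w w) * (1 / (1 - l)) \<le> 2"
  proof -
    have "1 - L w w = of_real ((1 - l) * (1 + l))"
      by (simp add: l(1) power2_eq_square algebra_simps)
    then have "cmod (1 - L w w) = \<bar>(1 - l) * (1 + l)\<bar>" by (metis norm_of_real real_norm_def)
    then show ?thesis using l by (simp add: abs_mult)
  qed
  ultimately have "mult_bound (\<lambda>x. (1 - L w w) * (1 / (1 - L x w))) 2"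
    by (rule mult_bound_mono)
  then show ?thesis
  proof (rule mult_bound_limit[of "\<lambda>_::nat. _", OF _])
    fix x assume x: "x \<in> X"
    have "(1 - L w w) * (1 / (1 - L x w)) = K x w / K w w"
      using K_eq[OF x w] K_eq[OF w w] by simp
    then show "(\<lambda>n. (1 - L w w) * (1 / (1 - L x w))) \<longlonglongrightarrow> K x w / K w w" by simp
  qed
qed

text \<open>
  As all kernel functions have positive real part, nothing cancels in a positive combination of
  them, so one function can be nearly as large as possible along a whole sequence.
\<close>

lemma large_along_sequence:
  fixes s :: "nat \<Rightarrow> 'a"
  assumes s: "\<And>n. s n \<in> X"
  shows "\<exists>f\<in>H. \<forall>n. (1/2) ^ n * nrm (ker (s n)) \<le> cmod (f (s n))"
proof -
  define c where "c i = (1/2) ^ i / nrm (ker (s i))" for i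
  have c: "c i > 0" for i using nrm_ker_pos[OF s] by (simp add: c_def)
  define F where "F n = (\<lambda>x. \<Sum>i<n. of_real (c i) * ker (s i) x)" for n
  have FH: "F n \<in> H" for n
    unfolding F_def by (intro sum_mem scale_mem ker_mem s) auto
  have Fdiff: "nrm (\<lambda>x. F m x - F n x) \<le> 2 * (1/2) ^ n" if "n \<le> m" for m n
  proof -
    have "(\<lambda>x. F m x - F n x) = (\<lambda>x. \<Sum>i\<in>{n..<m}. of_real (c i) * ker (s i) x)"
    proof
      fix x
      show "F m x - F n x = (\<Sum>i\<in>{n..<m}. of_real (c i) * ker (s i) x)"
        unfolding F_def lessThan_atLeast0 using that by (intro sum_diff_nat_ivl) auto
    qed
    then have "nrm (\<lambda>x. F m x - F n x) \<le> (\<Sum>i\<in>{n..<m}. nrm (\<lambda>x. of_real (c i) * ker (s i) x))"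
      using nrm_sum_le[of "{n..<m}" "\<lambda>i x. of_real (c i) * ker (s i) x"] scale_mem ker_mem s by simp
    also have "\<dots> = (\<Sum>i\<in>{n..<m}. (1/2) ^ i)"
    proof (rule sum.cong[OF refl])
      fix i
      show "nrm (\<lambda>x. of_real (c i) * ker (s i) x) = (1/2) ^ i"
      proof -
        have "c i * nrm (ker (s i)) = (1/2) ^ i"
          using nrm_ker_pos[OF s, of i] by (simp add: c_def)
        then show ?thesis
          using nrm_scale[OF ker_mem[OF s], of "of_real (c i)" i] c[of i] by simp
      qed
    qed
    also have "\<dots> \<le> 2 * (1/2) ^ n"
    proof -
      have "(\<Sum>i\<in>{n..<m}. (1/2::real) ^ i) = 2 * (1/2) ^ n - 2 * (1/2) ^ m"
        using that by (induction m rule: dec_induct) (simp_all)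
      then show ?thesis by simp
    qed
    finally show ?thesis .
  qed
  have sym: "nrm (\<lambda>x. F m x - F n x) = nrm (\<lambda>x. F n x - F m x)" for m n
    using nrm_scale[OF diff_mem[OF FH FH], of "-1" m n] by simp
  have "\<exists>f\<in>H. (\<lambda>n. sqrt (Re (ip (\<lambda>x. F n x - f x) (\<lambda>x. F n x - f x)))) \<longlonglongrightarrow> 0"
  proof (rule complete[OF FH])
    fix e :: real assume e: "e > 0"
    obtain N where N: "(1/2::real) ^ N < e / 2"
      using real_arch_pow_inv[of "e/2" "1/2"] e by auto
    show "\<exists>N. \<forall>m\<ge>N. \<forall>n\<ge>N. sqrt (Re (ip (\<lambda>x. F m x - F n x) (\<lambda>x. F m x - F n x))) < e"
    proof (intro exI allI impI)
      fix m n assume mn: "N \<le> m" "N \<le> n"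
      have le: "(1/2::real) ^ k \<le> (1/2) ^ N" if "N \<le> k" for k
        using that by (intro power_decreasing) auto
      have "nrm (\<lambda>x. F m x - F n x) \<le> 2 * (1/2) ^ N"
      proof (cases "n \<le> m")
        case True
        then show ?thesis using Fdiff[OF True] le[OF mn(2)] by linarith
      next
        case False
        then show ?thesis using Fdiff[of m n] le[OF mn(1)] sym[of m n] by linarith
      qed
      then show "sqrt (Re (ip (\<lambda>x. F m x - F n x) (\<lambda>x. F m x - F n x))) < e"
        using N by (simp add: nrm_def)
    qed
  qed
  then obtain f where f: "f \<in> H" "(\<lambda>n. nrm (\<lambda>x. F n x - f x)) \<longlonglongrightarrow> 0"
    unfolding nrm_def by blast
  have lim: "(\<lambda>n. F n x) \<longlonglongrightarrow> f x" if x: "x \<in> X" for x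
  proof -
    have "(\<lambda>n. F n x - f x) \<longlonglongrightarrow> 0"
    proof (rule Lim_null_comparison)
      show "\<forall>\<^sub>F n in sequentially. norm (F n x - f x) \<le> nrm (\<lambda>x. F n x - f x) * nrm (ker x)"
        using eval_bound[OF diff_mem[OF FH f(1)] x] by simp
      show "(\<lambda>n. nrm (\<lambda>x. F n x - f x) * nrm (ker x)) \<longlonglongrightarrow> 0"
        using tendsto_mult_right[OF f(2), of "nrm (ker x)"] by simp
    qed
    then show ?thesis by (simp add: LIM_zero_iff)
  qed
  have "(1/2) ^ m * nrm (ker (s m)) \<le> cmod (f (s m))" for m
  proof -
    have "(\<lambda>n. Re (F n (s m))) \<longlonglongrightarrow> Re (f (s m))"
      by (intro tendsto_intros lim s)
    moreover have "(1/2) ^ m * nrm (ker (s m)) \<le> Re (F n (s m))" if "n \<ge> Suc m" for n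
    proof -
      have t: "Re (of_real (c i) * ker (s i) (s m)) = c i * Re (K (s m) (s i))" for i
        using s by (simp add: ker_def on_set_def)
      have "(1/2) ^ m * nrm (ker (s m)) = c m * Re (K (s m) (s m))"
        using K_self[OF s, of m] nrm_ker_pos[OF s, of m] by (simp add: c_def power2_eq_square)
      also have "\<dots> \<le> (\<Sum>i<n. c i * Re (K (s m) (s i)))"
        using that c Re_K_pos[OF s s] by (intro member_le_sum) (auto intro: mult_nonneg_nonneg less_imp_le)
      also have "\<dots> = Re (F n (s m))"
        unfolding F_def Re_sum t ..
      finally show ?thesis .
    qed
    ultimately have "(1/2) ^ m * nrm (ker (s m)) \<le> Re (f (s m))"
      by (intro LIMSEQ_le_const) auto
    then show ?thesis using complex_Re_le_cmod[of "f (s m)"] by linarith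
  qed
  with f(1) show ?thesis by blast
qed

lemma nrm_ker_minus_projection:
  assumes x: "x \<in> X" and y: "y \<in> X"
  shows "nrm (\<lambda>z. ker x z - K y x / K y y * ker y z) = nrm (ker x) * kdist K x y"
proof -
  define p q c where "p = nrm (ker x)" and "q = nrm (ker y)" and "c = K y x / K y y"
  have pq: "p > 0" "q > 0" using nrm_ker_pos x y by (auto simp: p_def q_def)
  have Kx: "K x x = of_real (p\<^sup>2)" and Ky: "K y y = of_real (q\<^sup>2)"
    using K_self x y by (auto simp: p_def q_def)
  define A where "A = cmod (K x y)"
  have A: "cmod (K y x) = A" unfolding A_def using K_herm[OF x y] by simp
  have cmc: "cmod c = A / q\<^sup>2" by (simp add: c_def Ky norm_divide norm_power A)
  have "ip (ker x) (\<lambda>z. c * ker y z) = cnj c * K y x"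
    by (simp add: ip_scale_right ker_mem x y ip_ker_ker)
  also have "\<dots> = of_real (A\<^sup>2 / q\<^sup>2)"
    by (simp add: c_def Ky A[symmetric] complex_norm_square[symmetric] mult.commute)
  finally have "Re (ip (ker x) (\<lambda>z. c * ker y z)) = A\<^sup>2 / q\<^sup>2"
    by (metis Re_complex_of_real)
  then have "(nrm (\<lambda>z. ker x z - c * ker y z))\<^sup>2 = p\<^sup>2 + (cmod c * q)\<^sup>2 - 2 * (A\<^sup>2 / q\<^sup>2)"
    using nrm_diff_sq[OF ker_mem[OF x] scale_mem[OF ker_mem[OF y], of c]] nrm_scale[OF ker_mem[OF y], of c]
    by (simp add: p_def q_def)
  also have "\<dots> = p\<^sup>2 * (1 - A\<^sup>2 / (p\<^sup>2 * q\<^sup>2))"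
    unfolding cmc using pq by (simp add: power2_eq_square field_simps)
  finally have e: "(nrm (\<lambda>z. ker x z - c * ker y z))\<^sup>2 = p\<^sup>2 * (1 - A\<^sup>2 / (p\<^sup>2 * q\<^sup>2))" .
  then have "nrm (\<lambda>z. ker x z - c * ker y z) = sqrt (p\<^sup>2 * (1 - A\<^sup>2 / (p\<^sup>2 * q\<^sup>2)))"
    using nrm_nonneg[OF diff_mem[OF ker_mem[OF x] scale_mem[OF ker_mem[OF y], of c]]]
    by (metis abs_of_nonneg real_sqrt_abs)
  also have "\<dots> = p * kdist K x y"
    unfolding kdist_def using pq by (simp add: real_sqrt_mult Kx Ky A_def)
  finally show ?thesis by (simp add: p_def c_def)
qed

lemma kdist_nonneg: "x \<in> X \<Longrightarrow> y \<in> X \<Longrightarrow> 0 \<le> kdist K x y"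
  using nrm_ker_minus_projection[of x y] nrm_ker_pos[of x]
    nrm_nonneg[OF diff_mem[OF ker_mem scale_mem[OF ker_mem]], of x y "K y x / K y y"]
  by (simp add: zero_le_mult_iff)

text \<open>
  A substitute for boundedness of multiplication operators and for the estimate
  \<open>cmod (\<psi> x - \<psi> y) \<le> C * kdist K x y\<close> that it implies. With \<open>f\<close> large along the two sequences,
  testing \<open>f\<close> and \<open>\<psi> * f\<close> against the component of the kernel function at \<open>x n\<close> orthogonal to the one
  at \<open>y n\<close> gives the estimate up to a geometric factor, which costs nothing when the distances
  are chosen to decrease faster.
\<close>

lemma Mult_difference_bound:
  fixes x y :: "nat \<Rightarrow> 'a"
  assumes x: "\<And>n. x n \<in> X" and y: "\<And>n. y n \<in> X" and \<psi>: "\<psi> \<in> Mult X H"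
  shows "\<exists>C. \<forall>n. cmod (\<psi> (x n) - \<psi> (y n)) \<le> C * 16 ^ n * kdist K (x n) (y n)"
proof -
  \<comment> \<open>interleaving makes one \<open>f\<close> large along both sequences: weight \<open>4\<^sup>-\<^sup>n\<close> at \<open>x n\<close> and \<open>4\<^sup>-\<^sup>n / 2\<close> at \<open>y n\<close>\<close>
  define s where "s n = (if even n then x (n div 2) else y (n div 2))" for n
  have sX: "s n \<in> X" for n using x y by (simp add: s_def)
  obtain f where f: "f \<in> H" and fs: "\<And>n. (1/2) ^ n * nrm (ker (s n)) \<le> cmod (f (s n))"
    using large_along_sequence[of s, OF sX] by blast
  define g where "g = (\<lambda>z. \<psi> z * f z)"
  have g: "g \<in> H" using \<psi> f by (simp add: Mult_def g_def)
  define C where "C = nrm g + 2 * nrm g * nrm f"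
  have "cmod (\<psi> (x n) - \<psi> (y n)) \<le> C * 16 ^ n * kdist K (x n) (y n)" for n
  proof -
    define a b where "a = nrm (ker (x n))" and "b = nrm (ker (y n))"
    have ab: "a > 0" "b > 0" using nrm_ker_pos x y by (auto simp: a_def b_def)
    have nn: "0 \<le> nrm f" "0 \<le> nrm g" using nrm_nonneg f g by auto
    have fx: "(1/4) ^ n * a \<le> cmod (f (x n))"
      using fs[of "2 * n"] by (simp add: s_def a_def power_mult power2_eq_square)
    have fy: "(1/4) ^ n * b / 2 \<le> cmod (f (y n))"
      using fs[of "2 * n + 1"] by (simp add: s_def b_def power_mult power2_eq_square)
    have "cmod (\<psi> (y n)) * ((1/4) ^ n * b / 2) \<le> cmod (\<psi> (y n)) * cmod (f (y n))"
      by (intro mult_left_mono fy) auto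
    also have "\<dots> \<le> nrm g * b"
      using eval_bound[OF g y, of n] by (simp add: g_def norm_mult b_def)
    finally have "cmod (\<psi> (y n)) * (1/4) ^ n \<le> 2 * nrm g" using ab by simp
    then have \<psi>y: "cmod (\<psi> (y n)) \<le> 2 * nrm g * 4 ^ n"
      by (simp add: power_one_over divide_le_eq)
    define c where "c = K (y n) (x n) / K (y n) (y n)"
    define v where "v = (\<lambda>z. ker (x n) z - c * ker (y n) z)"
    have v: "v \<in> H" unfolding v_def by (intro diff_mem scale_mem ker_mem x y)
    have nv: "nrm v = a * kdist K (x n) (y n)"
      unfolding v_def a_def c_def by (rule nrm_ker_minus_projection[OF x y])
    have ipv: "ip h v = h (x n) - cnj c * h (y n)" if "h \<in> H" for h
      using that by (simp add: v_def ip_diff_right scale_mem ker_mem x y ip_scale_right reproduce)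
    have "(\<psi> (x n) - \<psi> (y n)) * f (x n) = ip g v - \<psi> (y n) * ip f v"
      unfolding ipv[OF g] ipv[OF f] by (simp add: g_def algebra_simps)
    then have "cmod (\<psi> (x n) - \<psi> (y n)) * cmod (f (x n)) \<le> cmod (ip g v) + cmod (\<psi> (y n)) * cmod (ip f v)"
      by (metis norm_mult norm_triangle_ineq4)
    also have "\<dots> \<le> nrm g * nrm v + (2 * nrm g * 4 ^ n) * (nrm f * nrm v)"
      using cauchy_schwarz[OF g v] cauchy_schwarz[OF f v] \<psi>y nn
      by (intro add_mono mult_mono) auto
    also have "\<dots> = (nrm g + 2 * nrm g * nrm f * 4 ^ n) * nrm v"
      by (simp add: algebra_simps)
    also have "\<dots> \<le> (C * 4 ^ n) * nrm v"
    proof (rule mult_right_mono)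
      have "nrm g * 1 \<le> nrm g * 4 ^ n" using nn by (intro mult_left_mono) auto
      then show "nrm g + 2 * nrm g * nrm f * 4 ^ n \<le> C * 4 ^ n"
        by (simp add: C_def algebra_simps)
    qed (rule nrm_nonneg[OF v])
    finally have "cmod (\<psi> (x n) - \<psi> (y n)) * cmod (f (x n)) \<le> C * 4 ^ n * (a * kdist K (x n) (y n))"
      by (simp add: nv)
    moreover have "cmod (\<psi> (x n) - \<psi> (y n)) * ((1/4) ^ n * a) \<le> cmod (\<psi> (x n) - \<psi> (y n)) * cmod (f (x n))"
      by (intro mult_left_mono fx) auto
    ultimately have "cmod (\<psi> (x n) - \<psi> (y n)) * (1/4) ^ n * a \<le> (C * 4 ^ n * kdist K (x n) (y n)) * a"
      by (simp add: mult_ac)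
    then have "cmod (\<psi> (x n) - \<psi> (y n)) * (1/4) ^ n \<le> C * 4 ^ n * kdist K (x n) (y n)"
      using ab by simp
    then have "cmod (\<psi> (x n) - \<psi> (y n)) \<le> C * 4 ^ n * kdist K (x n) (y n) * 4 ^ n"
      by (simp add: power_one_over divide_le_eq)
    also have "\<dots> = C * (4 * 4) ^ n * kdist K (x n) (y n)"
      unfolding power_mult_distrib by (simp add: mult_ac)
    finally show ?thesis by simp
  qed
  then show ?thesis by blast
qed

text \<open>
  Points at distance at least \<open>e\<close> are told apart by one of the two normalized kernel functions:
  if both were close to \<open>1\<close> at the other point, so would be the product of these two values, which is
  \<open>1 - kdist\<^sup>2\<close>.
\<close>

lemma kernel_separates:
  assumes x: "x \<in> X" and y: "y \<in> X" and e: "0 < e" "e \<le> kdist K x y"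
  shows "\<exists>\<phi>. mult_bound \<phi> 2 \<and> e\<^sup>2 / 2 \<le> cmod (\<phi> x - \<phi> y)"
proof (rule ccontr)
  assume con: "\<not> ?thesis"
  let ?u = "K x y / K y y" and ?v = "K y x / K x x"
  define d where "d = e\<^sup>2 / 2"
  have u: "cmod (?u - 1) < d" and v: "cmod (1 - ?v) < d"
    using con mult_bound_normalized_kernel[OF y] mult_bound_normalized_kernel[OF x] K_ne x y
    by (auto simp: d_def not_le)
  obtain p q where pq: "K x x = of_real p" "K y y = of_real q"
    using K_self x y by blast
  have pos: "p > 0" "q > 0" using Re_K_pos[OF x x] Re_K_pos[OF y y] pq by auto
  have "cmod ?u * cmod ?v = (cmod (K x y))\<^sup>2 / (p * q)"
    using K_herm[OF x y] pos by (simp add: pq norm_divide power2_eq_square)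
  moreover have "e\<^sup>2 \<le> (kdist K x y)\<^sup>2" using e by (intro power_mono) auto
  moreover have "0 \<le> 1 - (cmod (K x y))\<^sup>2 / (p * q)"
    using e unfolding kdist_def pq by (smt (verit) Re_complex_of_real real_sqrt_lt_0_iff)
  ultimately have le: "cmod ?u * cmod ?v \<le> 1 - 2 * d"
    by (simp add: kdist_def pq d_def)
  have "1 - d < cmod ?u" "1 - d < cmod ?v"
    using u v norm_triangle_ineq2[of 1 ?v] norm_triangle_ineq2[of 1 "?u"]
    by (auto simp: norm_minus_commute)
  moreover have "0 < d" using e by (simp add: d_def)
  moreover have "0 \<le> 1 - 2 * d" by (rule order_trans[OF _ le]) simp
  ultimately have "(1 - d) * (1 - d) < cmod ?u * cmod ?v"
    by (intro mult_strict_mono) auto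
  moreover have "1 - 2 * d \<le> (1 - d) * (1 - d)"
    using zero_le_square[of d] by (simp add: algebra_simps)
  ultimately show False using le by linarith
qed

end

section \<open>Comparison of distances under multiplier maps\<close>

text \<open>
  Gliding hump: the coefficients are chosen one after the other, each one so that the part of the
  \<open>n\<close>-th sum known by then is large: of the two partial sums with coefficient \<open>0\<close> or \<open>1\<close> in front of a
  summand of size \<open>t\<^sup>n * \<eta>\<close>, one has at least half that size. The remaining terms are too small to
  spoil this.
\<close>

fun hump_coeff :: "(nat \<Rightarrow> nat \<Rightarrow> complex) \<Rightarrow> (nat \<Rightarrow> real) \<Rightarrow> nat \<Rightarrow> real" where
  "hump_coeff D c n =
     (if c n \<le> cmod (\<Sum>k\<in>{..<n}. of_real (hump_coeff D c k) * D n k) then 0 else 1)"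

declare hump_coeff.simps [simp del]

lemma gliding_hump:
  fixes D :: "nat \<Rightarrow> nat \<Rightarrow> complex"
  assumes up: "\<And>n k. cmod (D n k) \<le> 4" and low: "\<And>n. \<eta> \<le> cmod (D n n)" and \<eta>: "0 < \<eta>"
  defines "t \<equiv> \<eta> / 32"  \<comment> \<open>then the tail \<open>4 * t / (1 - t)\<close> is at most \<open>8 * t = \<eta> / 4\<close>\<close>
  obtains s :: "nat \<Rightarrow> real" where "\<And>k. s k = 0 \<or> s k = 1"
    and "\<And>n. t ^ n * \<eta> / 4 \<le> cmod (\<Sum>k. of_real (s k * t ^ k) * D n k)"
    and "0 < t" "t \<le> 1/8"
proof -
  have t: "0 < t" "t \<le> 1/8" using \<eta> low[of 0] up[of 0 0] by (auto simp: t_def)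
  define E where "E n k = of_real (t ^ k) * D n k" for n k
  define s where "s = hump_coeff E (\<lambda>n. t ^ n * \<eta> / 2)"
  have s: "s n = (if t ^ n * \<eta> / 2 \<le> cmod (\<Sum>k<n. of_real (s k) * E n k) then 0 else 1)" for n
    unfolding s_def by (subst hump_coeff.simps) (rule refl)
  have s01: "s k = 0 \<or> s k = 1" for k using s[of k] by presburger
  have "t ^ n * \<eta> / 4 \<le> cmod (\<Sum>k. of_real (s k * t ^ k) * D n k)" for n
  proof -
    define h where "h k = of_real (s k) * E n k" for k
    have hb: "cmod (h k) \<le> 4 * t ^ k" for k
    proof -
      have "cmod (h k) \<le> t ^ k * cmod (D n k)"
        using s01[of k] t by (auto simp: h_def E_def norm_mult norm_power)
      also have "\<dots> \<le> t ^ k * 4" using up t by (intro mult_left_mono) auto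
      finally show ?thesis by simp
    qed
    have gs: "(\<lambda>k. 4 * t ^ k) sums (4 * (1 / (1 - t)))"
      using t by (intro sums_mult geometric_sums) auto
    have sh: "summable h"
      by (rule summable_comparison_test'[OF sums_summable[OF gs]]) (use hb in auto)
    have head: "t ^ n * \<eta> / 2 \<le> cmod (\<Sum>k<Suc n. h k)"
    proof (cases "t ^ n * \<eta> / 2 \<le> cmod (\<Sum>k<n. h k)")
      case True
      then have "s n = 0" using s[of n] by (simp add: h_def)
      then show ?thesis using True by (simp add: h_def)
    next
      case False
      then have "h n = of_real (t ^ n) * D n n" using s[of n] by (simp add: h_def E_def)
      then have "t ^ n * \<eta> \<le> cmod (h n)" using low[of n] t by (simp add: norm_mult norm_power)
      moreover have "cmod (h n) \<le> cmod (\<Sum>k<Suc n. h k) + cmod (\<Sum>k<n. h k)"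
        using norm_triangle_ineq4[of "\<Sum>k<Suc n. h k" "\<Sum>k<n. h k"] by simp
      ultimately show ?thesis using False by linarith
    qed
    have split: "(\<Sum>k. h k) = (\<Sum>k. h (k + Suc n)) + (\<Sum>k<Suc n. h k)"
      by (rule suminf_split_initial_segment[OF sh])
    have gs': "(\<lambda>k. 4 * t ^ (k + Suc n)) sums (4 * (t ^ Suc n * (1 / (1 - t))))"
      using sums_mult[OF geometric_sums[of t], of "4 * t ^ Suc n"] t by (simp add: power_add mult_ac)
    have "cmod (\<Sum>k. h (k + Suc n)) \<le> (\<Sum>k. 4 * t ^ (k + Suc n))"
      by (rule norm_suminf_le[OF hb sums_summable[OF gs']])
    also have "\<dots> = 4 * (t ^ Suc n * (1 / (1 - t)))" using gs' by (rule sums_unique[symmetric])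
    also have "\<dots> = t ^ n * (4 * t * (1 / (1 - t)))" by simp
    also have "\<dots> \<le> t ^ n * (\<eta> / 4)"
    proof (rule mult_left_mono)
      have "1 / (1 - t) \<le> 2" using t by (simp add: field_simps)
      then have "4 * t * (1 / (1 - t)) \<le> 4 * t * 2" using t by (intro mult_left_mono) auto
      then show "4 * t * (1 / (1 - t)) \<le> \<eta> / 4" by (simp add: t_def)
    qed (use t in simp)
    finally have tail: "cmod (\<Sum>k. h (k + Suc n)) \<le> t ^ n * \<eta> / 4" by simp
    have "cmod (\<Sum>k<Suc n. h k) \<le> cmod (\<Sum>k. h k) + cmod (\<Sum>k. h (k + Suc n))"
      using norm_triangle_ineq4[of "\<Sum>k. h k" "\<Sum>k. h (k + Suc n)"] split by simp
    then have "t ^ n * \<eta> / 4 \<le> cmod (\<Sum>k. h k)" using head tail by argo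
    moreover have "h = (\<lambda>k. of_real (s k * t ^ k) * D n k)"
      by (auto simp: h_def E_def)
    ultimately show ?thesis by simp
  qed
  with that s01 t show ?thesis by blast
qed

text \<open>
  A quantitative closed graph argument. If the claim fails, there are pairs of points whose
  \<open>kdist K1\<close> tends to \<open>0\<close> as fast as desired, while \<open>kdist K2\<close> stays bounded below. The kernel
  multipliers that separate their images under \<open>q\<close> are glued by a gliding hump to one multiplier \<open>\<Phi>\<close>,
  whose differences along the pairs decay only like \<open>t\<^sup>n\<close>. The multiplier corresponding to it on the
  first space would have to have the same differences, contradicting \<open>Mult_difference_bound\<close>.
  
  Stated for two maps \<open>p\<close> and \<open>q\<close> from a common set, the lemma serves for both directions of the
  composition map.
\<close>

lemma kdist_transfer:
  assumes one: "pick_space X1 H1 ip1 K1 L1" and two: "pick_space X2 H2 ip2 K2 L2"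
    and p: "\<And>z. z \<in> Z \<Longrightarrow> p z \<in> X1" and q: "\<And>z. z \<in> Z \<Longrightarrow> q z \<in> X2"
    and transfer: "\<And>\<phi>. \<phi> \<in> Mult X2 H2 \<Longrightarrow> \<exists>\<psi>\<in>Mult X1 H1. \<forall>z\<in>Z. \<phi> (q z) = \<psi> (p z)"
    and e: "0 < e"
  shows "\<exists>d>0. \<forall>z\<in>Z. \<forall>w\<in>Z. kdist K1 (p z) (p w) < d \<longrightarrow> kdist K2 (q z) (q w) < e"
proof (rule ccontr)
  assume con: "\<not> ?thesis"
  interpret A: pick_space X1 H1 ip1 K1 L1 by (rule one)
  interpret B: pick_space X2 H2 ip2 K2 L2 by (rule two)
  define \<eta> where "\<eta> = e\<^sup>2 / 2"
  have \<eta>: "\<eta> > 0" using e by (simp add: \<eta>_def)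
  define t where "t = \<eta> / 32"
  have t0: "t > 0" using \<eta> by (simp add: t_def)
  \<comment> \<open>\<open>(t / 32)\<^sup>n\<close> beats the factor \<open>16\<^sup>n\<close> of \<open>Mult_difference_bound\<close> and the hump height \<open>t\<^sup>n\<close> by \<open>2\<^sup>n\<close>\<close>
  have "\<exists>z w. z \<in> Z \<and> w \<in> Z \<and> kdist K1 (p z) (p w) < (t / 32) ^ n \<and> e \<le> kdist K2 (q z) (q w)" for n :: nat
  proof -
    have "(t / 32) ^ n > 0" using t0 by simp
    then show ?thesis using con by (meson not_less)
  qed
  then obtain z w where zw: "\<And>n. z n \<in> Z" "\<And>n. w n \<in> Z"
      "\<And>n. kdist K1 (p (z n)) (p (w n)) < (t / 32) ^ n" "\<And>n. e \<le> kdist K2 (q (z n)) (q (w n))"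
    by metis
  have "\<exists>\<phi>. B.mult_bound \<phi> 2 \<and> \<eta> \<le> cmod (\<phi> (q (z n)) - \<phi> (q (w n)))" for n
    unfolding \<eta>_def by (rule B.kernel_separates) (use q zw e in auto)
  then obtain \<phi> where \<phi>: "\<And>n. B.mult_bound (\<phi> n) 2"
      "\<And>n. \<eta> \<le> cmod (\<phi> n (q (z n)) - \<phi> n (q (w n)))"
    by metis
  have sup: "cmod (\<phi> k x) \<le> 2" if "x \<in> X2" for k x
    using B.mult_bound_sup[OF \<phi>(1) that] B.K_ne that by blast
  define D where "D n k = \<phi> k (q (z n)) - \<phi> k (q (w n))" for n k
  have "cmod (D n k) \<le> 4" for n k
    using norm_triangle_ineq4[of "\<phi> k (q (z n))" "\<phi> k (q (w n))"] sup[of "q (z n)" k] sup[of "q (w n)" k] q zw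
    by (simp add: D_def)
  moreover have "\<eta> \<le> cmod (D n n)" for n using \<phi> by (simp add: D_def)
  ultimately obtain s where s: "\<And>k. s k = 0 \<or> s k = (1::real)"
    and big: "\<And>n. t ^ n * \<eta> / 4 \<le> cmod (\<Sum>k. of_real (s k * t ^ k) * D n k)"
    and t: "0 < t" "t \<le> 1/8"
    unfolding t_def using gliding_hump[of D \<eta>] \<eta> by blast
  have sb: "\<bar>s k\<bar> \<le> 1" for k using s[of k] by auto
  have smm: "summable (\<lambda>k. t ^ k * 2)" using t by (intro summable_mult2 summable_geometric) auto
  have term_le: "cmod (of_real (s k * t ^ k) * \<phi> k x) \<le> t ^ k * 2" if "x \<in> X2" for k x
    using mult_mono[OF mult_right_mono[OF sb, of "t ^ k" k] sup[OF that, of k]] t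
    by (simp add: norm_mult norm_power abs_mult)
  define \<Phi> where "\<Phi> x = (\<Sum>k. of_real (s k * t ^ k) * \<phi> k x)" for x
  have sm: "summable (\<lambda>k. of_real (s k * t ^ k) * \<phi> k x)" if "x \<in> X2" for x
    by (rule summable_comparison_test'[OF smm]) (use term_le that in auto)
  have "B.mult_bound \<Phi> (\<Sum>k. t ^ k * 2)"
  proof (rule B.mult_bound_series[OF _ smm])
    fix k
    have "B.mult_bound (\<lambda>x. of_real (s k * t ^ k) * \<phi> k x) (cmod (of_real (s k * t ^ k)) * 2)"
      by (intro B.mult_bound_cmult \<phi>)
    then show "B.mult_bound (\<lambda>x. of_real (s k * t ^ k) * \<phi> k x) (t ^ k * 2)"
    proof (rule B.mult_bound_mono)
      show "cmod (of_real (s k * t ^ k)) * 2 \<le> t ^ k * 2"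
        using s[of k] t by (auto simp: norm_mult norm_power)
    qed
  next
    fix x assume "x \<in> X2"
    then show "(\<lambda>k. of_real (s k * t ^ k) * \<phi> k x) sums \<Phi> x"
      unfolding \<Phi>_def by (intro summable_sums sm)
  qed
  then have "on_set X2 \<Phi> \<in> Mult X2 H2" by (rule B.mult_bound_imp_Mult)
  then obtain \<psi> where \<psi>: "\<psi> \<in> Mult X1 H1" "\<And>z. z \<in> Z \<Longrightarrow> on_set X2 \<Phi> (q z) = \<psi> (p z)"
    using transfer by blast
  obtain C where C: "\<And>n. cmod (\<psi> (p (z n)) - \<psi> (p (w n))) \<le> C * 16 ^ n * kdist K1 (p (z n)) (p (w n))"
    using A.Mult_difference_bound[of "\<lambda>n. p (z n)" "\<lambda>n. p (w n)" \<psi>] p zw \<psi>(1) by blast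
  have main: "\<eta> / 4 * 2 ^ n \<le> \<bar>C\<bar>" for n
  proof -
    have "(\<Sum>k. of_real (s k * t ^ k) * D n k) = \<Phi> (q (z n)) - \<Phi> (q (w n))"
      unfolding \<Phi>_def D_def using suminf_diff[OF sm sm, of "q (z n)" "q (w n)"] q zw
      by (simp add: algebra_simps)
    also have "\<dots> = \<psi> (p (z n)) - \<psi> (p (w n))"
      using \<psi>(2)[OF zw(1), of n] \<psi>(2)[OF zw(2), of n] q zw by (simp add: on_set_def)
    finally have "t ^ n * \<eta> / 4 \<le> C * 16 ^ n * kdist K1 (p (z n)) (p (w n))"
      using big[of n] C[of n] by simp
    also have "\<dots> \<le> \<bar>C\<bar> * 16 ^ n * (t / 32) ^ n"
      using zw(3)[of n] A.kdist_nonneg[OF p[OF zw(1)] p[OF zw(2)], of n n]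
      by (intro mult_mono) auto
    also have "\<dots> = \<bar>C\<bar> * (16 * (t / 32)) ^ n" by (simp only: power_mult_distrib mult.assoc)
    also have "\<dots> = \<bar>C\<bar> * (t ^ n * (1/2) ^ n)" by (simp add: power_mult_distrib[symmetric])
    finally have "\<eta> / 4 * t ^ n \<le> \<bar>C\<bar> * (1/2) ^ n * t ^ n" by (simp add: mult_ac)
    then have "\<eta> / 4 \<le> \<bar>C\<bar> * (1/2) ^ n" using t by simp
    then show ?thesis by (simp add: power_one_over field_simps)
  qed
  obtain n where "\<bar>C\<bar> / (\<eta> / 4) < 2 ^ n" using real_arch_pow[of 2] by auto
  then show False using main[of n] \<eta> by (simp add: field_simps)
qed

section \<open>The Drury--Arveson space\<close>

lemma cdot_scale_left: "cdot (c *s x) y = c * cdot x y"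
  by (simp add: cdot_def sum_distrib_left mult.assoc)

lemma cdot_scale_right: "cdot x (c *s y) = cnj c * cdot x y"
  by (simp add: cdot_def sum_distrib_left algebra_simps)

lemma cdot_add_left: "cdot (x + y) z = cdot x z + cdot y z"
  by (simp add: cdot_def sum.distrib algebra_simps)

lemma cdot_add_right: "cdot z (x + y) = cdot z x + cdot z y"
  by (simp add: cdot_def sum.distrib algebra_simps)

lemma cdot_diff_left: "cdot (x - y) z = cdot x z - cdot y z"
  by (simp add: cdot_def sum_subtractf algebra_simps)

lemma cdot_diff_right: "cdot z (x - y) = cdot z x - cdot z y"
  by (simp add: cdot_def sum_subtractf algebra_simps)

lemma cdot_herm: "cnj (cdot x y) = cdot y x"
  by (simp add: cdot_def mult.commute)

lemma cdot_self: "cdot x x = of_real ((norm x)\<^sup>2)"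
proof -
  have "(norm x)\<^sup>2 = (\<Sum>i\<in>UNIV. (cmod (x $ i))\<^sup>2)"
    by (simp add: norm_vec_def L2_set_def sum_nonneg)
  then show ?thesis
    by (simp only: cdot_def of_real_sum complex_norm_square)
qed

lemma cdot_cauchy_schwarz: "cmod (cdot x y) \<le> norm x * norm y"
proof -
  have "cmod (cdot x y) \<le> (\<Sum>i\<in>UNIV. \<bar>cmod (x $ i)\<bar> * \<bar>cmod (y $ i)\<bar>)"
    unfolding cdot_def by (rule sum_norm_le) (simp add: norm_mult)
  also have "\<dots> \<le> norm x * norm y"
    unfolding norm_vec_def by (rule L2_set_mult_ineq)
  finally show ?thesis .
qed

lemma cdot_less_one: "norm x < 1 \<Longrightarrow> norm y < 1 \<Longrightarrow> cmod (cdot x y) < 1"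
  using cdot_cauchy_schwarz[of x y] mult_strict_mono'[of "norm x" 1 "norm y" 1] by simp

text \<open>
  Here \<open>L\<close> is the inner product, a finite sum of rank one kernels.
\<close>

lemma drury_arveson_pick_space:
  fixes H2 :: "(complex ^ 'n \<Rightarrow> complex) set"
  assumes "is_drury_arveson_space H2 ip"
  shows "pick_space (ball 0 1) H2 ip drury_arveson_kernel cdot"
proof -
  interpret rkhs "ball 0 1" H2 ip drury_arveson_kernel
    using assms by (simp add: is_drury_arveson_space_def)
  show ?thesis
  proof
    fix x y :: "complex ^ 'n" assume "x \<in> ball 0 1" "y \<in> ball 0 1"
    then show "cmod (cdot x y) < 1" by (simp add: cdot_less_one)
  next
    fix M :: "complex ^ 'n \<Rightarrow> complex ^ 'n \<Rightarrow> complex" assume M: "psd (ball 0 1) M"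
    have "psd (ball 0 1) (\<lambda>x y. \<Sum>i\<in>UNIV. x $ i * cnj (y $ i) * M x y)"
      by (intro psd_sum psd_rank_one M) auto
    then show "psd (ball 0 1) (\<lambda>x y. cdot x y * M x y)"
      by (simp add: cdot_def sum_distrib_right)
  qed (simp add: drury_arveson_kernel_def)
qed

text \<open>
  The linear part \<open>P + s Q\<close> of the automorphism of the ball exchanging \<open>v\<close> and \<open>0\<close>, where \<open>P\<close> is the
  orthogonal projection onto the span of \<open>v\<close> and \<open>Q = 1 - P\<close>. Written in this form it does not divide
  by the norm of \<open>v\<close>, since \<open>(1 - s) / (1 - s\<^sup>2) = 1 / (1 + s)\<close>.
\<close>

definition mobius_linear :: "complex ^ 'n \<Rightarrow> complex ^ 'n \<Rightarrow> complex ^ 'n" where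
  "mobius_linear v p =
     (let s = of_real (sqrt (1 - (norm v)\<^sup>2)) in s *s p + (cdot p v / (1 + s)) *s v)"

definition mobius :: "complex ^ 'n \<Rightarrow> complex ^ 'n \<Rightarrow> complex ^ 'n" where
  "mobius v x = (1 / (1 - cdot x v)) *s mobius_linear v (v - x)"

lemma cdot_mobius_linear:
  assumes v: "norm v < 1"
  shows "cdot (mobius_linear v p) (mobius_linear v q)
    = (1 - cdot v v) * cdot p q + cdot p v * cdot v q"
proof -
  define r where "r = sqrt (1 - (norm v)\<^sup>2)"
  have "(norm v)\<^sup>2 < 1" using v by (simp add: power_less_one_iff)
  then have r: "r > 0" "(norm v)\<^sup>2 = 1 - r\<^sup>2" by (auto simp: r_def)
  define s :: complex where "s = of_real r"
  have V: "cdot v v = 1 - s\<^sup>2" by (simp add: cdot_self r s_def)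
  have "1 + s = of_real (1 + r)" by (simp add: s_def)
  then have s1: "1 + s \<noteq> 0" using r by (metis add_pos_pos of_real_eq_0_iff order_less_irrefl zero_less_one)
  define a b where "a = cdot p v" and "b = cdot v q"
  have b: "cnj (cdot q v) = b" by (simp add: b_def cdot_herm)
  have cs: "cnj s = s" by (simp add: s_def)
  define d where "d = 1 / (1 + s)"
  have d: "(1 + s) * d = 1" using s1 by (simp add: d_def)
  have dd: "x / (1 + s) = x * d" for x by (simp add: d_def)
  have cd: "cnj d = d" by (simp add: d_def s_def)
  have "cdot (mobius_linear v p) (mobius_linear v q)
      = s * s * cdot p q + a * b * (2 * s * d + d * d * (1 - s\<^sup>2))"
    unfolding mobius_linear_def Let_def r_def[symmetric] s_def[symmetric] dd
    by (simp add: cdot_add_left cdot_add_right cdot_scale_left cdot_scale_right b cs cd V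
        a_def[symmetric] b_def[symmetric] algebra_simps)
  also have "2 * s * d + d * d * (1 - s\<^sup>2) = 2 * s * d + ((1 + s) * d) * (d - s * d)"
    by (simp add: power2_eq_square algebra_simps)
  also have "\<dots> = 2 * s * d + 1 * (d - s * d)" unfolding d ..
  also have "\<dots> = (1 + s) * d" by (simp add: algebra_simps)
  also have "\<dots> = 1" by (rule d)
  also have "s * s = 1 - cdot v v" using V by (simp add: power2_eq_square)
  finally show ?thesis by (simp add: a_def b_def)
qed

lemma mobius_identity:
  assumes v: "norm v < 1" and x: "norm x < 1" and y: "norm y < 1"
  shows "1 - cdot (mobius v x) (mobius v y)
    = (1 - cdot v v) * (1 - cdot x y) / ((1 - cdot x v) * (1 - cdot v y))"
proof -
  define a b V c where "a = cdot x v" and "b = cdot v y" and "V = cdot v v" and "c = cdot x y"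
  have a1: "1 - a \<noteq> 0" using cdot_less_one[OF x v] by (auto simp: a_def)
  have b1: "1 - b \<noteq> 0" using cdot_less_one[OF v y] by (auto simp: b_def)
  have cy: "cnj (cdot y v) = b" by (simp add: b_def cdot_herm)
  have "cdot (mobius v x) (mobius v y)
      = ((1 - V) * cdot (v - x) (v - y) + cdot (v - x) v * cdot v (v - y)) / ((1 - a) * (1 - b))"
    unfolding mobius_def cdot_scale_left cdot_scale_right cdot_mobius_linear[OF v]
    by (simp add: cy a_def[symmetric] V_def[symmetric])
  also have "cdot (v - x) (v - y) = V - b - a + c"
    by (simp add: cdot_diff_left cdot_diff_right a_def b_def V_def c_def)
  also have "cdot (v - x) v = V - a"
    by (simp add: cdot_diff_left a_def V_def)
  also have "cdot v (v - y) = V - b"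
    by (simp add: cdot_diff_right b_def V_def)
  finally have e: "cdot (mobius v x) (mobius v y)
      = ((1 - V) * (V - b - a + c) + (V - a) * (V - b)) / ((1 - a) * (1 - b))" .
  have "1 - cdot (mobius v x) (mobius v y)
      = ((1 - a) * (1 - b) - ((1 - V) * (V - b - a + c) + (V - a) * (V - b))) / ((1 - a) * (1 - b))"
    unfolding e using a1 b1 by (simp add: diff_divide_distrib)
  also have "(1 - a) * (1 - b) - ((1 - V) * (V - b - a + c) + (V - a) * (V - b)) = (1 - V) * (1 - c)"
    by (simp add: algebra_simps)
  finally show ?thesis by (simp add: a_def b_def V_def c_def)
qed

lemma mobius_center: "mobius v v = 0"
  by (simp add: mobius_def mobius_linear_def Let_def cdot_def)

lemma kdist_drury_arveson:
  fixes x y :: "complex ^ 'n"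
  shows
  "kdist drury_arveson_kernel x y
    = sqrt (1 - (1 - (norm x)\<^sup>2) * (1 - (norm y)\<^sup>2) / (cmod (1 - cdot x y))\<^sup>2)"
proof -
  have "drury_arveson_kernel z z = of_real (1 / (1 - (norm z)\<^sup>2))" for z :: "complex ^ 'n"
    by (simp add: drury_arveson_kernel_def cdot_self)
  then have "Re (drury_arveson_kernel z z) = 1 / (1 - (norm z)\<^sup>2)" for z :: "complex ^ 'n"
    by (metis Re_complex_of_real)
  moreover have "cmod (drury_arveson_kernel x y) = 1 / cmod (1 - cdot x y)"
    by (simp add: drury_arveson_kernel_def norm_divide)
  ultimately show ?thesis
    by (simp add: kdist_def power_divide)
qed

text \<open>
  By \<open>mobius_identity\<close> the kernel at the image points differs from the original one only by factors
  depending on a single variable, and these cancel in \<open>kdist\<close>.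
\<close>

lemma kdist_mobius:
  fixes v x y :: "complex ^ 'n"
  assumes v: "norm v < 1" and x: "norm x < 1" and y: "norm y < 1"
  shows "kdist drury_arveson_kernel (mobius v x) (mobius v y) = kdist drury_arveson_kernel x y"
proof -
  define D where "D = 1 - (norm v)\<^sup>2"
  have "(norm v)\<^sup>2 < 1" using v by (simp add: power_less_one_iff)
  then have D: "D > 0" by (simp add: D_def)
  define a where "a z = cmod (1 - cdot z v)" for z :: "complex ^ 'n"
  have a0: "a z > 0" if "norm z < 1" for z
    using cdot_less_one[OF that v] by (auto simp: a_def)
  have a': "cmod (1 - cdot v z) = a z" for z :: "complex ^ 'n"
    unfolding a_def by (metis cdot_herm complex_cnj_diff complex_cnj_one complex_mod_cnj)
  have cv: "cmod (1 - cdot v v) = D"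
  proof -
    have "1 - cdot v v = of_real D" by (simp add: cdot_self D_def)
    then show ?thesis using D by simp
  qed
  have m: "cmod (1 - cdot (mobius v z) (mobius v w)) = D * cmod (1 - cdot z w) / (a z * a w)"
    if "norm z < 1" "norm w < 1" for z w
    unfolding mobius_identity[OF v that] norm_divide norm_mult cv unfolding a' by (simp add: a_def)
  have s: "1 - (norm (mobius v z))\<^sup>2 = D * (1 - (norm z)\<^sup>2) / (a z)\<^sup>2" if z: "norm z < 1" for z
  proof -
    have "(1 - cdot z v) * (1 - cdot v z) = of_real ((a z)\<^sup>2)"
      unfolding a_def complex_norm_square by (simp add: cdot_herm)
    then have "1 - cdot (mobius v z) (mobius v z) = of_real (D * (1 - (norm z)\<^sup>2) / (a z)\<^sup>2)"
      unfolding mobius_identity[OF v z z] by (simp add: cdot_self D_def)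
    then have "complex_of_real (1 - (norm (mobius v z))\<^sup>2) = of_real (D * (1 - (norm z)\<^sup>2) / (a z)\<^sup>2)"
      by (simp add: cdot_self)
    then show ?thesis by (simp only: of_real_eq_iff)
  qed
  have c: "cmod (1 - cdot x y) > 0" using cdot_less_one[OF x y] by auto
  have alg: "(D * p / A\<^sup>2) * (D * q / B\<^sup>2) / (D * c / (A * B))\<^sup>2 = p * q / c\<^sup>2"
    if "A > 0" "B > 0" "c > 0" for p q A B c :: real
    using that D by (simp add: power2_eq_square field_simps)
  show ?thesis
    unfolding kdist_drury_arveson m[OF x y] s[OF x] s[OF y] alg[OF a0[OF x] a0[OF y] c] ..
qed

lemma kdist_drury_arveson_zero: "kdist drury_arveson_kernel 0 y = norm y"
  by (simp add: kdist_drury_arveson cdot_def)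

lemma kdist_drury_arveson_self: "norm x < 1 \<Longrightarrow> kdist drury_arveson_kernel x x = 0"
  using kdist_mobius[of x x x] by (simp add: mobius_center kdist_drury_arveson_zero)

lemma kdist_le_norm:
  assumes x: "norm x \<le> 1/2" and y: "norm y \<le> 1/2"
  shows "kdist drury_arveson_kernel x y \<le> 2 * norm (x - y)"
proof -
  define c where "c = cdot x y"
  have cm: "cmod c \<le> norm x * norm y" unfolding c_def by (rule cdot_cauchy_schwarz)
  also have "\<dots> \<le> 1/2 * (1/2)" using x y by (intro mult_mono) auto
  finally have "cmod c \<le> 1/4" by simp
  then have den: "cmod (1 - c) \<ge> 1/2" using norm_triangle_ineq2[of 1 c] by simp
  have "of_real ((norm (x - y))\<^sup>2) = cdot (x - y) (x - y)" by (simp add: cdot_self)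
  also have "\<dots> = of_real ((norm x)\<^sup>2) - cnj c - c + of_real ((norm y)\<^sup>2)"
    unfolding cdot_diff_left cdot_diff_right unfolding cdot_self c_def cdot_herm by simp
  finally have "Re (of_real ((norm (x - y))\<^sup>2)) = Re (of_real ((norm x)\<^sup>2) - cnj c - c + of_real ((norm y)\<^sup>2))"
    by presburger
  then have d: "(norm (x - y))\<^sup>2 = (norm x)\<^sup>2 + (norm y)\<^sup>2 - 2 * Re c" by simp
  have e: "(cmod (1 - c))\<^sup>2 = 1 - 2 * Re c + (cmod c)\<^sup>2"
    by (simp add: cmod_power2 power2_diff)
  have "(cmod c)\<^sup>2 \<le> (norm x * norm y)\<^sup>2" using cm by (intro power_mono) auto
  then have num: "(cmod (1 - c))\<^sup>2 - (1 - (norm x)\<^sup>2) * (1 - (norm y)\<^sup>2) \<le> (norm (x - y))\<^sup>2"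
    unfolding d e by (simp add: power_mult_distrib algebra_simps)
  have den2: "1/4 \<le> (cmod (1 - c))\<^sup>2" using power_mono[OF den, of 2] by (simp add: power2_eq_square)
  have "1 - (1 - (norm x)\<^sup>2) * (1 - (norm y)\<^sup>2) / (cmod (1 - c))\<^sup>2
      = ((cmod (1 - c))\<^sup>2 - (1 - (norm x)\<^sup>2) * (1 - (norm y)\<^sup>2)) / (cmod (1 - c))\<^sup>2"
  proof -
    have "(cmod (1 - c))\<^sup>2 \<noteq> 0" using den2 by linarith
    then show ?thesis by (simp add: diff_divide_distrib)
  qed
  also have "\<dots> \<le> (norm (x - y))\<^sup>2 / (cmod (1 - c))\<^sup>2"
    by (intro divide_right_mono num) auto
  also have "\<dots> \<le> (norm (x - y))\<^sup>2 / (1/4)"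
    using den2 by (intro divide_left_mono) (auto intro: mult_pos_pos)
  also have "\<dots> = (2 * norm (x - y))\<^sup>2" by (simp add: power_mult_distrib)
  finally show ?thesis
    unfolding kdist_drury_arveson c_def[symmetric] by (intro real_le_lsqrt) auto
qed

text \<open>
  This is where finiteness of the dimension enters. An automorphism moves the first point to the
  centre; the points then lie in a compact ball on which \<open>kdist\<close> is dominated by the norm.
\<close>

lemma drury_arveson_packing:
  assumes c: "0 < c"
  shows "\<exists>N::nat. \<forall>x :: nat \<Rightarrow> complex ^ 'n. (\<forall>i<N. norm (x i) < 1) \<longrightarrow>
     (\<forall>i<N. kdist drury_arveson_kernel (x 0) (x i) \<le> 1/2) \<longrightarrow>
     (\<exists>i<N. \<exists>j<N. i \<noteq> j \<and> kdist drury_arveson_kernel (x i) (x j) < c)"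
proof -
  obtain S where S: "finite S" "cball (0 :: complex ^ 'n) (1/2) \<subseteq> (\<Union>s\<in>S. ball s (c / 4))"
    using compact_cball[of "0 :: complex ^ 'n" "1/2"] c unfolding compact_eq_totally_bounded
    by (meson divide_pos_pos zero_less_numeral)
  define N where "N = Suc (card S)"
  have "\<exists>i<N. \<exists>j<N. i \<noteq> j \<and> kdist drury_arveson_kernel (x i) (x j) < c"
    if x: "\<And>i. i < N \<Longrightarrow> norm (x i) < 1"
      and near: "\<And>i. i < N \<Longrightarrow> kdist drury_arveson_kernel (x 0) (x i) \<le> 1/2"
    for x :: "nat \<Rightarrow> complex ^ 'n"
  proof -
    define y where "y i = mobius (x 0) (x i)" for i
    have N0: "0 < N" by (simp add: N_def)
    have y: "norm (y i) \<le> 1/2" if "i < N" for i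
      using kdist_mobius[OF x[OF N0] x[OF N0] x[OF that]] near[OF that]
      by (simp add: mobius_center kdist_drury_arveson_zero y_def)
    have "\<exists>s\<in>S. y i \<in> ball s (c / 4)" if "i < N" for i
      using S(2) y[OF that] by (auto simp: subset_iff)
    then obtain f where f: "\<And>i. i < N \<Longrightarrow> f i \<in> S" "\<And>i. i < N \<Longrightarrow> y i \<in> ball (f i) (c / 4)"
      by metis
    have "\<not> inj_on f {..<N}"
    proof
      assume "inj_on f {..<N}"
      then have "card {..<N} \<le> card S"
        by (rule card_inj_on_le) (use f S(1) in auto)
      then show False by (simp add: N_def)
    qed
    then obtain i j where ij: "i < N" "j < N" "i \<noteq> j" "f i = f j"
      by (auto simp: inj_on_def)
    have "dist (f i) (y i) < c / 4" "dist (f i) (y j) < c / 4"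
      using f(2)[OF ij(1)] f(2)[OF ij(2)] ij(4) by auto
    then have "norm (y i - y j) < c / 2"
      using dist_triangle2[of "y i" "y j" "f i"] by (simp add: dist_norm norm_minus_commute)
    then have "kdist drury_arveson_kernel (y i) (y j) < c"
      using kdist_le_norm[OF y[OF ij(1)] y[OF ij(2)]] by simp
    then have "kdist drury_arveson_kernel (x i) (x j) < c"
      using kdist_mobius[OF x[OF N0] x[OF ij(1)] x[OF ij(2)]] by (simp add: y_def)
    then show ?thesis using ij by blast
  qed
  then show ?thesis by blast
qed

section \<open>Area integrals of power series\<close>

definition vec_complex :: "real ^ 2 \<Rightarrow> complex" where
  "vec_complex v = Complex (v $ 1) (v $ 2)"

lemma vec_complex_borel [measurable]: "vec_complex \<in> borel_measurable borel"
proof -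
  have "linear vec_complex"
    by (rule linearI) (auto simp: vec_complex_def complex_eq_iff)
  then show ?thesis
    using linear_continuous_on linear_conv_bounded_linear borel_measurable_continuous_onI by blast
qed

lemma vimage_box_vec_complex:
  "vec_complex -` box l u = box (\<chi> i. if i = 1 then Re l else Im l) (\<chi> i. if i = 1 then Re u else Im u)"
  by (auto simp: vec_complex_def box_def Basis_complex_def Basis_vec_def inner_axis exhaust_2 UNIV_2)

lemma emeasure_vimage_box:
  assumes "\<And>b. b \<in> Basis \<Longrightarrow> l \<bullet> b \<le> u \<bullet> b"
  shows "emeasure lborel (vec_complex -` box l u) = (\<Prod>b\<in>Basis. (u - l) \<bullet> b)"
proof -
  have lu: "Re l \<le> Re u" "Im l \<le> Im u"
    using assms[of 1] assms[of \<i>] by (auto simp: Basis_complex_def)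
  have B: "(Basis :: (real ^ 2) set) = {axis 1 1, axis 2 1}"
    by (auto simp: Basis_vec_def UNIV_2)
  have ne: "(axis 1 1 :: real ^ 2) \<noteq> axis 2 1" by (simp add: axis_eq_axis)
  show ?thesis
    unfolding vimage_box_vec_complex
    by (subst emeasure_lborel_box) (use lu ne in \<open>auto simp: B inner_axis Basis_complex_def\<close>)
qed

lemma lborel_complex_eq: "lborel = distr (lborel :: (real ^ 2) measure) borel vec_complex"
  by (rule lborel_eqI) (simp_all add: emeasure_distr emeasure_vimage_box)

text \<open>
  In real coordinates a rotation is a linear map of determinant \<open>1\<close>, so it preserves Lebesgue measure;
  \<open>vec_complex\<close> carries this over to the complex plane.
\<close>

lemma distr_lborel_rotation:
  fixes w :: complex
  assumes w: "cmod w = 1"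
  shows "distr lborel borel (\<lambda>z. w * z) = lborel"
proof (rule lborel_eqI[symmetric])
  show "sets (distr lborel borel (\<lambda>z. w * z)) = sets borel" by simp
  fix l u :: complex assume lu: "\<And>b. b \<in> Basis \<Longrightarrow> l \<bullet> b \<le> u \<bullet> b"
  define a b where "a = Re w" and "b = Im w"
  have ab: "a * a + b * b = 1"
    using w by (simp add: cmod_def a_def b_def power2_eq_square)
  have ww: "w * cnj w = 1"
    using w by (metis complex_norm_square of_real_1 power_one)
  define R :: "real ^ 2 \<Rightarrow> real ^ 2" where
    "R v = (\<chi> i. if i = 1 then a * v $ 1 + b * v $ 2 else a * v $ 2 - b * v $ 1)" for v
  have lin: "linear R"
    by (rule linearI) (auto simp: R_def vec_eq_iff algebra_simps)
  have cR: "vec_complex (R v) = cnj w * vec_complex v" for v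
    by (simp add: vec_complex_def R_def complex_eq_iff a_def b_def)
  define S where "S = vec_complex -` box l u"
  have S_box: "S \<in> lmeasurable" unfolding S_def vimage_box_vec_complex by simp
  have det: "det (matrix R) = 1"
    using ab by (simp add: det_2 matrix_def R_def axis_def)
  have img: "vec_complex -` ((\<lambda>z. w * z) -` box l u) = R ` S"
  proof (intro set_eqI iffI)
    fix v assume v: "v \<in> vec_complex -` ((\<lambda>z. w * z) -` box l u)"
    define v' :: "real ^ 2" where "v' = (\<chi> i. if i = 1 then Re (w * vec_complex v) else Im (w * vec_complex v))"
    have cv': "vec_complex v' = w * vec_complex v"
      by (simp add: vec_complex_def v'_def complex_eq_iff)
    have "vec_complex (R v') = vec_complex v"
      unfolding cR cv' using ww by (simp add: mult.assoc[symmetric] mult.commute[of "cnj w"])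
    then have "R v' = v" by (simp add: vec_complex_def vec_eq_iff forall_2)
    moreover have "v' \<in> S" using v cv' by (simp add: S_def)
    ultimately show "v \<in> R ` S" by blast
  next
    fix v assume "v \<in> R ` S"
    then show "v \<in> vec_complex -` ((\<lambda>z. w * z) -` box l u)"
      using ww by (auto simp: S_def cR mult.assoc[symmetric])
  qed
  have ms: "(\<lambda>z. w * z) -` box l u \<in> sets borel"
    using measurable_sets[of "\<lambda>z. w * z" borel borel "box l u"] by simp
  then have ms': "R ` S \<in> sets borel"
    unfolding img[symmetric] using measurable_sets[OF vec_complex_borel] by simp
  have "emeasure (distr lborel borel (\<lambda>z. w * z)) (box l u) = emeasure lborel ((\<lambda>z. w * z) -` box l u)"
    by (subst emeasure_distr) auto
  also have "\<dots> = emeasure lborel (R ` S)"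
    by (subst lborel_complex_eq, subst emeasure_distr) (use ms img in auto)
  also have "\<dots> = emeasure lebesgue (R ` S)" using ms' by simp
  also have "\<dots> = ennreal (measure lebesgue (R ` S))"
    by (intro emeasure_eq_measure2 measurable_linear_image[OF lin S_box])
  also have "\<dots> = ennreal (measure lebesgue S)"
    by (simp add: measure_linear_image[OF lin S_box] det)
  also have "\<dots> = emeasure lebesgue S"
    by (intro emeasure_eq_measure2[symmetric] S_box)
  also have "\<dots> = emeasure lborel S" by (simp add: S_def vimage_box_vec_complex)
  also have "\<dots> = (\<Prod>b\<in>Basis. (u - l) \<bullet> b)" unfolding S_def by (rule emeasure_vimage_box[OF lu])
  finally show "emeasure (distr lborel borel (\<lambda>z. w * z)) (box l u) = (\<Prod>b\<in>Basis. (u - l) \<bullet> b)" .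
qed

lemma nn_integral_rotation:
  fixes w :: complex
  assumes w: "cmod w = 1" and h: "h \<in> borel_measurable borel"
  shows "(\<integral>\<^sup>+z. h (w * z) \<partial>lborel) = (\<integral>\<^sup>+z. h z \<partial>lborel)"
proof -
  have "(\<integral>\<^sup>+z. h z \<partial>distr lborel borel (\<lambda>z. w * z)) = (\<integral>\<^sup>+z. h (w * z) \<partial>lborel)"
    using h by (intro nn_integral_distr) auto
  then show ?thesis by (simp add: distr_lborel_rotation[OF w])
qed

text \<open>
  Under \<open>z \<mapsto> |z|\<^sup>2\<close> area measure on the disc becomes \<open>pi\<close> times Lebesgue measure on the unit interval,
  which reduces the integral to that of \<open>t\<^sup>n\<close>.
\<close>

lemma nn_integral_norm_power_disc:
  "(\<integral>\<^sup>+z. ennreal (cmod z ^ (2 * n)) * indicator (ball 0 1) z \<partial>lborel) = ennreal (pi / (real n + 1))"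
proof -
  define M where "M = distr (restrict_space lborel (ball 0 1)) borel (\<lambda>z. (cmod z)\<^sup>2)"
  define N where "N = density lborel (\<lambda>t. ennreal pi * indicator {0<..<1::real} t)"
  have fin: "emeasure M {x<..} = emeasure lborel {z \<in> ball 0 1. x < (cmod z)\<^sup>2}" for x
  proof -
    have "emeasure M {x<..} = emeasure (restrict_space lborel (ball 0 1)) {z \<in> ball 0 1. x < (cmod z)\<^sup>2}"
      unfolding M_def by (subst emeasure_distr) (auto simp: space_restrict_space intro!: arg_cong2[where f=emeasure] measurable_restrict_space1)
    then show ?thesis by (subst (asm) emeasure_restrict_space) auto
  qed
  have b1: "emeasure lborel (ball (0::complex) 1) = ennreal pi"
    by (subst emeasure_ball) (auto simp: unit_ball_vol_2)
  have "M = N"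
  proof (rule measure_eqI_lessThan)
    show "sets M = sets borel" "sets N = sets borel" by (simp_all add: M_def N_def)
    show "emeasure M {x<..} < \<infinity>" for x
    proof -
      have "emeasure M {x<..} \<le> emeasure lborel (ball (0::complex) 1)"
        unfolding fin by (intro emeasure_mono) auto
      then show ?thesis by (simp add: b1 le_less_trans)
    qed
    show "emeasure M {x<..} = emeasure N {x<..}" for x
    proof -
      have N: "emeasure N {x<..} = ennreal pi * emeasure lborel ({0<..<1} \<inter> {x<..})"
        unfolding N_def by (subst emeasure_density)
          (auto simp: mult.assoc nn_integral_cmult indicator_inter_arith[symmetric])
      consider "x < 0" | "0 \<le> x" "x < 1" | "1 \<le> x" by linarith
      then show ?thesis
      proof cases
        case 1
        then have "{z \<in> ball 0 1. x < (cmod z)\<^sup>2} = ball 0 1" "{0<..<1} \<inter> {x<..} = {0<..<1}"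
          by (auto intro: less_le_trans)
        then show ?thesis unfolding fin N by (simp add: b1)
      next
        case 2
        have "{z \<in> ball 0 1. x < (cmod z)\<^sup>2} = ball 0 1 - cball 0 (sqrt x)"
        proof -
          have "x < (cmod z)\<^sup>2 \<longleftrightarrow> sqrt x < cmod z" for z
            using real_sqrt_less_iff[of x "(cmod z)\<^sup>2"] by simp
          then have "{z \<in> ball 0 1. x < (cmod z)\<^sup>2} = {z \<in> ball 0 1. sqrt x < cmod z}"
            by (simp only:)
          also have "\<dots> = ball 0 1 - cball 0 (sqrt x)"
            by (auto simp: not_le)
          finally show ?thesis .
        qed
        also have "emeasure lborel \<dots> = ennreal pi - ennreal (pi * x)"
        proof (subst emeasure_Diff)
          show "emeasure lborel (ball (0::complex) 1) - emeasure lborel (cball (0::complex) (sqrt x))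
              = ennreal pi - ennreal (pi * x)"
            using 2 by (subst emeasure_cball) (auto simp: unit_ball_vol_2 b1)
          show "cball 0 (sqrt x) \<subseteq> ball (0::complex) 1"
          proof -
            have "sqrt x < 1" using 2 by simp
            then have "cmod z < 1" if "cmod z \<le> sqrt x" for z
              using that by (rule le_less_trans[rotated])
            then show ?thesis by auto
          qed
          show "emeasure lborel (cball (0::complex) (sqrt x)) \<noteq> \<infinity>"
            using emeasure_compact_finite[OF compact_cball, of "0::complex" "sqrt x"] by auto
        qed auto
        also have "\<dots> = ennreal pi * ennreal (1 - x)"
          using 2 by (simp add: ennreal_minus ennreal_mult'[symmetric] algebra_simps)
        also have "{0<..<1} \<inter> {x<..} = {x<..<1}" using 2 by auto
        then have "ennreal pi * ennreal (1 - x) = emeasure N {x<..}"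
          unfolding N using 2 by simp
        finally show ?thesis unfolding fin .
      next
        case 3
        have "\<not> x < (cmod z)\<^sup>2" if "cmod z < 1" for z
          using that 3 power_less_one_iff[of "cmod z" 2] by simp
        then have E: "{z \<in> ball 0 1. x < (cmod z)\<^sup>2} = {}" "{0<..<1} \<inter> {x<..} = {}"
          using 3 by auto
        show ?thesis unfolding fin N E by simp
      qed
    qed
  qed
  have "(\<integral>\<^sup>+z. ennreal (cmod z ^ (2 * n)) * indicator (ball 0 1) z \<partial>lborel)
      = (\<integral>\<^sup>+z. ennreal (((cmod z)\<^sup>2) ^ n) \<partial>restrict_space lborel (ball 0 1))"
    by (subst nn_integral_restrict_space) (auto simp: power_mult)
  also have "\<dots> = (\<integral>\<^sup>+t. ennreal (t ^ n) \<partial>M)"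
    unfolding M_def by (subst nn_integral_distr) (auto intro: measurable_restrict_space1)
  also have "\<dots> = (\<integral>\<^sup>+t. ennreal pi * indicator {0<..<1} t * ennreal (t ^ n) \<partial>lborel)"
    unfolding \<open>M = N\<close> N_def by (subst nn_integral_density) auto
  also have "\<dots> = (\<integral>\<^sup>+t. ennreal (pi * t ^ n) * indicator {0..1} t \<partial>lborel)"
  proof (rule nn_integral_cong_AE)
    have "AE t in lborel. t \<noteq> (0::real) \<and> t \<noteq> 1"
      using AE_lborel_singleton[of "0::real"] AE_lborel_singleton[of "1::real"] by eventually_elim simp
    then show "AE t in lborel. ennreal pi * indicator {0<..<1} t * ennreal (t ^ n)
        = ennreal (pi * t ^ n) * indicator {0..1} t"
      by eventually_elim (auto simp: indicator_def ennreal_mult')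
  qed
  also have "\<dots> = ennreal (pi * 1 ^ Suc n / (real n + 1) - pi * 0 ^ Suc n / (real n + 1))"
  proof (rule nn_integral_FTC_Icc)
    fix t :: real
    have "((\<lambda>t. pi * t ^ Suc n / (real n + 1)) has_real_derivative pi * (real (Suc n) * t ^ n) / (real n + 1)) (at t)"
      using DERIV_cdivide[OF DERIV_cmult[OF DERIV_pow[of "Suc n" t]]] by simp
    moreover have "pi * (real (Suc n) * t ^ n) / (real n + 1) = pi * t ^ n"
      by (simp add: field_simps)
    ultimately show "((\<lambda>t. pi * t ^ Suc n / (real n + 1)) has_real_derivative pi * t ^ n) (at t)"
      by (simp only:)
  qed auto
  finally show ?thesis by simp
qed

lemma cis_sum_orthogonal:
  assumes n: "n < N" and m: "m < N"
  defines "w \<equiv> cis (2 * pi / real N)"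
  shows "(\<Sum>j<N. (w ^ j) ^ n * cnj ((w ^ j) ^ m)) = (if n = m then of_nat N else 0)"
proof -
  define x where "x = 2 * pi * (real n - real m) / real N"
  have N: "N > 0" using n by simp
  have t: "(w ^ j) ^ n * cnj ((w ^ j) ^ m) = cis x ^ j" for j
    unfolding w_def x_def
    by (simp add: Complex.DeMoivre cis_cnj cis_mult) (rule arg_cong[where f = cis], simp add: diff_divide_distrib algebra_simps)
  have "cis x ^ N = cis (2 * pi * of_int (int n - int m))"
    using N by (simp add: x_def Complex.DeMoivre mult.commute)
  also have "\<dots> = 1" by (rule cis_multiple_2pi) auto
  finally have one: "cis x ^ N = 1" .
  have ne: "cis x \<noteq> 1" if "n \<noteq> m"
  proof
    assume "cis x = 1"
    then have "cos x = 1" by (metis cis.simps(1) one_complex.sel(1))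
    then obtain k :: int where k: "x = of_int k * 2 * pi" using cos_one_2pi_int by auto
    then have "(2 * pi) * ((real n - real m) / real N) = (2 * pi) * of_int k"
      by (simp add: x_def mult_ac)
    then have "(real n - real m) / real N = of_int k"
      by (rule mult_left_cancel[THEN iffD1, rotated]) simp
    then have "real n - real m = of_int k * real N"
      using N by (simp add: field_simps)
    then have kN: "int n - int m = k * int N"
      by (metis of_int_diff of_int_eq_iff of_int_mult of_int_of_nat_eq)
    moreover have "\<bar>int n - int m\<bar> < int N" using n m by linarith
    ultimately have "\<bar>k\<bar> * int N < 1 * int N" by (simp add: abs_mult)
    then have "\<bar>k\<bar> < 1" by (rule mult_right_less_imp_less) simp
    then have "k = 0" by simp
    then show False using kN that by simp
  qed
  show ?thesis
  proof (cases "n = m")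
    case True
    then show ?thesis unfolding t by (simp add: x_def)
  next
    case False
    then show ?thesis
      unfolding t using sum_gp_strict[of "cis x" N] ne one by simp
  qed
qed

lemma sum_rotations_polynomial:
  fixes b :: "nat \<Rightarrow> complex"
  assumes N: "N > 0"
  defines "w \<equiv> cis (2 * pi / real N)"
  shows "(\<Sum>j<N. (cmod (\<Sum>n<N. b n * (w ^ j * z) ^ n))\<^sup>2)
    = real N * (\<Sum>n<N. (cmod (b n))\<^sup>2 * cmod z ^ (2 * n))"
proof -
  let ?o = "\<lambda>n m j. (w ^ j) ^ n * cnj ((w ^ j) ^ m)"
  let ?c = "\<lambda>n m. b n * z ^ n * cnj (b m * z ^ m)"
  have "complex_of_real (\<Sum>j<N. (cmod (\<Sum>n<N. b n * (w ^ j * z) ^ n))\<^sup>2)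
      = (\<Sum>j<N. \<Sum>n<N. \<Sum>m<N. ?c n m * ?o n m j)"
    unfolding of_real_sum complex_norm_square cnj_sum sum_product
    by (intro sum.cong refl) (simp add: power_mult_distrib)
  also have "\<dots> = (\<Sum>n<N. \<Sum>m<N. ?c n m * (\<Sum>j<N. ?o n m j))"
    unfolding sum_distrib_left
    by (rule trans[OF sum.swap]) (rule sum.cong[OF refl], rule sum.swap)
  also have "\<dots> = (\<Sum>n<N. \<Sum>m<N. if n = m then ?c n n * of_nat N else 0)"
    using cis_sum_orthogonal[where N = N, folded w_def] by (intro sum.cong refl) auto
  also have "\<dots> = (\<Sum>n<N. ?c n n * of_nat N)" by simp
  also have "\<dots> = of_real (real N * (\<Sum>n<N. (cmod (b n))\<^sup>2 * cmod z ^ (2 * n)))"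
  proof -
    have "?c n n = of_real ((cmod (b n))\<^sup>2 * cmod z ^ (2 * n))" for n
      unfolding complex_norm_square[symmetric] by (simp add: norm_mult norm_power power_mult_distrib power_mult mult.commute)
    then show ?thesis by (simp add: sum_distrib_left mult.commute)
  qed
  finally show ?thesis by (simp only: of_real_eq_iff)
qed

text \<open>
  Averaging over the rotations by the \<open>N\<close>-th roots of unity removes the mixed terms of a polynomial of
  degree less than \<open>N\<close> pointwise, so no integrability question arises.
\<close>

lemma nn_integral_polynomial_disc:
  fixes b :: "nat \<Rightarrow> complex"
  shows "(\<integral>\<^sup>+z. ennreal ((cmod (\<Sum>n<N. b n * z ^ n))\<^sup>2) * indicator (ball 0 r) z \<partial>lborel)
    = (\<Sum>n<N. \<integral>\<^sup>+z. ennreal ((cmod (b n))\<^sup>2 * cmod z ^ (2 * n)) * indicator (ball 0 r) z \<partial>lborel)"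
proof (cases "N = 0")
  case False
  then have N: "N > 0" by simp
  define w where "w = cis (2 * pi / real N)"
  have w: "cmod (w ^ j) = 1" for j by (simp add: w_def norm_power)
  define h where "h z = ennreal ((cmod (\<Sum>n<N. b n * z ^ n))\<^sup>2) * indicator (ball 0 r) z" for z
  have [measurable]: "ball (0::complex) r \<in> sets borel" by simp
  have hm: "h \<in> borel_measurable borel" unfolding h_def by measurable
  have "of_nat N * (\<integral>\<^sup>+z. h z \<partial>lborel) = (\<Sum>j<N. \<integral>\<^sup>+z. h (w ^ j * z) \<partial>lborel)"
    by (simp add: nn_integral_rotation[OF w hm])
  also have "\<dots> = (\<integral>\<^sup>+z. (\<Sum>j<N. h (w ^ j * z)) \<partial>lborel)"
    by (rule nn_integral_sum[symmetric]) (use hm in measurable)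
  also have "\<dots> = (\<integral>\<^sup>+z. of_nat N * ((\<Sum>n<N. ennreal ((cmod (b n))\<^sup>2 * cmod z ^ (2 * n))) * indicator (ball 0 r) z) \<partial>lborel)"
  proof (rule nn_integral_cong)
    fix z :: complex
    have ind: "indicator (ball 0 r) (w ^ j * z) = (indicator (ball 0 r) z :: ennreal)" for j
      by (simp add: indicator_def norm_mult w)
    have "(\<Sum>j<N. h (w ^ j * z))
        = (\<Sum>j<N. ennreal ((cmod (\<Sum>n<N. b n * (w ^ j * z) ^ n))\<^sup>2)) * indicator (ball 0 r) z"
      by (simp only: h_def ind sum_distrib_right)
    also have "(\<Sum>j<N. ennreal ((cmod (\<Sum>n<N. b n * (w ^ j * z) ^ n))\<^sup>2))
        = ennreal (real N * (\<Sum>n<N. (cmod (b n))\<^sup>2 * cmod z ^ (2 * n)))"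
      using sum_rotations_polynomial[OF N, of b z, folded w_def] by simp
    also have "\<dots> = of_nat N * (\<Sum>n<N. ennreal ((cmod (b n))\<^sup>2 * cmod z ^ (2 * n)))"
    proof -
      have "ennreal (\<Sum>n<N. (cmod (b n))\<^sup>2 * cmod z ^ (2 * n))
          = (\<Sum>n<N. ennreal ((cmod (b n))\<^sup>2 * cmod z ^ (2 * n)))"
        by (rule sum_ennreal[symmetric]) simp
      then show ?thesis
        unfolding ennreal_of_nat_eq_real_of_nat by (subst ennreal_mult') simp_all
    qed
    finally show "(\<Sum>j<N. h (w ^ j * z))
        = of_nat N * ((\<Sum>n<N. ennreal ((cmod (b n))\<^sup>2 * cmod z ^ (2 * n))) * indicator (ball 0 r) z)"
      by (simp add: mult.assoc)
  qed
  also have "\<dots> = of_nat N * (\<integral>\<^sup>+z. (\<Sum>n<N. ennreal ((cmod (b n))\<^sup>2 * cmod z ^ (2 * n)) * indicator (ball 0 r) z) \<partial>lborel)"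
    unfolding sum_distrib_right by (rule nn_integral_cmult) measurable
  also have "(\<integral>\<^sup>+z. (\<Sum>n<N. ennreal ((cmod (b n))\<^sup>2 * cmod z ^ (2 * n)) * indicator (ball 0 r) z) \<partial>lborel)
      = (\<Sum>n<N. \<integral>\<^sup>+z. ennreal ((cmod (b n))\<^sup>2 * cmod z ^ (2 * n)) * indicator (ball 0 r) z \<partial>lborel)"
    by (rule nn_integral_sum) measurable
  finally show ?thesis
    using N unfolding h_def by (subst (asm) ennreal_mult_cancel_left) (auto simp: ennreal_of_nat_eq_real_of_nat)
qed simp

text \<open>
  On a smaller disc the partial sums are uniformly bounded and dominated convergence applies; the
  smaller discs exhaust the unit disc.
\<close>

lemma nn_integral_power_series_disc:
  fixes F :: "complex \<Rightarrow> complex" and b :: "nat \<Rightarrow> complex"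
  assumes F: "\<And>z. z \<in> ball 0 1 \<Longrightarrow> (\<lambda>n. b n * z ^ n) sums F z"
  shows "(\<integral>\<^sup>+z\<in>ball 0 1. ennreal ((cmod (F z))\<^sup>2) \<partial>lborel)
    = (\<Sum>n. ennreal ((cmod (b n))\<^sup>2 * (pi / (real n + 1))))"
proof -
  have holF: "F holomorphic_on ball 0 1"
    by (rule power_series_holomorphic[of 0 1 b]) (use F in auto)
  define u where "u z = ennreal ((cmod (indicator (ball 0 1) z *\<^sub>R F z))\<^sup>2)" for z
  define v where "v z = (\<Sum>n. ennreal ((cmod (b n))\<^sup>2 * cmod z ^ (2 * n))) * indicator (ball 0 1) z" for z
  have [measurable]: "ball (0::complex) s \<in> sets borel" for s by simp
  have um: "u \<in> borel_measurable borel"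
  proof -
    have "(\<lambda>z. indicator (ball 0 1) z *\<^sub>R F z) \<in> borel_measurable borel"
      using holF by (intro borel_measurable_continuous_on_indicator holomorphic_on_imp_continuous_on) auto
    then show ?thesis unfolding u_def by measurable
  qed
  have vm: "v \<in> borel_measurable borel" unfolding v_def by measurable
  define A where "A k = ball (0::complex) (1 - 1 / real (Suc k))" for k
  have AUn: "(\<Union>k. A k) = ball 0 1"
  proof (intro equalityI subsetI)
    fix z :: complex assume "z \<in> ball 0 1"
    then have "0 < 1 - cmod z" by simp
    then obtain k where "inverse (real (Suc k)) < 1 - cmod z" using reals_Archimedean by blast
    then show "z \<in> (\<Union>k. A k)" by (auto simp: A_def inverse_eq_divide intro!: exI[of _ k])
  next
    fix z assume "z \<in> (\<Union>k. A k)"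
    then obtain k where "cmod z < 1 - 1 / real (Suc k)" by (auto simp: A_def)
    also have "\<dots> \<le> 1" by simp
    finally show "z \<in> ball 0 1" by simp
  qed
  have Ainc: "incseq A"
    unfolding A_def by (intro monoI subset_ball) (simp add: frac_le)
  have lim: "(\<lambda>k. \<integral>\<^sup>+z. g z * indicator (A k) z \<partial>lborel) \<longlonglongrightarrow> (\<integral>\<^sup>+z. g z * indicator (ball 0 1) z \<partial>lborel)"
    if g: "g \<in> borel_measurable borel" for g :: "complex \<Rightarrow> ennreal"
  proof -
    have "(\<lambda>k. emeasure (density lborel g) (A k)) \<longlonglongrightarrow> emeasure (density lborel g) (\<Union>k. A k)"
      by (rule Lim_emeasure_incseq[OF _ Ainc]) (auto simp: A_def)
    then show ?thesis
      unfolding AUn using g by (simp add: emeasure_density A_def)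
  qed
  have eqr: "(\<integral>\<^sup>+z. u z * indicator (ball 0 r) z \<partial>lborel) = (\<integral>\<^sup>+z. v z * indicator (ball 0 r) z \<partial>lborel)"
    if r: "r < 1" for r :: real
  proof (cases "r \<le> 0")
    case False
    define s where "s = (\<lambda>N z. ennreal ((cmod (\<Sum>n<N. b n * z ^ n))\<^sup>2) * indicator (ball 0 r) z)"
    define B where "B = (\<Sum>n. cmod (b n * of_real r ^ n))"
    have absr: "summable (\<lambda>n. cmod (b n * of_real r ^ n))"
    proof -
      define q where "q = (r + 1) / 2"
      have q: "r < q" "q < 1" using r by (auto simp: q_def)
      have "summable (\<lambda>n. b n * of_real q ^ n)"
        using F[of "of_real q"] q False by (auto dest: sums_summable)
      then show ?thesis
        by (rule powser_insidea) (use q False in auto)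
    qed
    have bound: "s N z \<le> ennreal (B\<^sup>2) * indicator (ball 0 r) z" for N z
    proof (cases "z \<in> ball 0 r")
      case True
      have "cmod (\<Sum>n<N. b n * z ^ n) \<le> (\<Sum>n<N. cmod (b n * of_real r ^ n))"
        using True by (intro sum_norm_le) (auto simp: norm_mult norm_power intro!: mult_left_mono power_mono)
      also have "\<dots> \<le> B" unfolding B_def by (rule sum_le_suminf[OF absr]) auto
      finally have "(cmod (\<Sum>n<N. b n * z ^ n))\<^sup>2 \<le> B\<^sup>2" by (intro power_mono) auto
      then show ?thesis using True by (simp add: s_def ennreal_leI)
    qed (simp add: s_def)
    have "(\<lambda>N. \<integral>\<^sup>+z. s N z \<partial>lborel) \<longlonglongrightarrow> (\<integral>\<^sup>+z. u z * indicator (ball 0 r) z \<partial>lborel)"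
    proof (rule nn_integral_dominated_convergence)
      show "s N \<in> borel_measurable lborel" for N unfolding s_def by measurable
      show "(\<lambda>z. u z * indicator (ball 0 r) z) \<in> borel_measurable lborel"
        using um by (simp add: borel_measurable_times_ennreal borel_measurable_indicator)
      show "(\<lambda>z. ennreal (B\<^sup>2) * indicator (ball (0::complex) r) z) \<in> borel_measurable lborel" by measurable
      show "AE z in lborel. s N z \<le> ennreal (B\<^sup>2) * indicator (ball 0 r) z" for N using bound by simp
      have "emeasure lborel (ball (0::complex) r) < \<infinity>"
        by (rule le_less_trans[OF emeasure_mono[OF ball_subset_cball[of "0::complex" r]]
              emeasure_compact_finite[OF compact_cball]]) simp
      then show "(\<integral>\<^sup>+z. ennreal (B\<^sup>2) * indicator (ball (0::complex) r) z \<partial>lborel) < \<infinity>"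
        by (simp add: nn_integral_cmult ennreal_mult_less_top)
      show "AE z in lborel. (\<lambda>N. s N z) \<longlonglongrightarrow> u z * indicator (ball 0 r) z"
      proof (rule AE_I2)
        fix z :: complex
        show "(\<lambda>N. s N z) \<longlonglongrightarrow> u z * indicator (ball 0 r) z"
        proof (cases "z \<in> ball 0 r")
          case True
          then have z: "z \<in> ball 0 1" using r by simp
          have "(\<lambda>N. ennreal ((cmod (\<Sum>n<N. b n * z ^ n))\<^sup>2)) \<longlonglongrightarrow> ennreal ((cmod (F z))\<^sup>2)"
            using F[OF z] unfolding sums_def by (intro tendsto_intros)
          then show ?thesis using True z by (simp add: s_def u_def)
        qed (simp add: s_def)
      qed
    qed
    moreover have "(\<lambda>N. \<integral>\<^sup>+z. s N z \<partial>lborel) \<longlonglongrightarrow> (\<integral>\<^sup>+z. v z * indicator (ball 0 r) z \<partial>lborel)"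
    proof -
      let ?t = "\<lambda>n z. ennreal ((cmod (b n))\<^sup>2 * cmod z ^ (2 * n)) * indicator (ball (0::complex) r) z"
      have "(\<lambda>N. \<Sum>n<N. \<integral>\<^sup>+z. ?t n z \<partial>lborel) \<longlonglongrightarrow> (\<Sum>n. \<integral>\<^sup>+z. ?t n z \<partial>lborel)"
        by (rule summable_LIMSEQ) simp
      also have "(\<lambda>N. \<Sum>n<N. \<integral>\<^sup>+z. ?t n z \<partial>lborel) = (\<lambda>N. \<integral>\<^sup>+z. s N z \<partial>lborel)"
        unfolding s_def nn_integral_polynomial_disc ..
      also have "(\<Sum>n. \<integral>\<^sup>+z. ?t n z \<partial>lborel) = (\<integral>\<^sup>+z. (\<Sum>n. ?t n z) \<partial>lborel)"
        by (rule nn_integral_suminf[symmetric]) measurable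
      also have "\<dots> = (\<integral>\<^sup>+z. v z * indicator (ball 0 r) z \<partial>lborel)"
      proof (rule nn_integral_cong)
        fix z :: complex
        show "(\<Sum>n. ?t n z) = v z * indicator (ball 0 r) z"
        proof (cases "z \<in> ball 0 r")
          case True
          then have "z \<in> ball 0 1" using r by simp
          then show ?thesis using True unfolding v_def by (simp only: indicator_simps mult_1_right)
        next
          case False
          then have "indicator (ball 0 r) z = (0::ennreal)" by (rule indicator_simps(2))
          then show ?thesis by (simp only: mult_zero_right suminf_zero)
        qed
      qed
      finally show ?thesis .
    qed
    ultimately show ?thesis by (rule LIMSEQ_unique)
  qed (simp add: ball_empty)
  have "(\<integral>\<^sup>+z. u z * indicator (ball 0 1) z \<partial>lborel) = (\<integral>\<^sup>+z. v z * indicator (ball 0 1) z \<partial>lborel)"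
  proof (rule LIMSEQ_unique[OF lim[OF um]])
    have "(\<lambda>k. \<integral>\<^sup>+z. u z * indicator (A k) z \<partial>lborel) = (\<lambda>k. \<integral>\<^sup>+z. v z * indicator (A k) z \<partial>lborel)"
      unfolding A_def by (intro ext eqr) simp
    then show "(\<lambda>k. \<integral>\<^sup>+z. u z * indicator (A k) z \<partial>lborel) \<longlonglongrightarrow> (\<integral>\<^sup>+z. v z * indicator (ball 0 1) z \<partial>lborel)"
      using lim[OF vm] by simp
  qed
  also have "(\<integral>\<^sup>+z. v z * indicator (ball 0 1) z \<partial>lborel)
      = (\<integral>\<^sup>+z. (\<Sum>n. ennreal ((cmod (b n))\<^sup>2) * (ennreal (cmod z ^ (2 * n)) * indicator (ball 0 1) z)) \<partial>lborel)"
    by (intro nn_integral_cong) (auto simp: v_def indicator_def ennreal_mult')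
  also have "\<dots> = (\<Sum>n. \<integral>\<^sup>+z. ennreal ((cmod (b n))\<^sup>2) * (ennreal (cmod z ^ (2 * n)) * indicator (ball 0 1) z) \<partial>lborel)"
    by (rule nn_integral_suminf) measurable
  also have "\<dots> = (\<Sum>n. ennreal ((cmod (b n))\<^sup>2 * (pi / (real n + 1))))"
  proof (rule suminf_cong)
    fix n
    have "(\<integral>\<^sup>+z. ennreal ((cmod (b n))\<^sup>2) * (ennreal (cmod z ^ (2 * n)) * indicator (ball 0 1) z) \<partial>lborel)
        = ennreal ((cmod (b n))\<^sup>2) * (\<integral>\<^sup>+z. ennreal (cmod z ^ (2 * n)) * indicator (ball 0 1) z \<partial>lborel)"
      by (rule nn_integral_cmult) measurable
    also have "\<dots> = ennreal ((cmod (b n))\<^sup>2 * (pi / (real n + 1)))"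
      unfolding nn_integral_norm_power_disc by (rule ennreal_mult'[symmetric]) simp
    finally show "(\<integral>\<^sup>+z. ennreal ((cmod (b n))\<^sup>2) * (ennreal (cmod z ^ (2 * n)) * indicator (ball 0 1) z) \<partial>lborel)
        = ennreal ((cmod (b n))\<^sup>2 * (pi / (real n + 1)))" .
  qed
  also have "(\<integral>\<^sup>+z. u z * indicator (ball 0 1) z \<partial>lborel) = (\<integral>\<^sup>+z\<in>ball 0 1. ennreal ((cmod (F z))\<^sup>2) \<partial>lborel)"
    by (intro nn_integral_cong) (auto simp: u_def indicator_def)
  finally show ?thesis .
qed

definition taylor :: "(complex \<Rightarrow> complex) \<Rightarrow> nat \<Rightarrow> complex" where
  "taylor f n = (deriv ^^ n) f 0 / fact n"

lemma taylor_sums: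
  assumes "f holomorphic_on ball 0 1" "z \<in> ball 0 1"
  shows "(\<lambda>n. taylor f n * z ^ n) sums f z"
  using holomorphic_power_series[OF assms] by (simp add: taylor_def)

lemma taylor_deriv: "taylor (deriv f) n = of_nat (Suc n) * taylor f (Suc n)"
  by (simp add: taylor_def funpow_swap1 del: of_nat_Suc)

lemma dirichlet_integral_eq:
  assumes f: "f holomorphic_on ball 0 1"
  shows "dirichlet_integral f = (\<Sum>n. ennreal (real (Suc n) * (cmod (taylor f (Suc n)))\<^sup>2))"
proof -
  have "dirichlet_integral f
      = ennreal (1 / pi) * (\<Sum>n. ennreal ((cmod (taylor (deriv f) n))\<^sup>2 * (pi / (real n + 1))))"
    unfolding dirichlet_integral_def
    using taylor_sums[OF holomorphic_deriv[OF f open_ball]]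
    by (subst nn_integral_power_series_disc[of "taylor (deriv f)"]) auto
  also have "\<dots> = (\<Sum>n. ennreal (1 / pi) * ennreal ((cmod (taylor (deriv f) n))\<^sup>2 * (pi / (real n + 1))))"
    by (rule ennreal_suminf_cmult[symmetric])
  also have "\<dots> = (\<Sum>n. ennreal (real (Suc n) * (cmod (taylor f (Suc n)))\<^sup>2))"
  proof (rule suminf_cong)
    fix n
    have "1 / pi * ((k * t)\<^sup>2 * (pi / k)) = k * t\<^sup>2" if "k > 0" for k t :: real
      using that by (simp add: power2_eq_square)
    moreover have "real n + 1 = real (Suc n)" by simp
    ultimately have "1 / pi * ((cmod (taylor (deriv f) n))\<^sup>2 * (pi / (real n + 1)))
        = real (Suc n) * (cmod (taylor f (Suc n)))\<^sup>2"
      unfolding taylor_deriv norm_mult norm_of_nat by (metis of_nat_0_less_iff zero_less_Suc)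
    then show "ennreal (1 / pi) * ennreal ((cmod (taylor (deriv f) n))\<^sup>2 * (pi / (real n + 1)))
        = ennreal (real (Suc n) * (cmod (taylor f (Suc n)))\<^sup>2)"
      by (simp add: ennreal_mult'[symmetric])
  qed
  finally show ?thesis .
qed

lemma dirichlet_space_iff:
  "f \<in> dirichlet_space \<longleftrightarrow> f \<in> functions_on (ball 0 1) \<and> f holomorphic_on ball 0 1 \<and>
     summable (\<lambda>n. (real n + 1) * (cmod (taylor f n))\<^sup>2)"
proof -
  have "dirichlet_integral f < \<infinity> \<longleftrightarrow> summable (\<lambda>n. (real n + 1) * (cmod (taylor f n))\<^sup>2)"
    if f: "f holomorphic_on ball 0 1"
  proof -
    let ?g = "\<lambda>n. real (Suc n) * (cmod (taylor f (Suc n)))\<^sup>2"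
    have "dirichlet_integral f < \<infinity> \<longleftrightarrow> summable ?g"
      unfolding dirichlet_integral_eq[OF f]
    proof
      assume "(\<Sum>n. ennreal (?g n)) < \<infinity>"
      then show "summable ?g" by (intro summable_suminf_not_top) (auto simp: less_top)
    next
      assume "summable ?g"
      then have "(\<Sum>n. ennreal (?g n)) = ennreal (\<Sum>n. ?g n)" by (intro suminf_ennreal2) auto
      then show "(\<Sum>n. ennreal (?g n)) < \<infinity>" by simp
    qed
    also have "\<dots> \<longleftrightarrow> summable (\<lambda>n. (real (Suc n) + 1) * (cmod (taylor f (Suc n)))\<^sup>2)"
    proof
      assume "summable ?g"
      then have "summable (\<lambda>n. 2 * ?g n)" by (rule summable_mult)
      then show "summable (\<lambda>n. (real (Suc n) + 1) * (cmod (taylor f (Suc n)))\<^sup>2)"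
      proof (rule summable_comparison_test')
        fix n
        have "(real (Suc n) + 1) * (cmod (taylor f (Suc n)))\<^sup>2 \<le> (2 * real (Suc n)) * (cmod (taylor f (Suc n)))\<^sup>2"
          by (intro mult_right_mono) auto
        also have "\<dots> = 2 * ?g n" by (rule mult.assoc)
        finally show "norm ((real (Suc n) + 1) * (cmod (taylor f (Suc n)))\<^sup>2) \<le> 2 * ?g n"
          unfolding real_norm_def by (subst abs_of_nonneg) (rule mult_nonneg_nonneg, simp_all)
      qed
    next
      assume "summable (\<lambda>n. (real (Suc n) + 1) * (cmod (taylor f (Suc n)))\<^sup>2)"
      then show "summable ?g"
        by (rule summable_comparison_test') (auto intro!: mult_right_mono)
    qed
    also have "\<dots> \<longleftrightarrow> summable (\<lambda>n. (real n + 1) * (cmod (taylor f n))\<^sup>2)"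
      by (rule summable_Suc_iff[of "\<lambda>n. (real n + 1) * (cmod (taylor f n))\<^sup>2"])
    finally show ?thesis .
  qed
  then show ?thesis by (auto simp: dirichlet_space_def)
qed

section \<open>The kernel of the Dirichlet space\<close>

lemma summable_powser_bounded:
  fixes t :: "'a :: {real_normed_field, banach}"
  assumes a: "\<And>n. norm (a n) \<le> C" and t: "norm t < 1"
  shows "summable (\<lambda>n. norm (a n * t ^ n))"
proof (rule summable_comparison_test')
  show "summable (\<lambda>n. C * norm t ^ n)"
    using t by (intro summable_mult summable_geometric) simp
  show "norm (norm (a n * t ^ n)) \<le> C * norm t ^ n" for n
    using a[of n] by (simp add: norm_mult norm_power mult_right_mono)
qed

text \<open>
  The Taylor coefficients of \<open>1 - 1 / k\<close> for the series \<open>k\<close> with coefficients \<open>1 / (n + 1)\<close>, read off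
  from \<open>k = 1 + (1 - 1 / k) * k\<close>.
\<close>

fun renewal_coeff :: "nat \<Rightarrow> real" where
  "renewal_coeff n =
     (if n = 0 then 0
      else 1 / real (Suc n) - (\<Sum>j\<in>{..<n}. renewal_coeff j / real (Suc (n - j))))"

declare renewal_coeff.simps [simp del]

lemma renewal_coeff_0: "renewal_coeff 0 = 0"
  by (subst renewal_coeff.simps) simp

lemma renewal_equation:
  "(\<Sum>j\<le>n. renewal_coeff j / real (Suc (n - j))) = (if n = 0 then 0 else 1 / real (Suc n))"
proof (cases n)
  case 0
  then show ?thesis by (simp add: renewal_coeff_0)
next
  case (Suc m)
  have "(\<Sum>j\<le>n. renewal_coeff j / real (Suc (n - j)))
      = (\<Sum>j<n. renewal_coeff j / real (Suc (n - j))) + renewal_coeff n"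
    by (simp add: lessThan_Suc_atMost[symmetric])
  also have "renewal_coeff n = 1 / real (Suc n) - (\<Sum>j<n. renewal_coeff j / real (Suc (n - j)))"
    using Suc by (subst renewal_coeff.simps) simp
  finally show ?thesis using Suc by simp
qed

text \<open>
  Kaluza's argument: the ratios \<open>r k\<close> of consecutive coefficients \<open>1 / (k + 1)\<close> increase. Hence the sum subtracted
  in the recursion for \<open>n = m + 1\<close> is at most \<open>r m\<close> times the sum in the equation for \<open>m\<close>, that is, at most
  \<open>r m / (m + 1) = 1 / (n + 1)\<close>.
\<close>

lemma renewal_coeff_nonneg: "0 \<le> renewal_coeff n"
proof (induction n rule: less_induct)
  case (less n)
  consider "n = 0" | "n = 1" | m where "n = Suc m" "m \<ge> 1"
    by (metis One_nat_def Suc_leI gr0I not0_implies_Suc)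
  then show ?case
  proof cases
    case 1
    then show ?thesis by (simp add: renewal_coeff_0)
  next
    case 2
    then show ?thesis by (subst renewal_coeff.simps) (simp add: renewal_coeff_0)
  next
    case 3
    define r where "r k = real (Suc k) / real (Suc (Suc k))" for k
    have r_mono: "r k \<le> r m" if "k \<le> m" for k
      using that by (simp add: r_def divide_simps) (simp add: algebra_simps)
    have "(\<Sum>j<n. renewal_coeff j / real (Suc (n - j)))
        \<le> (\<Sum>j\<le>m. r m * (renewal_coeff j / real (Suc (m - j))))"
      unfolding 3 lessThan_Suc_atMost
    proof (rule sum_mono)
      fix j assume j: "j \<in> {..m}"
      then have p: "0 \<le> renewal_coeff j" using less.IH[of j] 3 by auto
      have "Suc m - j = Suc (m - j)" using j by auto
      then have "renewal_coeff j / real (Suc (Suc m - j)) = r (m - j) * (renewal_coeff j / real (Suc (m - j)))"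
        by (simp add: r_def del: of_nat_Suc)
      also have "\<dots> \<le> r m * (renewal_coeff j / real (Suc (m - j)))"
        using p by (intro mult_right_mono r_mono) auto
      finally show "renewal_coeff j / real (Suc (Suc m - j)) \<le> r m * (renewal_coeff j / real (Suc (m - j)))" .
    qed
    also have "\<dots> = r m * (1 / real (Suc m))"
      unfolding sum_distrib_left[symmetric] renewal_equation using 3 by simp
    also have "\<dots> = 1 / real (Suc n)" using 3 by (simp add: r_def del: of_nat_Suc)
    finally show ?thesis
      using 3 by (subst renewal_coeff.simps) simp
  qed
qed

lemma renewal_coeff_le_1: "renewal_coeff n \<le> 1"
proof (cases "n = 0")
  case False
  have "renewal_coeff n \<le> 1 / real (Suc n)"
    using False by (subst renewal_coeff.simps)
      (auto intro!: sum_nonneg divide_nonneg_nonneg renewal_coeff_nonneg)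
  also have "\<dots> \<le> 1" by simp
  finally show ?thesis .
qed (simp add: renewal_coeff_0)

text \<open>
  The function \<open>- log (1 - t) / t\<close>.
\<close>

definition log_kernel :: "'a :: {real_normed_field, banach} \<Rightarrow> 'a" where
  "log_kernel t = (\<Sum>n. t ^ n / of_nat (Suc n))"

definition renewal_series :: "'a :: {real_normed_field, banach} \<Rightarrow> 'a" where
  "renewal_series t = (\<Sum>n. of_real (renewal_coeff n) * t ^ n)"

lemma log_kernel_abs_summable:
  fixes t :: "'a :: {real_normed_field, banach}"
  assumes "norm t < 1"
  shows "summable (\<lambda>n. norm (t ^ n / of_nat (Suc n)))"
proof -
  have "norm (1 / of_nat (Suc n) :: 'a) \<le> 1" for n
    by (simp add: norm_divide del: of_nat_Suc)
  from summable_powser_bounded[OF this assms] show ?thesis by simp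
qed

lemma log_kernel_sums:
  fixes t :: "'a :: {real_normed_field, banach}"
  shows "norm t < 1 \<Longrightarrow> (\<lambda>n. t ^ n / of_nat (Suc n)) sums log_kernel t"
  unfolding log_kernel_def by (rule summable_sums[OF summable_norm_cancel[OF log_kernel_abs_summable]])

lemma renewal_series_abs_summable:
  fixes t :: "'a :: {real_normed_field, banach}"
  assumes "norm t < 1"
  shows "summable (\<lambda>n. norm (of_real (renewal_coeff n) * t ^ n))"
  by (rule summable_powser_bounded[OF _ assms, of _ 1])
    (simp add: renewal_coeff_nonneg renewal_coeff_le_1)

lemma renewal_series_sums:
  fixes t :: "'a :: {real_normed_field, banach}"
  shows "norm t < 1 \<Longrightarrow> (\<lambda>n. of_real (renewal_coeff n) * t ^ n) sums renewal_series t"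
  unfolding renewal_series_def by (rule summable_sums[OF summable_norm_cancel[OF renewal_series_abs_summable]])

lemma renewal_series_times_log_kernel:
  fixes t :: "'a :: {real_normed_field, banach}"
  assumes t: "norm t < 1"
  shows "renewal_series t * log_kernel t = log_kernel t - 1"
proof -
  have "(\<lambda>n. \<Sum>j\<le>n. (of_real (renewal_coeff j) * t ^ j) * (t ^ (n - j) / of_nat (Suc (n - j)))) sums (renewal_series t * log_kernel t)"
    unfolding renewal_series_def log_kernel_def by (rule Cauchy_product_sums[OF renewal_series_abs_summable[OF t] log_kernel_abs_summable[OF t]])
  moreover have "(\<Sum>j\<le>n. (of_real (renewal_coeff j) * t ^ j) * (t ^ (n - j) / of_nat (Suc (n - j))))
      = t ^ n / of_nat (Suc n) - (if n = 0 then t ^ n else 0)" for n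
  proof -
    have "(\<Sum>j\<le>n. (of_real (renewal_coeff j) * t ^ j) * (t ^ (n - j) / of_nat (Suc (n - j))))
        = (\<Sum>j\<le>n. t ^ n * of_real (renewal_coeff j / real (Suc (n - j))))"
    proof (rule sum.cong[OF refl])
      fix j assume "j \<in> {..n}"
      then have "t ^ n = t ^ j * t ^ (n - j)" by (simp add: power_add[symmetric])
      then show "(of_real (renewal_coeff j) * t ^ j) * (t ^ (n - j) / of_nat (Suc (n - j)))
          = t ^ n * of_real (renewal_coeff j / real (Suc (n - j)))"
        by (simp del: of_nat_Suc)
    qed
    also have "\<dots> = t ^ n * of_real (if n = 0 then 0 else 1 / real (Suc n))"
      unfolding sum_distrib_left[symmetric] of_real_sum[symmetric] renewal_equation ..
    also have "\<dots> = t ^ n / of_nat (Suc n) - (if n = 0 then t ^ n else 0)"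
      by (simp del: of_nat_Suc)
    finally show ?thesis .
  qed
  moreover have "(\<lambda>n. t ^ n / of_nat (Suc n) - (if n = 0 then t ^ n else 0)) sums (log_kernel t - 1)"
    using sums_diff[OF log_kernel_sums[OF t] sums_single[of 0 "\<lambda>n. t ^ n"]] by simp
  ultimately show ?thesis by (simp add: sums_unique2)
qed

lemma log_kernel_eq:
  fixes t :: "'a :: {real_normed_field, banach}"
  assumes t: "norm t < 1"
  shows "log_kernel t = 1 / (1 - renewal_series t)"
proof -
  have e: "log_kernel t * (1 - renewal_series t) = 1" using renewal_series_times_log_kernel[OF t] by (simp add: algebra_simps)
  then have "1 - renewal_series t \<noteq> 0" by auto
  with e show ?thesis by (simp add: eq_divide_eq)
qed

text \<open>
  As the coefficients are nonnegative, it suffices to look at \<open>cmod t\<close>, where \<open>1 - renewal_series = 1 / log_kernel\<close> is positive.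
\<close>

lemma renewal_series_less_1:
  fixes t :: "'a :: {real_normed_field, banach}"
  assumes t: "norm t < 1"
  shows "norm (renewal_series t) < 1"
proof -
  have nt: "norm (norm t) < 1" using t by simp
  have "norm (renewal_series t) \<le> (\<Sum>n. norm (of_real (renewal_coeff n) * t ^ n))"
    unfolding renewal_series_def by (rule summable_norm[OF renewal_series_abs_summable[OF t]])
  also have "\<dots> = renewal_series (norm t)"
    unfolding renewal_series_def by (intro suminf_cong) (simp add: norm_mult norm_power renewal_coeff_nonneg)
  also have "renewal_series (norm t) < 1"
  proof -
    have "0 < log_kernel (norm t)"
      unfolding log_kernel_def
      by (rule suminf_pos2[of _ 0]) (use log_kernel_sums[OF nt] in \<open>auto dest: sums_summable\<close>)
    then have "0 < 1 - renewal_series (norm t)" unfolding log_kernel_eq[OF nt] by (simp add: zero_less_divide_iff)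
    then show ?thesis by simp
  qed
  finally show ?thesis .
qed

lemma log_kernel_Ln:
  fixes t :: complex
  assumes t: "cmod t < 1"
  shows "t * log_kernel t = - Ln (1 - t)"
proof -
  have "(\<lambda>n. - ((- (- t)) ^ n / of_nat n)) sums Ln (1 + (- t))"
    using Ln_series'[of "- t"] t by simp
  then have "(\<lambda>n. t ^ n / of_nat n) sums (- Ln (1 - t))"
    using sums_minus by fastforce
  then have "(\<lambda>n. t ^ Suc n / of_nat (Suc n)) sums (- Ln (1 - t))"
    using sums_Suc_iff[of "\<lambda>n. t ^ n / of_nat n"] by simp
  moreover have "(\<lambda>n. t * (t ^ n / of_nat (Suc n))) sums (t * log_kernel t)"
    by (intro sums_mult log_kernel_sums t)
  ultimately show ?thesis using sums_unique2 by (simp del: of_nat_Suc)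
qed

section \<open>The Dirichlet space as a complete Pick space\<close>

definition finite_energy :: "(nat \<Rightarrow> complex) \<Rightarrow> bool" where
  "finite_energy a \<longleftrightarrow> summable (\<lambda>n. (real n + 1) * (cmod (a n))\<^sup>2)"

definition power_series :: "(nat \<Rightarrow> complex) \<Rightarrow> complex \<Rightarrow> complex" where
  "power_series a = on_set (ball 0 1) (\<lambda>z. \<Sum>n. a n * z ^ n)"

text \<open>
  The Dirichlet integral of \<open>f\<close> is the sum of \<open>n * |a n|\<^sup>2\<close> over its Taylor coefficients \<open>a n\<close>, and the
  squared Hardy norm is the sum of \<open>|a n|\<^sup>2\<close>.
\<close>

definition dirichlet_ip :: "(complex \<Rightarrow> complex) \<Rightarrow> (complex \<Rightarrow> complex) \<Rightarrow> complex" where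
  "dirichlet_ip f g = (\<Sum>n. of_real (real n + 1) * (taylor f n * cnj (taylor g n)))"

lemma dirichlet_spaceD:
  assumes "f \<in> dirichlet_space"
  shows "f holomorphic_on ball 0 1" "finite_energy (taylor f)" "\<And>z. z \<notin> ball 0 1 \<Longrightarrow> f z = 0"
  using assms by (auto simp: dirichlet_space_iff finite_energy_def functions_on_def)

lemma taylor_unique:
  assumes "\<And>z. z \<in> ball 0 1 \<Longrightarrow> (\<lambda>n. a n * z ^ n) sums f z"
  shows "taylor f = a"
proof
  fix n
  have "f has_fps_expansion Abs_fps a"
  proof (rule has_fps_expansionI)
    show "\<forall>\<^sub>F u in nhds 0. (\<lambda>n. fps_nth (Abs_fps a) n * u ^ n) sums f u"
      by (rule eventually_nhds_in_open[of "ball 0 1", THEN eventually_mono]) (use assms in auto)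
  qed
  from fps_nth_fps_expansion[OF this, of n] show "taylor f n = a n"
    by (simp add: taylor_def)
qed

lemma finite_energy_bounded:
  assumes "finite_energy a"
  obtains C where "\<And>n. cmod (a n) \<le> C"
proof -
  have "(\<lambda>n. (real n + 1) * (cmod (a n))\<^sup>2) \<longlonglongrightarrow> 0"
    using assms unfolding finite_energy_def by (rule summable_LIMSEQ_zero)
  then have "Bseq (\<lambda>n. (real n + 1) * (cmod (a n))\<^sup>2)"
    by (intro convergent_imp_Bseq) (auto simp: convergent_def)
  then obtain B where B: "B > 0" "\<And>n. norm ((real n + 1) * (cmod (a n))\<^sup>2) \<le> B"
    by (auto elim: BseqE)
  have "cmod (a n) \<le> B + 1" for n
  proof -
    have "1 * (cmod (a n))\<^sup>2 \<le> (real n + 1) * (cmod (a n))\<^sup>2" by (intro mult_right_mono) auto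
    also have "\<dots> \<le> B" using B(2)[of n] by simp
    also have "\<dots> \<le> (B + 1)\<^sup>2" using B(1) by (simp add: power2_eq_square algebra_simps)
    finally show ?thesis unfolding mult_1_left by (rule power2_le_imp_le) (use B(1) in simp)
  qed
  then show ?thesis using that by blast
qed

lemma power_series_sums:
  assumes "finite_energy a" "z \<in> ball 0 1"
  shows "(\<lambda>n. a n * z ^ n) sums power_series a z"
proof -
  obtain C where "\<And>n. cmod (a n) \<le> C" using finite_energy_bounded[OF assms(1)] by blast
  then have "summable (\<lambda>n. a n * z ^ n)"
    using assms(2) by (intro summable_norm_cancel[OF summable_powser_bounded]) auto
  then show ?thesis using assms(2) by (simp add: power_series_def on_set_def summable_sums)
qed

lemma taylor_power_series: "finite_energy a \<Longrightarrow> taylor (power_series a) = a"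
  by (rule taylor_unique) (rule power_series_sums)

lemma power_series_mem:
  assumes a: "finite_energy a"
  shows "power_series a \<in> dirichlet_space"
proof -
  have "power_series a holomorphic_on ball 0 1"
    by (rule power_series_holomorphic[of 0 1 a]) (use power_series_sums[OF a] in auto)
  moreover have "power_series a \<in> functions_on (ball 0 1)"
    by (simp add: power_series_def functions_on_def on_set_def)
  ultimately show ?thesis
    using a by (simp add: dirichlet_space_iff taylor_power_series finite_energy_def)
qed

lemma power_series_taylor:
  assumes f: "f \<in> dirichlet_space"
  shows "power_series (taylor f) = f"
proof
  fix z
  show "power_series (taylor f) z = f z"
  proof (cases "z \<in> ball 0 1")
    case True
    then show ?thesis
      using taylor_sums[OF dirichlet_spaceD(1)[OF f] True] power_series_sums[OF dirichlet_spaceD(2)[OF f] True]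
      by (rule_tac sums_unique2)
  next
    case False
    then show ?thesis using dirichlet_spaceD(3)[OF f False] by (simp add: power_series_def on_set_def)
  qed
qed

lemma finite_energy_add:
  assumes "finite_energy a" "finite_energy b"
  shows "finite_energy (\<lambda>n. a n + b n)"
  unfolding finite_energy_def
proof (rule summable_comparison_test')
  show "summable (\<lambda>n. 2 * ((real n + 1) * (cmod (a n))\<^sup>2 + (real n + 1) * (cmod (b n))\<^sup>2))"
    using assms unfolding finite_energy_def by (intro summable_mult summable_add)
  fix n
  have "(cmod (a n + b n))\<^sup>2 \<le> (cmod (a n) + cmod (b n))\<^sup>2"
    by (intro power_mono norm_triangle_ineq) auto
  also have "\<dots> \<le> 2 * ((cmod (a n))\<^sup>2 + (cmod (b n))\<^sup>2)"
    using zero_le_power2[of "cmod (a n) - cmod (b n)"] by (simp add: power2_eq_square algebra_simps)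
  finally have "(real n + 1) * (cmod (a n + b n))\<^sup>2 \<le> (real n + 1) * (2 * ((cmod (a n))\<^sup>2 + (cmod (b n))\<^sup>2))"
    by (intro mult_left_mono) auto
  then show "norm ((real n + 1) * (cmod (a n + b n))\<^sup>2)
      \<le> 2 * ((real n + 1) * (cmod (a n))\<^sup>2 + (real n + 1) * (cmod (b n))\<^sup>2)"
    by (simp add: algebra_simps)
qed

lemma finite_energy_scale:
  assumes "finite_energy a"
  shows "finite_energy (\<lambda>n. c * a n)"
proof -
  have "summable (\<lambda>n. (cmod c)\<^sup>2 * ((real n + 1) * (cmod (a n))\<^sup>2))"
    using assms unfolding finite_energy_def by (rule summable_mult)
  then show ?thesis
    unfolding finite_energy_def by (simp add: norm_mult power_mult_distrib mult_ac)
qed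

lemma taylor_add:
  "f \<in> dirichlet_space \<Longrightarrow> g \<in> dirichlet_space \<Longrightarrow>
    taylor (\<lambda>z. f z + g z) = (\<lambda>n. taylor f n + taylor g n)"
  by (rule taylor_unique, unfold distrib_right) (intro sums_add taylor_sums dirichlet_spaceD(1))

lemma taylor_scale: "f \<in> dirichlet_space \<Longrightarrow> taylor (\<lambda>z. c * f z) = (\<lambda>n. c * taylor f n)"
  by (rule taylor_unique, unfold mult.assoc) (intro sums_mult taylor_sums dirichlet_spaceD(1))

lemma dirichlet_space_add:
  assumes "f \<in> dirichlet_space" "g \<in> dirichlet_space"
  shows "(\<lambda>z. f z + g z) \<in> dirichlet_space"
  using assms finite_energy_add[OF assms[THEN dirichlet_spaceD(2)]] taylor_add[OF assms]
  by (auto simp: dirichlet_space_iff functions_on_def finite_energy_def intro!: holomorphic_intros)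

lemma dirichlet_space_scale:
  assumes "f \<in> dirichlet_space"
  shows "(\<lambda>z. c * f z) \<in> dirichlet_space"
  using assms finite_energy_scale[OF dirichlet_spaceD(2)[OF assms], of c] taylor_scale[OF assms, of c]
  by (auto simp: dirichlet_space_iff functions_on_def finite_energy_def intro!: holomorphic_intros)

lemma dirichlet_space_diff:
  "f \<in> dirichlet_space \<Longrightarrow> g \<in> dirichlet_space \<Longrightarrow> (\<lambda>z. f z - g z) \<in> dirichlet_space"
  using dirichlet_space_add[OF _ dirichlet_space_scale[of g "-1"], of f] by simp

lemma taylor_diff:
  "f \<in> dirichlet_space \<Longrightarrow> g \<in> dirichlet_space \<Longrightarrow>
    taylor (\<lambda>z. f z - g z) = (\<lambda>n. taylor f n - taylor g n)"
  using taylor_add[OF _ dirichlet_space_scale[of g "-1"], of f] taylor_scale[of g "-1"] by simp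

lemma energy_ip_summable:
  assumes "finite_energy a" "finite_energy b"
  shows "summable (\<lambda>n. of_real (real n + 1) * (a n * cnj (b n)))"
proof (rule summable_comparison_test')
  show "summable (\<lambda>n. (real n + 1) * (cmod (a n))\<^sup>2 + (real n + 1) * (cmod (b n))\<^sup>2)"
    using assms unfolding finite_energy_def by (intro summable_add)
  fix n
  have "cmod (of_real (real n + 1) * (a n * cnj (b n))) = (real n + 1) * (cmod (a n) * cmod (b n))"
    unfolding norm_mult complex_mod_cnj norm_of_real by simp
  also have "\<dots> \<le> (real n + 1) * ((cmod (a n))\<^sup>2 + (cmod (b n))\<^sup>2)"
  proof (rule mult_left_mono)
    have "0 \<le> (cmod (a n) - cmod (b n))\<^sup>2" "0 \<le> cmod (a n) * cmod (b n)" by auto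
    then show "cmod (a n) * cmod (b n) \<le> (cmod (a n))\<^sup>2 + (cmod (b n))\<^sup>2"
      unfolding power2_diff by linarith
  qed simp
  finally show "cmod (of_real (real n + 1) * (a n * cnj (b n)))
      \<le> (real n + 1) * (cmod (a n))\<^sup>2 + (real n + 1) * (cmod (b n))\<^sup>2"
    by (simp add: algebra_simps)
qed

lemma dirichlet_ip_summable:
  "f \<in> dirichlet_space \<Longrightarrow> g \<in> dirichlet_space \<Longrightarrow>
    summable (\<lambda>n. of_real (real n + 1) * (taylor f n * cnj (taylor g n)))"
  by (intro energy_ip_summable dirichlet_spaceD)

lemma dirichlet_ip_self:
  assumes f: "f \<in> dirichlet_space"
  shows "dirichlet_ip f f = of_real (\<Sum>n. (real n + 1) * (cmod (taylor f n))\<^sup>2)"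
proof -
  have "(\<lambda>n. complex_of_real ((real n + 1) * (cmod (taylor f n))\<^sup>2)) sums
      of_real (\<Sum>n. (real n + 1) * (cmod (taylor f n))\<^sup>2)"
    using dirichlet_spaceD(2)[OF f] unfolding finite_energy_def
    by (intro sums_of_real summable_sums)
  then have "of_real (\<Sum>n. (real n + 1) * (cmod (taylor f n))\<^sup>2)
      = (\<Sum>n. complex_of_real ((real n + 1) * (cmod (taylor f n))\<^sup>2))"
    by (rule sums_unique)
  then show ?thesis
    unfolding dirichlet_ip_def by (simp only: of_real_mult complex_norm_square)
qed

lemma energy_le_imp_finite:
  assumes "\<And>N. (\<Sum>n<N. (real n + 1) * (cmod (a n))\<^sup>2) \<le> B"
  shows "finite_energy a" "(\<Sum>n. (real n + 1) * (cmod (a n))\<^sup>2) \<le> B"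
proof -
  show f: "finite_energy a"
    unfolding finite_energy_def by (rule summableI_nonneg_bounded) (use assms in auto)
  show "(\<Sum>n. (real n + 1) * (cmod (a n))\<^sup>2) \<le> B"
    using f assms unfolding finite_energy_def by (intro suminf_le_const)
qed

text \<open>
  Completeness of a weighted sequence space: coefficients converge one by one, and the Cauchy
  estimate for finite partial sums passes to the limit.
\<close>

lemma dirichlet_complete:
  fixes F :: "nat \<Rightarrow> complex \<Rightarrow> complex"
  assumes F: "\<And>n. F n \<in> dirichlet_space"
    and cauchy: "\<And>e. e > 0 \<Longrightarrow> \<exists>N. \<forall>m\<ge>N. \<forall>n\<ge>N.
         sqrt (Re (dirichlet_ip (\<lambda>x. F m x - F n x) (\<lambda>x. F m x - F n x))) < e"
  shows "\<exists>f\<in>dirichlet_space.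
    (\<lambda>n. sqrt (Re (dirichlet_ip (\<lambda>x. F n x - f x) (\<lambda>x. F n x - f x)))) \<longlonglongrightarrow> 0"
proof -
  have ipd: "Re (dirichlet_ip (\<lambda>x. f x - g x) (\<lambda>x. f x - g x))
      = (\<Sum>k. (real k + 1) * (cmod (taylor f k - taylor g k))\<^sup>2)"
    if "f \<in> dirichlet_space" "g \<in> dirichlet_space" for f g
    using dirichlet_ip_self[OF dirichlet_space_diff[OF that]] taylor_diff[OF that] by simp
  have part: "(\<Sum>k<K. (real k + 1) * (cmod (taylor f k - taylor g k))\<^sup>2)
      \<le> Re (dirichlet_ip (\<lambda>x. f x - g x) (\<lambda>x. f x - g x))"
    if "f \<in> dirichlet_space" "g \<in> dirichlet_space" for f g K
    unfolding ipd[OF that]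
    by (rule sum_le_suminf)
      (use dirichlet_spaceD(2)[OF dirichlet_space_diff[OF that]] taylor_diff[OF that] in \<open>auto simp: finite_energy_def\<close>)
  have cau: "\<exists>N. \<forall>m\<ge>N. \<forall>n\<ge>N. \<forall>K. (\<Sum>k<K. (real k + 1) * (cmod (taylor (F m) k - taylor (F n) k))\<^sup>2) \<le> e\<^sup>2"
    if e: "e > 0" for e
  proof -
    obtain N where N: "\<And>m n. m \<ge> N \<Longrightarrow> n \<ge> N \<Longrightarrow>
        sqrt (Re (dirichlet_ip (\<lambda>x. F m x - F n x) (\<lambda>x. F m x - F n x))) < e"
      using cauchy[OF e] by blast
    have "(\<Sum>k<K. (real k + 1) * (cmod (taylor (F m) k - taylor (F n) k))\<^sup>2) \<le> e\<^sup>2"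
      if "m \<ge> N" "n \<ge> N" for m n K
    proof -
      have "Re (dirichlet_ip (\<lambda>x. F m x - F n x) (\<lambda>x. F m x - F n x)) \<le> e\<^sup>2"
        using N[OF that] by (intro sqrt_le_D less_imp_le)
      then show ?thesis using part[OF F F, of m n K] by linarith
    qed
    then show ?thesis by blast
  qed
  have "Cauchy (\<lambda>n. taylor (F n) k)" for k
  proof (rule metric_CauchyI)
    fix e :: real assume e: "e > 0"
    obtain N where N: "\<And>m n K. m \<ge> N \<Longrightarrow> n \<ge> N \<Longrightarrow>
        (\<Sum>k<K. (real k + 1) * (cmod (taylor (F m) k - taylor (F n) k))\<^sup>2) \<le> (e/2)\<^sup>2"
      using cau[of "e/2"] e by auto
    have "dist (taylor (F m) k) (taylor (F n) k) < e" if "m \<ge> N" "n \<ge> N" for m n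
    proof -
      have "1 * (cmod (taylor (F m) k - taylor (F n) k))\<^sup>2
          \<le> (real k + 1) * (cmod (taylor (F m) k - taylor (F n) k))\<^sup>2"
        by (intro mult_right_mono) auto
      also have "\<dots> \<le> (\<Sum>k<Suc k. (real k + 1) * (cmod (taylor (F m) k - taylor (F n) k))\<^sup>2)"
        by (simp add: sum_nonneg)
      also have "\<dots> \<le> (e/2)\<^sup>2" by (rule N[OF that])
      finally have "cmod (taylor (F m) k - taylor (F n) k) \<le> e / 2"
        unfolding mult_1_left by (rule power2_le_imp_le) (use e in simp)
      then show ?thesis using e by (simp add: dist_norm)
    qed
    then show "\<exists>M. \<forall>m\<ge>M. \<forall>n\<ge>M. dist (taylor (F m) k) (taylor (F n) k) < e" by blast
  qed
  then have "\<exists>l. (\<lambda>n. taylor (F n) k) \<longlonglongrightarrow> l" for k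
    using Cauchy_convergent_iff convergent_def by blast
  then obtain a where a: "\<And>k. (\<lambda>n. taylor (F n) k) \<longlonglongrightarrow> a k" by metis
  have lim: "\<exists>N. \<forall>m\<ge>N. finite_energy (\<lambda>k. taylor (F m) k - a k)
      \<and> (\<Sum>k. (real k + 1) * (cmod (taylor (F m) k - a k))\<^sup>2) \<le> e\<^sup>2" if e: "e > 0" for e
  proof -
    obtain N where N: "\<And>m n K. m \<ge> N \<Longrightarrow> n \<ge> N \<Longrightarrow>
        (\<Sum>k<K. (real k + 1) * (cmod (taylor (F m) k - taylor (F n) k))\<^sup>2) \<le> e\<^sup>2"
      using cau[OF e] by blast
    have le: "(\<Sum>k<K. (real k + 1) * (cmod (taylor (F m) k - a k))\<^sup>2) \<le> e\<^sup>2" if "m \<ge> N" for m K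
    proof (rule LIMSEQ_le_const2)
      show "(\<lambda>n. \<Sum>k<K. (real k + 1) * (cmod (taylor (F m) k - taylor (F n) k))\<^sup>2)
          \<longlonglongrightarrow> (\<Sum>k<K. (real k + 1) * (cmod (taylor (F m) k - a k))\<^sup>2)"
        by (intro tendsto_intros a)
      show "\<exists>M. \<forall>n\<ge>M. (\<Sum>k<K. (real k + 1) * (cmod (taylor (F m) k - taylor (F n) k))\<^sup>2) \<le> e\<^sup>2"
        using N[OF that] by blast
    qed
    show ?thesis
      using energy_le_imp_finite[OF le] by blast
  qed
  have fa: "finite_energy a"
  proof -
    obtain m where "finite_energy (\<lambda>k. taylor (F m) k - a k)" using lim[of 1] by auto
    from finite_energy_add[OF dirichlet_spaceD(2)[OF F, of m] finite_energy_scale[OF this, of "-1"]]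
    show ?thesis by simp
  qed
  define f where "f = power_series a"
  have f: "f \<in> dirichlet_space" and tf: "taylor f = a"
    using fa by (simp_all add: f_def power_series_mem taylor_power_series)
  have "(\<lambda>n. sqrt (Re (dirichlet_ip (\<lambda>x. F n x - f x) (\<lambda>x. F n x - f x)))) \<longlonglongrightarrow> 0"
  proof (rule metric_LIMSEQ_I)
    fix e :: real assume e: "e > 0"
    obtain N where N: "\<And>m. m \<ge> N \<Longrightarrow> (\<Sum>k. (real k + 1) * (cmod (taylor (F m) k - a k))\<^sup>2) \<le> (e/2)\<^sup>2"
      using lim[of "e/2"] e by auto
    have "dist (sqrt (Re (dirichlet_ip (\<lambda>x. F n x - f x) (\<lambda>x. F n x - f x)))) 0 < e" if "n \<ge> N" for n
    proof -
      have nn: "0 \<le> Re (dirichlet_ip (\<lambda>x. F n x - f x) (\<lambda>x. F n x - f x))"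
        using part[OF F f, of n 0] by simp
      have "sqrt (Re (dirichlet_ip (\<lambda>x. F n x - f x) (\<lambda>x. F n x - f x))) \<le> e / 2"
        unfolding ipd[OF F f] tf using N[OF that] e by (intro real_le_lsqrt) auto
      then show ?thesis using nn e by (simp add: dist_real_def)
    qed
    then show "\<exists>no. \<forall>n\<ge>no. dist (sqrt (Re (dirichlet_ip (\<lambda>x. F n x - f x) (\<lambda>x. F n x - f x)))) 0 < e"
      by blast
  qed
  then show ?thesis using f by blast
qed

definition dirichlet_kernel :: "complex \<Rightarrow> complex \<Rightarrow> complex" where
  "dirichlet_kernel z w = log_kernel (z * cnj w)"

lemma norm_mult_cnj_less_1: "z \<in> ball 0 1 \<Longrightarrow> w \<in> ball 0 1 \<Longrightarrow> cmod (z * cnj w) < 1"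
  using mult_strict_mono'[of "cmod z" 1 "cmod w" 1] by (simp add: norm_mult)

lemma hilbert_dirichlet: "hilbert_function_space (ball 0 1) dirichlet_space dirichlet_ip"
proof
  show "dirichlet_space \<subseteq> functions_on (ball 0 1)" by (auto simp: dirichlet_space_def)
  show "(\<lambda>x. 0) \<in> dirichlet_space"
    using power_series_mem[of "\<lambda>_. 0"] by (simp add: finite_energy_def power_series_def on_set_def)
  fix f g h :: "complex \<Rightarrow> complex" and c :: complex
  assume f: "f \<in> dirichlet_space"
  {
    assume g: "g \<in> dirichlet_space"
    show "(\<lambda>x. f x + g x) \<in> dirichlet_space" by (rule dirichlet_space_add[OF f g])
    show "dirichlet_ip (\<lambda>x. c * f x) g = c * dirichlet_ip f g"
      unfolding dirichlet_ip_def taylor_scale[OF f]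
      by (subst suminf_mult[symmetric, OF dirichlet_ip_summable[OF f g]]) (simp add: mult_ac)
    show "dirichlet_ip g f = cnj (dirichlet_ip f g)"
    proof -
      have "(\<lambda>n. cnj (of_real (real n + 1) * (taylor f n * cnj (taylor g n)))) sums cnj (dirichlet_ip f g)"
        unfolding sums_cnj dirichlet_ip_def by (rule summable_sums[OF dirichlet_ip_summable[OF f g]])
      then show ?thesis unfolding dirichlet_ip_def[of g f]
        by (subst sums_unique[symmetric]) (auto simp: mult_ac)
    qed
    {
      assume h: "h \<in> dirichlet_space"
      show "dirichlet_ip (\<lambda>x. f x + g x) h = dirichlet_ip f h + dirichlet_ip g h"
        unfolding dirichlet_ip_def taylor_add[OF f g]
        by (subst suminf_add[OF dirichlet_ip_summable[OF f h] dirichlet_ip_summable[OF g h]])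
          (simp add: algebra_simps)
    }
  }
  show "(\<lambda>x. c * f x) \<in> dirichlet_space" by (rule dirichlet_space_scale[OF f])
  have sm: "summable (\<lambda>n. (real n + 1) * (cmod (taylor f n))\<^sup>2)"
    using dirichlet_spaceD(2)[OF f] by (simp add: finite_energy_def)
  show "0 \<le> Re (dirichlet_ip f f)"
    unfolding dirichlet_ip_self[OF f] Re_complex_of_real by (intro suminf_nonneg sm) simp
  show "f = (\<lambda>x. 0)" if "dirichlet_ip f f = 0"
  proof -
    have "(\<Sum>n. (real n + 1) * (cmod (taylor f n))\<^sup>2) = 0"
      using that unfolding dirichlet_ip_self[OF f] of_real_eq_0_iff .
    then have "\<forall>n. (real n + 1) * (cmod (taylor f n))\<^sup>2 = 0"
      by (subst (asm) suminf_eq_zero_iff[OF sm]) auto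
    then have "taylor f = (\<lambda>n. 0)" by (auto simp: fun_eq_iff)
    then show ?thesis using power_series_taylor[OF f] by (simp add: power_series_def on_set_def fun_eq_iff)
  qed
next
  fix F :: "nat \<Rightarrow> complex \<Rightarrow> complex"
  assume F: "\<And>n. F n \<in> dirichlet_space"
    and cauchy: "\<And>e. e > 0 \<Longrightarrow> \<exists>N. \<forall>m\<ge>N. \<forall>n\<ge>N.
         sqrt (Re (dirichlet_ip (\<lambda>x. F m x - F n x) (\<lambda>x. F m x - F n x))) < e"
  show "\<exists>f\<in>dirichlet_space.
      (\<lambda>n. sqrt (Re (dirichlet_ip (\<lambda>x. F n x - f x) (\<lambda>x. F n x - f x)))) \<longlonglongrightarrow> 0"
    by (rule dirichlet_complete[OF F cauchy])
qed

lemma rkhs_dirichlet: "rkhs (ball 0 1) dirichlet_space dirichlet_ip dirichlet_kernel"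
proof -
  interpret hilbert_function_space "ball 0 1" dirichlet_space dirichlet_ip
    by (rule hilbert_dirichlet)
  define a where "a w n = cnj w ^ n / of_nat (Suc n)" for w n
  have fe: "finite_energy (a w)" if w: "w \<in> ball 0 1" for w
    unfolding finite_energy_def
  proof (rule summable_comparison_test')
    show "summable (\<lambda>n. (cmod w) ^ n)" using w by (intro summable_geometric) simp
    fix n
    have k: "real n + 1 = real (Suc n)" by simp
    have "(real n + 1) * (cmod (a w n))\<^sup>2 = (cmod w ^ n)\<^sup>2 / (real n + 1)"
      unfolding k a_def norm_divide norm_of_nat norm_power complex_mod_cnj
      by (simp add: power2_eq_square del: of_nat_Suc)
    also have "\<dots> \<le> (cmod w ^ n)\<^sup>2 / 1" by (intro divide_left_mono) auto
    also have "\<dots> \<le> cmod w ^ n * 1"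
      unfolding power2_eq_square div_by_1 using w by (intro mult_left_mono power_le_one) auto
    finally show "norm ((real n + 1) * (cmod (a w n))\<^sup>2) \<le> cmod w ^ n" by simp
  qed
  have ker: "on_set (ball 0 1) (\<lambda>z. dirichlet_kernel z w) = power_series (a w)" if w: "w \<in> ball 0 1" for w
    unfolding dirichlet_kernel_def power_series_def log_kernel_def a_def
    by (simp add: power_mult_distrib mult.commute)
  show ?thesis
  proof
    fix w :: complex assume w: "w \<in> ball 0 1"
    show "on_set (ball 0 1) (\<lambda>z. dirichlet_kernel z w) \<in> dirichlet_space"
      unfolding ker[OF w] by (rule power_series_mem[OF fe[OF w]])
    fix f assume f: "f \<in> dirichlet_space"
    have "dirichlet_ip f (power_series (a w)) = (\<Sum>n. taylor f n * w ^ n)"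
      unfolding dirichlet_ip_def taylor_power_series[OF fe[OF w]]
    proof (rule suminf_cong)
      fix n
      have "cnj (a w n) = w ^ n / of_nat (Suc n)" by (simp add: a_def)
      moreover have "complex_of_real (real n + 1) = of_nat (Suc n)" by simp
      ultimately show "of_real (real n + 1) * (taylor f n * cnj (a w n)) = taylor f n * w ^ n"
        by (simp del: of_nat_Suc)
    qed
    also have "\<dots> = f w"
      using taylor_sums[OF dirichlet_spaceD(1)[OF f] w] by (rule sums_unique[symmetric])
    finally show "f w = dirichlet_ip f (on_set (ball 0 1) (\<lambda>z. dirichlet_kernel z w))"
      unfolding ker[OF w] by simp
  qed
qed

lemma dirichlet_pick_space:
  "pick_space (ball 0 1) dirichlet_space dirichlet_ip dirichlet_kernel (\<lambda>z w. renewal_series (z * cnj w))"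
proof -
  interpret rkhs "ball 0 1" dirichlet_space dirichlet_ip dirichlet_kernel
    by (rule rkhs_dirichlet)
  show ?thesis
  proof
    fix x y :: complex assume xy: "x \<in> ball 0 1" "y \<in> ball 0 1"
    show "dirichlet_kernel x y = 1 / (1 - renewal_series (x * cnj y))"
      unfolding dirichlet_kernel_def by (rule log_kernel_eq[OF norm_mult_cnj_less_1[OF xy]])
    show "cmod (renewal_series (x * cnj y)) < 1" by (rule renewal_series_less_1[OF norm_mult_cnj_less_1[OF xy]])
  next
    fix M :: "complex \<Rightarrow> complex \<Rightarrow> complex" assume M: "psd (ball 0 1) M"
    show "psd (ball 0 1) (\<lambda>x y. renewal_series (x * cnj y) * M x y)"
    proof (rule psd_limit)
      fix N :: nat
      have "psd (ball 0 1) (\<lambda>x y. \<Sum>n<N. of_real (renewal_coeff n) * (x ^ n * cnj (y ^ n) * M x y))"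
        by (intro psd_sum psd_cmult psd_rank_one M) (auto simp: renewal_coeff_nonneg)
      then show "psd (ball 0 1) (\<lambda>x y. (\<Sum>n<N. of_real (renewal_coeff n) * (x * cnj y) ^ n) * M x y)"
        by (simp add: sum_distrib_right power_mult_distrib mult.assoc)
    next
      fix x y :: complex assume xy: "x \<in> ball 0 1" "y \<in> ball 0 1"
      show "(\<lambda>N. (\<Sum>n<N. of_real (renewal_coeff n) * (x * cnj y) ^ n) * M x y) \<longlonglongrightarrow> renewal_series (x * cnj y) * M x y"
        using renewal_series_sums[OF norm_mult_cnj_less_1[OF xy]] unfolding sums_def by (intro tendsto_intros)
    qed
  qed
qed

section \<open>Equilateral configurations in the disc\<close>

lemma sin_ge_half:
  fixes x :: real
  assumes x: "0 \<le> x" "x \<le> 1"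
  shows "x / 2 \<le> sin x"
proof -
  have "sin 0 - 0 / 2 \<le> sin x - x / 2"
  proof (rule DERIV_nonneg_imp_nondecreasing[OF x(1)])
    fix y assume y: "0 \<le> y" "y \<le> x"
    have "cos (pi / 3) \<le> cos y"
      using y x pi_gt3 by (intro cos_monotone_0_pi_le) auto
    then have "0 \<le> cos y - 1 / 2" by (simp add: cos_60)
    moreover have "((\<lambda>x. sin x - x / 2) has_real_derivative cos y - 1 / 2) (at y)"
      by (auto intro!: derivative_eq_intros)
    ultimately show "\<exists>d. ((\<lambda>x. sin x - x / 2) has_real_derivative d) (at y) \<and> 0 \<le> d" by blast
  qed
  then show ?thesis by simp
qed

lemma norm_one_minus_bounds:
  assumes \<epsilon>: "0 < \<epsilon>" "\<epsilon> \<le> h" "\<epsilon> \<le> 1/2" and \<theta>: "h \<le> \<bar>\<theta>\<bar>" "\<bar>\<theta>\<bar> \<le> real N * h" "\<bar>\<theta>\<bar> \<le> 1"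
  defines "t \<equiv> of_real (1 - \<epsilon>) * cis \<theta>"
  shows "h / 4 \<le> cmod (1 - t)" "cmod (1 - t) \<le> (real N + 1) * h"
proof -
  have "\<bar>\<theta>\<bar> / 2 \<le> sin \<bar>\<theta>\<bar>" using \<theta>(3) by (intro sin_ge_half) auto
  then have "h / 2 \<le> \<bar>sin \<theta>\<bar>" using \<theta>(1) by (auto simp: abs_if split: if_splits)
  then have "1/2 * (h / 2) \<le> (1 - \<epsilon>) * \<bar>sin \<theta>\<bar>" using \<epsilon> by (intro mult_mono) auto
  also have "\<dots> = \<bar>Im (1 - t)\<bar>" using \<epsilon> by (simp add: t_def abs_mult)
  also have "\<dots> \<le> cmod (1 - t)" by (rule abs_Im_le_cmod)
  finally show "h / 4 \<le> cmod (1 - t)" by simp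
  have "1 - t = (1 - cis \<theta>) + of_real \<epsilon> * cis \<theta>" by (simp add: t_def algebra_simps)
  then have "cmod (1 - t) \<le> cmod (1 - cis \<theta>) + cmod (of_real \<epsilon> * cis \<theta>)"
    by (metis norm_triangle_ineq)
  also have "cmod (of_real \<epsilon> * cis \<theta>) = \<epsilon>" using \<epsilon> by (simp add: norm_mult)
  also have "cmod (1 - cis \<theta>) = 2 * \<bar>sin (\<theta> / 2)\<bar>"
    using dist_exp_i_1[of \<theta>] by (simp add: cis_conv_exp norm_minus_commute)
  also have "\<dots> \<le> \<bar>\<theta>\<bar>" using abs_sin_x_le_abs_x[of "\<theta> / 2"] by simp
  finally show "cmod (1 - t) \<le> (real N + 1) * h" using \<theta>(2) \<epsilon>(2) by (simp add: algebra_simps)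
qed

text \<open>
  The phenomenon without counterpart in finite dimension. Take \<open>N\<close> points with \<open>1 - |z|\<^sup>2 = \<epsilon> = e\<^sup>-\<^sup>\<Lambda>\<close>,
  with neighbours at angle \<open>h = \<epsilon>\<^sup>a\<close>. For \<open>\<Lambda> \<rightarrow> \<infinity>\<close> and fixed \<open>N\<close> the numbers \<open>|1 - z i * cnj (z j)|\<close>,
  for all \<open>i \<noteq> j\<close>, agree with \<open>\<epsilon>\<^sup>a\<close> up to constant factors. The logarithm in the kernel turns these factors
  into bounded errors, so that the quotient of \<open>|K (z i) (z j)|\<close> by the values on the diagonal tends to \<open>a\<close>
  for all pairs at once, and all distances tend to \<open>sqrt (1 - a\<^sup>2)\<close>, which is as small as desired.
\<close>

lemma dirichlet_nearly_equilateral: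
  fixes d :: real
  assumes d: "0 < d" "d < 1"
  shows "\<exists>z :: nat \<Rightarrow> complex. (\<forall>i<N. z i \<in> ball 0 1) \<and>
    (\<forall>i<N. \<forall>j<N. i \<noteq> j \<longrightarrow> d / 2 < kdist dirichlet_kernel (z i) (z j)
        \<and> kdist dirichlet_kernel (z i) (z j) < d)"
proof -
  \<comment> \<open>the limiting squared distance \<open>1 - a\<^sup>2 = d\<^sup>2 / 2\<close> lies between \<open>(d / 2)\<^sup>2\<close> and \<open>d\<^sup>2\<close>\<close>
  define a where "a = sqrt (1 - d\<^sup>2 / 2)"
  have d2: "0 < d\<^sup>2" "d\<^sup>2 < 1" using d by (auto simp: power_less_one_iff)
  have a2: "a\<^sup>2 = 1 - d\<^sup>2 / 2" using d2 by (simp add: a_def)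
  have a: "0 < a" "a \<le> 1" using d2 by (auto simp: a_def)
  \<comment> \<open>\<open>C\<close> collects the bounded errors: the two factors and the imaginary part of the logarithm\<close>
  define C where "C = ln (real N + 1) + ln 4 + pi"
  have lnN: "0 \<le> ln (real N + 1)" by simp
  have C: "C > 0" using lnN ln_gt_zero[of "4::real"] pi_gt_zero unfolding C_def by linarith
  define \<Lambda> where "\<Lambda> = 12 * C / d\<^sup>2 + 1 + ln (real N + 1) / a"
  define \<epsilon> h where "\<epsilon> = exp (- \<Lambda>)" and "h = exp (- (a * \<Lambda>))"
  have \<Lambda>: "\<Lambda> > 1" "12 * C / d\<^sup>2 < \<Lambda>" "ln (real N + 1) \<le> a * \<Lambda>"
  proof -
    have p: "12 * C / d\<^sup>2 > 0" "ln (real N + 1) / a \<ge> 0" using C d2 a lnN by auto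
    then show "\<Lambda> > 1" "12 * C / d\<^sup>2 < \<Lambda>" by (auto simp: \<Lambda>_def)
    have "ln (real N + 1) / a \<le> \<Lambda>" using p by (simp add: \<Lambda>_def)
    then show "ln (real N + 1) \<le> a * \<Lambda>" using a by (simp add: divide_le_eq mult.commute)
  qed
  have \<epsilon>0: "0 < \<epsilon>" by (simp add: \<epsilon>_def)
  have \<epsilon>h: "\<epsilon> \<le> h" using a \<Lambda>(1) by (simp add: \<epsilon>_def h_def)
  have \<epsilon>2: "\<epsilon> \<le> 1/2"
  proof -
    have "2 \<le> exp \<Lambda>" using exp_ge_add_one_self[of \<Lambda>] \<Lambda>(1) by linarith
    then show ?thesis by (simp add: \<epsilon>_def exp_minus field_simps)
  qed
  have Nh: "real N * h \<le> 1"
  proof -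
    have "h \<le> exp (- ln (real N + 1))" using \<Lambda>(3) by (simp add: h_def)
    also have "\<dots> = 1 / (real N + 1)" by (simp add: exp_minus inverse_eq_divide)
    finally have "real N * h \<le> real N * (1 / (real N + 1))" by (intro mult_left_mono) auto
    also have "\<dots> \<le> 1" by (simp add: divide_le_eq)
    finally show ?thesis .
  qed
  define r where "r = sqrt (1 - \<epsilon>)"
  have r2: "r * r = 1 - \<epsilon>" using \<epsilon>2 by (simp add: r_def)
  have r: "0 \<le> r" "r < 1" using \<epsilon>0 \<epsilon>2 by (auto simp: r_def)
  define z where "z j = of_real r * cis (real j * h)" for j :: nat
  have zz: "z i * cnj (z j) = of_real (1 - \<epsilon>) * cis ((real i - real j) * h)" for i j
    unfolding z_def by (simp add: cis_cnj cis_mult r2[symmetric] algebra_simps)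
  have ball: "z i \<in> ball 0 1" for i using r by (simp add: z_def norm_mult)
  have diag: "Re (dirichlet_kernel (z i) (z i)) = \<Lambda> / (1 - \<epsilon>)" for i
  proof -
    have z: "z i * cnj (z i) = of_real (1 - \<epsilon>)" using zz[of i i] by simp
    have "cmod (of_real (1 - \<epsilon>)) < 1" unfolding norm_of_real using \<epsilon>0 \<epsilon>2 by simp
    from log_kernel_Ln[OF this] have "of_real (1 - \<epsilon>) * log_kernel (complex_of_real (1 - \<epsilon>)) = - Ln (of_real \<epsilon>)"
      by simp
    also have "\<dots> = of_real \<Lambda>" using \<epsilon>0 by (simp add: Ln_of_real \<epsilon>_def)
    finally have "log_kernel (complex_of_real (1 - \<epsilon>)) = of_real (\<Lambda> / (1 - \<epsilon>))"
      using \<epsilon>2 by (simp add: field_simps)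
    then show ?thesis unfolding dirichlet_kernel_def z by (metis Re_complex_of_real)
  qed
  have main: "d / 2 < kdist dirichlet_kernel (z i) (z j) \<and> kdist dirichlet_kernel (z i) (z j) < d"
    if ij: "i < N" "j < N" "i \<noteq> j" for i j
  proof -
    define \<theta> where "\<theta> = (real i - real j) * h"
    have h0: "h > 0" by (simp add: h_def)
    have "1 \<le> \<bar>real i - real j\<bar>" "\<bar>real i - real j\<bar> \<le> real N" using ij by linarith+
    then have \<theta>: "h \<le> \<bar>\<theta>\<bar>" "\<bar>\<theta>\<bar> \<le> real N * h"
      using h0 by (auto simp: \<theta>_def abs_mult)
    define t where "t = of_real (1 - \<epsilon>) * cis \<theta>"
    have t1: "cmod t = 1 - \<epsilon>" using \<epsilon>2 by (simp add: t_def norm_mult del: of_real_diff)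
    have "\<bar>\<theta>\<bar> \<le> 1" using \<theta>(2) Nh by linarith
    note b = norm_one_minus_bounds[OF \<epsilon>0 \<epsilon>h \<epsilon>2 \<theta> this, folded t_def]
    have pos: "cmod (1 - t) > 0" using b(1) h0 by linarith
    define L where "L = ln (cmod (1 - t))"
    have "ln (h / 4) \<le> L" unfolding L_def using b(1) h0 pos by (subst ln_le_cancel_iff) auto
    then have L1: "- (a * \<Lambda>) - ln 4 \<le> L" using h0 by (simp add: ln_div) (simp add: h_def)
    have "L \<le> ln ((real N + 1) * h)" unfolding L_def using b(2) h0 pos by (subst ln_le_cancel_iff) auto
    then have L2: "L \<le> ln (real N + 1) - a * \<Lambda>" using h0 by (simp add: ln_mult) (simp add: h_def)
    define q where "q = cmod (Ln (1 - t))"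
    have ne: "1 - t \<noteq> 0" using pos by auto
    have ReL: "Re (Ln (1 - t)) = L" using ne by (simp add: L_def)
    have ImL: "\<bar>Im (Ln (1 - t))\<bar> \<le> pi"
      using mpi_less_Im_Ln[OF ne] Im_Ln_le_pi[OF ne] by linarith
    have q1: "a * \<Lambda> - C \<le> q"
      using abs_Re_le_cmod[of "Ln (1 - t)"] L2 pi_gt_zero ln_gt_zero[of "4::real"]
      unfolding ReL q_def[symmetric] C_def by linarith
    have q2: "q \<le> a * \<Lambda> + C"
    proof -
      have "\<bar>L\<bar> \<le> a * \<Lambda> + ln 4" using L1 L2 \<Lambda>(3) ln_gt_zero[of "4::real"] by linarith
      then show ?thesis
        using cmod_le[of "Ln (1 - t)"] ImL lnN unfolding ReL q_def[symmetric] C_def by linarith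
    qed
    define u where "u = q / \<Lambda>"
    define c where "c = C / \<Lambda>"
    have c: "0 < c" "12 * c < d\<^sup>2" using C \<Lambda> d2 by (auto simp: c_def field_simps)
    have "(a * \<Lambda> - C) / \<Lambda> \<le> u" "u \<le> (a * \<Lambda> + C) / \<Lambda>"
      unfolding u_def using \<Lambda>(1) by (intro divide_right_mono q1 q2; simp)+
    then have u: "a - c \<le> u" "u \<le> a + c" "0 \<le> u"
      using \<Lambda>(1) by (auto simp: u_def c_def q_def diff_divide_distrib add_divide_distrib)
    have "\<bar>u\<^sup>2 - a\<^sup>2\<bar> = \<bar>u - a\<bar> * (u + a)"
    proof -
      have "u\<^sup>2 - a\<^sup>2 = (u - a) * (u + a)" by (simp add: power2_eq_square algebra_simps)
      then show ?thesis using u a by (simp add: abs_mult)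
    qed
    also have "\<dots> \<le> c * 3"
      using u a c d2 by (intro mult_mono) auto
    finally have dev: "\<bar>u\<^sup>2 - a\<^sup>2\<bar> < d\<^sup>2 / 4" using c by simp
    have kn: "cmod (dirichlet_kernel (z i) (z j)) = q / (1 - \<epsilon>)"
    proof -
      have "cmod t < 1" using t1 \<epsilon>0 by simp
      from arg_cong[OF log_kernel_Ln[OF this], of cmod]
      have "(1 - \<epsilon>) * cmod (log_kernel t) = q" by (simp add: norm_mult t1 q_def)
      moreover have "z i * cnj (z j) = t" unfolding zz t_def \<theta>_def ..
      ultimately show ?thesis using \<epsilon>2 by (simp add: dirichlet_kernel_def field_simps)
    qed
    have "(q / (1 - \<epsilon>))\<^sup>2 / (\<Lambda> / (1 - \<epsilon>) * (\<Lambda> / (1 - \<epsilon>))) = u\<^sup>2"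
      using \<epsilon>2 \<Lambda>(1) by (simp add: u_def power2_eq_square)
    then have k: "kdist dirichlet_kernel (z i) (z j) = sqrt (1 - u\<^sup>2)"
      unfolding kdist_def kn diag by simp
    have "(d / 2)\<^sup>2 < 1 - u\<^sup>2" "1 - u\<^sup>2 < d\<^sup>2"
      using abs_less_iff[THEN iffD1, OF dev] d2 by (auto simp: a2 power_divide)
    then show ?thesis unfolding k using d real_less_rsqrt[of "d / 2" "1 - u\<^sup>2"]
        real_sqrt_less_mono[of "1 - u\<^sup>2" "d\<^sup>2"] by simp
  qed
  show ?thesis using ball main by (intro exI[of _ z]) blast
qed

section \<open>The embedding theorem\<close>

theorem theorem1p1:
  fixes H2 :: "(complex ^ 'n \<Rightarrow> complex) set"
    and ip :: "(complex ^ 'n \<Rightarrow> complex) \<Rightarrow> (complex ^ 'n \<Rightarrow> complex) \<Rightarrow> complex"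
  assumes "is_drury_arveson_space H2 ip"
  shows "\<not> (\<exists>b :: complex \<Rightarrow> complex ^ 'n.
            b \<in> ball 0 1 \<rightarrow> ball 0 1 \<and>
            (\<forall>\<phi> \<in> Mult (ball 0 1) H2.
               on_set (ball 0 1) (\<phi> \<circ> b) \<in> Mult (ball 0 1) dirichlet_space) \<and>
            (\<forall>\<psi> \<in> Mult (ball 0 1) dirichlet_space.
               \<exists>\<phi> \<in> Mult (ball 0 1) H2. \<psi> = on_set (ball 0 1) (\<phi> \<circ> b)))"
proof
  assume "\<exists>b :: complex \<Rightarrow> complex ^ 'n.
            b \<in> ball 0 1 \<rightarrow> ball 0 1 \<and>
            (\<forall>\<phi> \<in> Mult (ball 0 1) H2.
               on_set (ball 0 1) (\<phi> \<circ> b) \<in> Mult (ball 0 1) dirichlet_space) \<and>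
            (\<forall>\<psi> \<in> Mult (ball 0 1) dirichlet_space.
               \<exists>\<phi> \<in> Mult (ball 0 1) H2. \<psi> = on_set (ball 0 1) (\<phi> \<circ> b))"
  then obtain b :: "complex \<Rightarrow> complex ^ 'n" where b: "\<And>z. z \<in> ball 0 1 \<Longrightarrow> b z \<in> ball 0 1"
    and into: "\<And>\<phi>. \<phi> \<in> Mult (ball 0 1) H2 \<Longrightarrow>
      on_set (ball 0 1) (\<phi> \<circ> b) \<in> Mult (ball 0 1) dirichlet_space"
    and onto: "\<And>\<psi>. \<psi> \<in> Mult (ball 0 1) dirichlet_space \<Longrightarrow>
      \<exists>\<phi> \<in> Mult (ball 0 1) H2. \<psi> = on_set (ball 0 1) (\<phi> \<circ> b)"
    by blast
  note DA = drury_arveson_pick_space[OF assms]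
  have "\<exists>d>0. \<forall>z\<in>ball 0 1. \<forall>w\<in>ball 0 1. kdist dirichlet_kernel z w < d \<longrightarrow>
      kdist drury_arveson_kernel (b z) (b w) < 1/2"
  proof (rule kdist_transfer[OF dirichlet_pick_space DA, where p = "\<lambda>z. z" and q = b])
    fix \<phi> assume "\<phi> \<in> Mult (ball 0 1) H2"
    from into[OF this] show "\<exists>\<psi>\<in>Mult (ball 0 1) dirichlet_space. \<forall>z\<in>ball 0 1. \<phi> (b z) = \<psi> z"
      by (intro bexI[of _ "on_set (ball 0 1) (\<phi> \<circ> b)"]) (auto simp: on_set_def)
  qed (use b in auto)
  then obtain d0 where d0: "d0 > 0" "\<And>z w. z \<in> ball 0 1 \<Longrightarrow> w \<in> ball 0 1 \<Longrightarrow>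
      kdist dirichlet_kernel z w < d0 \<Longrightarrow> kdist drury_arveson_kernel (b z) (b w) < 1/2"
    by blast
  define d where "d = min d0 (1/2)"
  have d: "0 < d" "d < 1" "d \<le> d0" using d0 by (auto simp: d_def)
  have "\<exists>c>0. \<forall>z\<in>ball 0 1. \<forall>w\<in>ball 0 1. kdist drury_arveson_kernel (b z) (b w) < c \<longrightarrow>
      kdist dirichlet_kernel z w < d / 2"
  proof (rule kdist_transfer[OF DA dirichlet_pick_space, where p = b and q = "\<lambda>z. z"])
    fix \<psi> assume "\<psi> \<in> Mult (ball 0 1) dirichlet_space"
    from onto[OF this] show "\<exists>\<phi>\<in>Mult (ball 0 1) H2. \<forall>z\<in>ball 0 1. \<psi> z = \<phi> (b z)"
      by (auto simp: on_set_def)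
  qed (use b d in auto)
  then obtain c where c: "c > 0" "\<And>z w. z \<in> ball 0 1 \<Longrightarrow> w \<in> ball 0 1 \<Longrightarrow>
      kdist drury_arveson_kernel (b z) (b w) < c \<Longrightarrow> kdist dirichlet_kernel z w < d / 2"
    by blast
  obtain N where N: "\<And>x :: nat \<Rightarrow> complex ^ 'n. (\<forall>i<N. norm (x i) < 1) \<Longrightarrow>
     (\<forall>i<N. kdist drury_arveson_kernel (x 0) (x i) \<le> 1/2) \<Longrightarrow>
     (\<exists>i<N. \<exists>j<N. i \<noteq> j \<and> kdist drury_arveson_kernel (x i) (x j) < c)"
    using drury_arveson_packing[OF c(1), where 'n = 'n] by blast
  obtain z where z: "\<And>i. i < N \<Longrightarrow> z i \<in> ball (0::complex) 1"
    "\<And>i j. i < N \<Longrightarrow> j < N \<Longrightarrow> i \<noteq> j \<Longrightarrow> d / 2 < kdist dirichlet_kernel (z i) (z j)"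
    "\<And>i j. i < N \<Longrightarrow> j < N \<Longrightarrow> i \<noteq> j \<Longrightarrow> kdist dirichlet_kernel (z i) (z j) < d"
    using dirichlet_nearly_equilateral[OF d(1,2), of N] by blast
  have ball: "norm (b (z i)) < 1" if "i < N" for i using b[OF z(1)[OF that]] by simp
  have "kdist drury_arveson_kernel (b (z 0)) (b (z i)) \<le> 1/2" if i: "i < N" for i
  proof (cases "i = 0")
    case True
    then show ?thesis using kdist_drury_arveson_self[OF ball[OF i]] by simp
  next
    case False
    then have "0 < N" using i by simp
    then have "kdist dirichlet_kernel (z 0) (z i) < d0" using z(3)[OF _ i, of 0] False d by simp
    from d0(2)[OF z(1)[OF \<open>0 < N\<close>] z(1)[OF i] this] show ?thesis by simp
  qed
  then obtain i j where ij: "i < N" "j < N" "i \<noteq> j" "kdist drury_arveson_kernel (b (z i)) (b (z j)) < c"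
    using N[of "\<lambda>i. b (z i)"] ball by blast
  have "kdist dirichlet_kernel (z i) (z j) < d / 2"
    by (rule c(2)) (use z ij in auto)
  then show False using z(2)[OF ij(1,2,3)] by simp
qed

end
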